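(* The following gap holds for the Dirichlet energy $\widetilde E_0$: $$2\pi=\min_{u\in\widetilde{\mathcal{A}}_{\rm S}}\widetilde E_0(u)<\min_{u\in\widetilde{\mathcal{A}}_{\rm N}}\widetilde E_0(u)=6\pi.$$ In addition, the minimum value of $\widetilde E_0$ over $\widetilde{\mathcal{A}}_{\rm S}$ is uniquely achieved by $$u_{\rm S}(z):=\left(\frac{|z|^4-3}{|z|^4+3},\ 0,\ \frac{2\sqrt3\,z^2}{|z|^4+3}\right),$$ while the minimum value of $\widetilde E_0$ over $\widetilde{\mathcal{A}}_{\rm N}$ is attained at $u\in\widetilde{\mathcal{A}}_{\rm N}$ if and only if there exists $\mu_1\in\mathbb{C}$ such that $$u(z)=\frac1{D(z)}\Big(1-|\mu_1|^2|z|^2-3|z|^4+\tfrac{|\mu_1|^2}3|z|^6,\ 2\mu_1z(1-|z|^4),\ 2\sqrt3\,z^2\big(1+\tfrac{|\mu_1|^2}3|z|^2\big)\Big),$$ with $D(z):=1+|\mu_1|^2|z|^2+3|z|^4+\frac{|\mu_1|^2}3|z|^6$.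
   Context: $\mathbb{D}\subset\mathbb{C}$ is the open unit disc and $\mathbb{S}^4$ is the unit sphere of $\mathbb{R}\oplus\mathbb{C}\oplus\mathbb{C}\simeq\mathbb{R}^5$. For $u\in W^{1,2}(\mathbb{D};\mathbb{S}^4)$, $\widetilde E_0(u):=\int_{\mathbb{D}}\frac12|\nabla u|^2\,dx$. A map $u=(u_0,u_1,u_2):\mathbb{D}\to\mathbb{R}\oplus\mathbb{C}\oplus\mathbb{C}$ is $\mathbb{S}^1$-equivariant if $u(e^{i\alpha}z)=(u_0(z),e^{i\alpha}u_1(z),e^{2i\alpha}u_2(z))$ for every $\alpha\in\mathbb{R}$ and a.e. $z$. Let $g_{\overline H}(z):=(-\frac12,0,\frac{\sqrt3}2z^2)$ for $|z|=1$. $\widetilde{\mathcal{A}}^{\rm sym}_{g_{\overline H}}(\mathbb{D})$ is the set of $\mathbb{S}^1$-equivariant $u\in W^{1,2}(\mathbb{D};\mathbb{S}^4)$ with $u=g_{\overline H}$ on $\partial\mathbb{D}$. Such maps are continuous on $\overline{\mathbb{D}}$ with $u(0)=(\pm1,0,0)$; $\widetilde{\mathcal{A}}_{\rm N}$ (resp. $\widetilde{\mathcal{A}}_{\rm S}$) is the subset where $u(0)=(1,0,0)$ (resp. $u(0)=(-1,0,0)$). *)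

theory Defs
  imports "HOL-Analysis.Analysis"
begin

definition partial_deriv :: "'a \<Rightarrow> ('a::euclidean_space \<Rightarrow> 'b::euclidean_space) \<Rightarrow> 'a \<Rightarrow> 'b" where
  "partial_deriv b f x = frechet_derivative f (at x) b"

primrec C_diff :: "nat \<Rightarrow> ('a::euclidean_space \<Rightarrow> 'b::euclidean_space) \<Rightarrow> bool" where
  "C_diff 0 = (\<lambda>f. continuous_on UNIV f)"
| "C_diff (Suc k) = (\<lambda>f. (\<forall>x. f differentiable (at x)) \<and> (\<forall>b\<in>Basis. C_diff k (partial_deriv b f)))"

definition smooth :: "('a::euclidean_space \<Rightarrow> 'b::euclidean_space) \<Rightarrow> bool" where
  "smooth f \<longleftrightarrow> (\<forall>k. C_diff k f)"

definition test_function :: "'a::euclidean_space set \<Rightarrow> ('a \<Rightarrow> real) \<Rightarrow> bool" where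
  "test_function U \<phi> \<longleftrightarrow>
     smooth \<phi> \<and> compact (closure {x. \<phi> x \<noteq> 0}) \<and> closure {x. \<phi> x \<noteq> 0} \<subseteq> U"

definition locally_integrable :: "'a::euclidean_space set \<Rightarrow> ('a \<Rightarrow> 'b::euclidean_space) \<Rightarrow> bool" where
  "locally_integrable U f \<longleftrightarrow> (\<forall>K. compact K \<and> K \<subseteq> U \<longrightarrow> f absolutely_integrable_on K)"

definition square_integrable ::
    "'a::euclidean_space set \<Rightarrow> ('a \<Rightarrow> 'b::euclidean_space) \<Rightarrow> bool" where
  "square_integrable U f \<longleftrightarrow>
     f \<in> borel_measurable (lebesgue_on U) \<and> integrable (lebesgue_on U) (\<lambda>x. (norm (f x))\<^sup>2)"

definition has_weak_partial ::
    "'a::euclidean_space set \<Rightarrow> 'a \<Rightarrow> ('a \<Rightarrow> 'b::euclidean_space) \<Rightarrow> ('a \<Rightarrow> 'b) \<Rightarrow> bool" where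
  "has_weak_partial U b u v \<longleftrightarrow>
     locally_integrable U u \<and> locally_integrable U v \<and>
     (\<forall>\<phi>. test_function U \<phi> \<longrightarrow>
        (LINT x|lebesgue_on U. partial_deriv b \<phi> x *\<^sub>R u x) = - (LINT x|lebesgue_on U. \<phi> x *\<^sub>R v x))"

text \<open>For open \<open>U\<close>, weak derivatives are unique up to null sets, so the choice made by
  \<open>SOME\<close> does not affect integrals over \<open>U\<close>.\<close>

definition weak_partial ::
    "'a::euclidean_space set \<Rightarrow> 'a \<Rightarrow> ('a \<Rightarrow> 'b::euclidean_space) \<Rightarrow> 'a \<Rightarrow> 'b" where
  "weak_partial U b u = (SOME v. has_weak_partial U b u v)"

text \<open>The elements of \<open>W\<^sup>1\<^sup>,\<^sup>2(U)\<close> are represented by functions on the whole space. Their values outside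
  \<open>U\<close> and on null sets are irrelevant, so equality in \<open>W\<^sup>1\<^sup>,\<^sup>2(U)\<close> is equality almost everywhere
  on \<open>U\<close>.\<close>

definition W12 :: "'a::euclidean_space set \<Rightarrow> ('a \<Rightarrow> 'b::euclidean_space) set" where
  "W12 U = {u. square_integrable U u \<and>
               (\<forall>b\<in>Basis. \<exists>v. has_weak_partial U b u v \<and> square_integrable U v)}"

definition W12_norm :: "'a::euclidean_space set \<Rightarrow> ('a \<Rightarrow> 'b::euclidean_space) \<Rightarrow> real" where
  "W12_norm U u = sqrt ((LINT x|lebesgue_on U. (norm (u x))\<^sup>2) +
                        (\<Sum>b\<in>Basis. LINT x|lebesgue_on U. (norm (weak_partial U b u x))\<^sup>2))"

abbreviation unit_disc :: "complex set" where
  "unit_disc \<equiv> ball 0 1"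

text \<open>The \<open>L\<^sup>2\<close> trace on the unit circle: the trace operator is the continuous extension to
  \<open>W\<^sup>1\<^sup>,\<^sup>2\<close> of the restriction map on functions that are smooth up to the boundary.\<close>

definition has_trace :: "(complex \<Rightarrow> 'b::euclidean_space) \<Rightarrow> (complex \<Rightarrow> 'b) \<Rightarrow> bool" where
  "has_trace u g \<longleftrightarrow>
     u \<in> W12 unit_disc \<and> square_integrable {0..2 * pi} (\<lambda>t. g (cis t)) \<and>
     (\<exists>v :: nat \<Rightarrow> complex \<Rightarrow> 'b.
        (\<forall>n. smooth (v n)) \<and>
        (\<lambda>n. W12_norm unit_disc (\<lambda>z. v n z - u z)) \<longlonglongrightarrow> 0 \<and>
        (\<lambda>n. LINT t|lebesgue_on {0..2 * pi}. (norm (v n (cis t) - g (cis t)))\<^sup>2) \<longlonglongrightarrow> 0)"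


type_synonym R5 = "real \<times> complex \<times> complex"

definition rot_action :: "real \<Rightarrow> R5 \<Rightarrow> R5" where
  "rot_action \<alpha> = (\<lambda>(a, b, c). (a, cis \<alpha> * b, cis (2 * \<alpha>) * c))"

definition equivariant :: "(complex \<Rightarrow> R5) \<Rightarrow> bool" where
  "equivariant u \<longleftrightarrow>
     (\<forall>\<alpha>. AE z in lebesgue_on unit_disc. u (cis \<alpha> * z) = rot_action \<alpha> (u z))"

definition g_H :: "complex \<Rightarrow> R5" where
  "g_H z = (- 1 / 2, 0, of_real (sqrt 3 / 2) * z\<^sup>2)"

definition A_sym :: "(complex \<Rightarrow> R5) set" where
  "A_sym = {u. u \<in> W12 unit_disc \<and> (AE z in lebesgue_on unit_disc. u z \<in> sphere 0 1) \<and>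
               equivariant u \<and> has_trace u g_H}"

text \<open>The value at the origin is that of the continuous representative.\<close>

definition A_at_origin :: "R5 \<Rightarrow> (complex \<Rightarrow> R5) set" where
  "A_at_origin p = {u \<in> A_sym. \<exists>v. continuous_on (closure unit_disc) v \<and>
                      (AE z in lebesgue_on unit_disc. u z = v z) \<and> v 0 = p}"

definition A_N :: "(complex \<Rightarrow> R5) set" where
  "A_N = A_at_origin (1, 0, 0)"

definition A_S :: "(complex \<Rightarrow> R5) set" where
  "A_S = A_at_origin (- 1, 0, 0)"

definition E0 :: "(complex \<Rightarrow> R5) \<Rightarrow> real" where
  "E0 u = (LINT z|lebesgue_on unit_disc.
             1 / 2 * (\<Sum>b\<in>Basis. (norm (weak_partial unit_disc b u z))\<^sup>2))"

definition has_minimum :: "('a \<Rightarrow> real) \<Rightarrow> 'a set \<Rightarrow> real \<Rightarrow> bool" where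
  "has_minimum f A m \<longleftrightarrow> (\<exists>x\<in>A. f x = m) \<and> (\<forall>x\<in>A. m \<le> f x)"

definition u_S :: "complex \<Rightarrow> R5" where
  "u_S z = ((cmod z ^ 4 - 3) / (cmod z ^ 4 + 3),
            0,
            of_real (2 * sqrt 3) * z\<^sup>2 / of_real (cmod z ^ 4 + 3))"

definition D_N :: "complex \<Rightarrow> complex \<Rightarrow> real" where
  "D_N \<mu> z = 1 + (cmod \<mu>)\<^sup>2 * (cmod z)\<^sup>2 + 3 * cmod z ^ 4 + (cmod \<mu>)\<^sup>2 / 3 * cmod z ^ 6"

definition u_N :: "complex \<Rightarrow> complex \<Rightarrow> R5" where
  "u_N \<mu> z = (1 / D_N \<mu> z) *\<^sub>R
     (1 - (cmod \<mu>)\<^sup>2 * (cmod z)\<^sup>2 - 3 * cmod z ^ 4 + (cmod \<mu>)\<^sup>2 / 3 * cmod z ^ 6,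
      2 * \<mu> * z * of_real (1 - cmod z ^ 4),
      of_real (2 * sqrt 3) * z\<^sup>2 * of_real (1 + (cmod \<mu>)\<^sup>2 / 3 * (cmod z)\<^sup>2))"

end

theory Submission
  imports Defs
begin

text \<open>Calibration. For an equivariant map with profile \<open>f r = u r\<close>, the energy is
  \<open>\<pi> \<integral> (r \<bar>f'\<bar>\<^sup>2 + W(f) / r) dr\<close> with \<open>W(x, c\<^sub>1, c\<^sub>2) = \<bar>c\<^sub>1\<bar>\<^sup>2 + 4 \<bar>c\<^sub>2\<bar>\<^sup>2\<close>. On the sphere the function
  \<open>V = sqrt ((2 x + 1)\<^sup>2 + 3 \<bar>c\<^sub>1\<bar>\<^sup>2)\<close> solves the eikonal equation \<open>\<bar>\<nabla>V\<bar>\<^sup>2 = W\<close> away from its zeros, so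
  completing the square gives \<open>E = \<pi> \<integral> r \<bar>f' + \<nabla>V(f) / r\<bar>\<^sup>2 dr + 2 \<pi> (V(f(0)) - V(f(1)))\<close>.
  Since \<open>V\<close> vanishes on the boundary datum and equals 3 and 1 at the poles, the lower bounds are
  \<open>6 \<pi>\<close> and \<open>2 \<pi>\<close>, with equality exactly for solutions of the gradient flow \<open>r f' = - \<nabla>V(f)\<close>, which
  is integrated explicitly by means of first integrals.

  A Sobolev map has no classical radial derivative, so the argument is run on curves on the sphere
  obtained from the smooth maps approximating \<open>u\<close> in the definition of the trace, by averaging over
  the circle action and normalizing. They converge to \<open>f\<close> uniformly on every \<open>[\<epsilon>, 1]\<close>, and in the
  limit the vanishing of the squared term yields the flow equation in integrated form.\<close>

section \<open>Smooth functions and weak derivatives\<close>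

text \<open>In the variable \<open>ln r\<close> a profile is a particle on the sphere with potential
  \<open>-W\<close>, and \<open>V\<close> solves the Hamilton-Jacobi equation at energy 0. On the
  sphere \<open>V\<close> vanishes exactly on the circle orbit of the boundary datum. There it
  behaves like a multiple of the distance and is not differentiable, so the square can be completed
  only before the first zero of \<open>V\<close>. Since \<open>W = 3\<close> on that orbit, a
  profile that arrives before \<open>r = 1\<close> pays for the radii that remain.

  The two poles differ in stability. With the logistic variable \<open>\<kappa>\<close>, the south
  pole is \<open>\<kappa> = 1\<close>, attracting as \<open>r\<close> grows, so a profile starting
  there keeps \<open>\<kappa> = 1\<close> and is unique. The north pole is
  \<open>\<kappa> = 0\<close>, repelling, and is left along a one-parameter family; this parameter
  is the squared modulus of \<open>\<mu>\<close>, and the phase of \<open>c1\<close>, constant along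
  the flow, gives its argument.

  The energy is defined through a choice of weak derivative, hence the fundamental lemma of the
  calculus of variations at the start. Integration in polar coordinates rests on the invariance of
  Lebesgue measure under rotations.\<close>

lemma partial_deriv_eq: "(f has_derivative f') (at x) \<Longrightarrow> partial_deriv b f x = f' b"
  unfolding partial_deriv_def using frechet_derivative_at by metis

lemma C_diff_SucD: "C_diff (Suc k) f \<Longrightarrow> C_diff k f"
proof (induction k arbitrary: f)
  case 0
  then show ?case
    by (auto intro!: differentiable_imp_continuous_on simp: differentiable_on_def differentiable_at_withinI)
qed auto

lemma C_diff_imp_continuous: "C_diff k f \<Longrightarrow> continuous_on UNIV f"
  by (induction k) (use C_diff_SucD in \<open>auto simp del: C_diff.simps(2)\<close>)

lemma C_diff_const: "C_diff k (\<lambda>x. c)"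
proof (induction k arbitrary: c)
  case (Suc k)
  have "partial_deriv b (\<lambda>x::'a. c) = (\<lambda>x. 0)" for b
    by (intro ext partial_deriv_eq[where f'="\<lambda>x. 0", simplified]) auto
  then show ?case using Suc by simp
qed auto

lemma C_diff_bounded_linear: "bounded_linear f \<Longrightarrow> C_diff k f"
proof (cases k)
  case (Suc l)
  assume f: "bounded_linear f"
  have "partial_deriv b f = (\<lambda>x. f b)" for b
    by (intro ext partial_deriv_eq bounded_linear_imp_has_derivative f)
  with f Suc show ?thesis
    by (auto intro: bounded_linear_imp_differentiable C_diff_const)
qed (auto simp: linear_continuous_on)

lemma has_derivative_frechet: "f differentiable (at x) \<Longrightarrow> (f has_derivative (\<lambda>h. partial_deriv h f x)) (at x)"
  unfolding partial_deriv_def using frechet_derivative_works by fastforce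

lemma C_diff_add: "C_diff k f \<Longrightarrow> C_diff k g \<Longrightarrow> C_diff k (\<lambda>x. f x + g x)"
proof (induction k arbitrary: f g)
  case (Suc k)
  have d: "((\<lambda>x. f x + g x) has_derivative (\<lambda>h. partial_deriv h f x + partial_deriv h g x)) (at x)" for x
    using Suc.prems by (intro has_derivative_add has_derivative_frechet) auto
  then have "partial_deriv b (\<lambda>x. f x + g x) = (\<lambda>x. partial_deriv b f x + partial_deriv b g x)" for b
    by (intro ext) (rule partial_deriv_eq)
  then show ?case using Suc d by (auto intro: differentiableI)
qed (auto intro: continuous_intros)

text \<open>One induction covers scalar multiples, products and inner products. The product rule
  differentiates one factor at a time; the other factor is then used at the lower order, which
  \<open>C_diff_SucD\<close> supplies.\<close>

lemma C_diff_bilinear: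
  assumes "bounded_bilinear p"
  shows "C_diff k f \<Longrightarrow> C_diff k g \<Longrightarrow> C_diff k (\<lambda>x. p (f x) (g x))"
proof (induction k arbitrary: f g)
  case 0
  then show ?case using bounded_bilinear.continuous_on[OF assms] by auto
next
  case (Suc k)
  have d: "((\<lambda>x. p (f x) (g x)) has_derivative
      (\<lambda>h. p (f x) (partial_deriv h g x) + p (partial_deriv h f x) (g x))) (at x)" for x
    using Suc.prems by (intro bounded_bilinear.FDERIV[OF assms] has_derivative_frechet) auto
  then have "partial_deriv b (\<lambda>x. p (f x) (g x)) =
      (\<lambda>x. p (f x) (partial_deriv b g x) + p (partial_deriv b f x) (g x))" for b
    by (intro ext) (rule partial_deriv_eq)
  moreover have "C_diff k f" "C_diff k g" using Suc.prems C_diff_SucD by auto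
  ultimately show ?case using Suc d by (auto intro!: C_diff_add differentiableI)
qed

lemmas C_diff_scaleR = C_diff_bilinear[OF bounded_bilinear_scaleR]
lemmas C_diff_mult = C_diff_bilinear[OF bounded_bilinear_mult]
lemmas C_diff_inner = C_diff_bilinear[OF bounded_bilinear_inner]

text \<open>A special case of the bilinear rule: \<open>h (f x)\<close> is the bilinear expression
  \<open>a *\<^sub>R h y\<close> with the constant first factor \<open>a = 1\<close>.\<close>

lemma C_diff_linear_compose:
  assumes "bounded_linear h" "C_diff k f"
  shows "C_diff k (\<lambda>x. h (f x))"
proof -
  have "bounded_bilinear (\<lambda>(a::real) y. a *\<^sub>R h y)"
    by (intro bounded_bilinear.comp[OF bounded_bilinear_scaleR] bounded_linear_ident assms)
  from C_diff_bilinear[OF this C_diff_const[of k 1] assms(2)] show ?thesis by simp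
qed

lemma C_diff_Pair:
  assumes "C_diff k f" "C_diff k g"
  shows "C_diff k (\<lambda>x. (f x, g x))"
proof -
  have "bounded_linear (\<lambda>y. (y, 0))" "bounded_linear (\<lambda>y. (0, y))"
    by (intro bounded_linear_Pair bounded_linear_ident bounded_linear_zero)+
  from C_diff_add[OF C_diff_linear_compose[OF this(1) assms(1)] C_diff_linear_compose[OF this(2) assms(2)]]
  show ?thesis by simp
qed

text \<open>The derivative contains \<open>inverse (f x)\<close> again; the induction closes because
  that factor is wanted only at the lower order.\<close>

lemma C_diff_inverse:
  fixes f :: "'a::euclidean_space \<Rightarrow> real"
  assumes "\<And>x. f x \<noteq> 0"
  shows "C_diff k f \<Longrightarrow> C_diff k (\<lambda>x. inverse (f x))"
proof (induction k)
  case 0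
  then show ?case using assms by (auto intro!: continuous_intros)
next
  case (Suc k)
  have d: "((\<lambda>x. inverse (f x)) has_derivative
      (\<lambda>h. - (inverse (f x) * partial_deriv h f x * inverse (f x)))) (at x)" for x
    using Suc.prems assms by (intro Deriv.has_derivative_inverse has_derivative_frechet) auto
  then have "partial_deriv b (\<lambda>x. inverse (f x)) =
      (\<lambda>x. - (inverse (f x) * partial_deriv b f x * inverse (f x)))" for b
    by (intro ext) (simp add: partial_deriv_eq[OF d])
  moreover have "C_diff k (\<lambda>x. inverse (f x))" using Suc C_diff_SucD by blast
  ultimately show ?case using Suc d
    by (auto intro!: C_diff_mult C_diff_linear_compose[OF bounded_linear_minus[OF bounded_linear_ident]] differentiableI)
qed

text \<open>The induction generalizes the outer function alone: the chain rule replaces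
  \<open>h\<close> by its derivative and keeps \<open>f\<close> as inner function.\<close>

lemma C_diff_compose_real:
  fixes h :: "real \<Rightarrow> real" and f :: "'a::euclidean_space \<Rightarrow> real"
  shows "C_diff k h \<Longrightarrow> C_diff k f \<Longrightarrow> C_diff k (\<lambda>x. h (f x))"
proof (induction k arbitrary: h)
  case 0
  then show ?case by (auto intro: continuous_on_compose2)
next
  case (Suc k)
  have d: "((\<lambda>x. h (f x)) has_derivative (\<lambda>b. partial_deriv b f x * partial_deriv 1 h (f x))) (at x)" for x
  proof -
    have a: "(h has_derivative (\<lambda>b. partial_deriv b h (f x))) (at (f x))"
      using Suc.prems by (intro has_derivative_frechet) auto
    have e: "partial_deriv b h y = b * partial_deriv 1 h y" for b y
    proof -
      have "linear (frechet_derivative h (at y))"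
        using Suc.prems by (intro linear_frechet_derivative) auto
      from linear_scale[OF this, of b 1] show ?thesis by (simp add: partial_deriv_def)
    qed
    have h: "(h has_derivative (\<lambda>b. b * partial_deriv 1 h (f x))) (at (f x))"
      using a by (rule has_derivative_eq_rhs) (intro ext e)
    have "(f has_derivative (\<lambda>b. partial_deriv b f x)) (at x)"
      using Suc.prems by (intro has_derivative_frechet) auto
    from has_derivative_compose[OF this h] show ?thesis .
  qed
  then have "partial_deriv b (\<lambda>x. h (f x)) =
      (\<lambda>x. partial_deriv b f x * partial_deriv 1 h (f x))" for b
    by (intro ext) (rule partial_deriv_eq)
  moreover have "C_diff k (\<lambda>x. partial_deriv 1 h (f x))"
    by (rule Suc.IH) (use Suc.prems in simp, rule C_diff_SucD, rule Suc.prems)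
  ultimately show ?case using Suc d by (auto intro!: C_diff_mult differentiableI)
qed

lemma C_diff_prod:
  fixes f :: "'i \<Rightarrow> 'a::euclidean_space \<Rightarrow> real"
  assumes "finite I" "\<And>i. i \<in> I \<Longrightarrow> C_diff k (f i)"
  shows "C_diff k (\<lambda>x. \<Prod>i\<in>I. f i x)"
  using assms by (induction) (auto intro!: C_diff_mult C_diff_const)

section \<open>Smooth bump functions on boxes\<close>

definition flat_exp :: "nat \<Rightarrow> real \<Rightarrow> real" where
  "flat_exp n t = (if t > 0 then (1 / t) ^ n * exp (- (1 / t)) else 0)"

text \<open>The classical flat function is the case \<open>n = 0\<close>. Differentiation only
  raises the power of \<open>1 / t\<close>, so the whole family is closed under it up to linear
  combinations, and smoothness becomes a single induction.\<close>

lemma flat_exp_has_derivative: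
  "(flat_exp n has_real_derivative flat_exp (n + 2) t - n * flat_exp (n + 1) t) (at t)"
proof (cases "t > 0")
  case True
  have "((\<lambda>t. (1 / t) ^ n * exp (- (1 / t))) has_real_derivative
      flat_exp (n + 2) t - n * flat_exp (n + 1) t) (at t)"
  proof -
    have i: "((\<lambda>t. 1 / t) has_real_derivative - (1 / t * (1 / t))) (at t)"
      using True by (auto intro!: derivative_eq_intros simp: field_simps power2_eq_square)
    have "((\<lambda>t. (1 / t) ^ n * exp (- (1 / t))) has_real_derivative
        (real n * (1 / t) ^ (n - Suc 0) * - (1 / t * (1 / t))) * exp (- (1 / t))
        + exp (- (1 / t)) * - (- (1 / t * (1 / t))) * (1 / t) ^ n) (at t)"
      by (intro DERIV_mult DERIV_fun_exp DERIV_minus DERIV_chain2[OF DERIV_pow] i)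
    then show ?thesis
      by (rule DERIV_cong) (use True in \<open>cases n; simp add: flat_exp_def algebra_simps add_divide_distrib\<close>)
  qed
  then show ?thesis
    by (rule has_field_derivative_transform_within[where d=t]) (use True in \<open>auto simp: flat_exp_def dist_real_def\<close>)
next
  case False
  show ?thesis
  proof (cases "t < 0")
    case True
    have "((\<lambda>t. 0) has_real_derivative 0) (at t)" by simp
    then have "(flat_exp n has_real_derivative 0) (at t)"
      by (rule has_field_derivative_transform_within[where d="-t"]) (use True in \<open>auto simp: flat_exp_def dist_real_def\<close>)
    with True show ?thesis by (simp add: flat_exp_def)
  next
    case False
    with \<open>\<not> 0 < t\<close> have t: "t = 0" by simp
    \<comment> \<open>At 0 the difference quotient of \<open>flat_exp n\<close> is
      \<open>flat_exp (n + 1)\<close>, which tends to 0 from the right by exponential decay and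
      vanishes on the left.\<close>
    have "((\<lambda>h. (1 / h) ^ (n + 1) * exp (- (1 / h))) \<longlongrightarrow> 0) (at_right (0::real))"
    proof -
      have "((\<lambda>y::real. y ^ (n + 1) / exp y) \<longlongrightarrow> 0) at_top" by (rule tendsto_power_div_exp_0)
      from filterlim_compose[OF this filterlim_inverse_at_top_right] show ?thesis
        by (simp add: exp_minus field_simps)
    qed
    then have "(flat_exp (n + 1) \<longlongrightarrow> 0) (at_right 0)"
      by (rule Lim_transform_eventually) (auto simp: flat_exp_def eventually_at_right_less eventually_at intro!: exI[of _ 1])
    moreover have "(flat_exp (n + 1) \<longlongrightarrow> 0) (at_left 0)"
      by (rule tendsto_eventually) (auto simp: flat_exp_def eventually_at_filter)
    ultimately have "(flat_exp (n + 1) \<longlongrightarrow> 0) (at 0)" by (simp add: filterlim_split_at)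
    then have "((\<lambda>h. (flat_exp n (0 + h) - flat_exp n 0) / h) \<longlongrightarrow> 0) (at 0)"
      by (rule Lim_transform_eventually) (auto simp: flat_exp_def eventually_at_filter)
    then show ?thesis unfolding t DERIV_def by (simp add: flat_exp_def)
  qed
qed

lemma C_diff_flat_exp: "C_diff k (flat_exp n)"
proof (induction k arbitrary: n)
  case 0
  show ?case using flat_exp_has_derivative
    by (auto intro!: continuous_at_imp_continuous_on DERIV_isCont)
next
  case (Suc k)
  have "partial_deriv 1 (flat_exp n) = (\<lambda>t. flat_exp (n + 2) t + (- real n) * flat_exp (n + 1) t)"
    by (intro ext) (simp add: partial_deriv_eq[OF flat_exp_has_derivative[unfolded has_field_derivative_def]])
  moreover have "C_diff k (\<lambda>t. flat_exp (n + 2) t + (- real n) * flat_exp (n + 1) t)"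
    by (intro C_diff_add C_diff_mult C_diff_const Suc)
  ultimately show ?case
    using flat_exp_has_derivative real_differentiable_def by auto
qed

text \<open>The factor \<open>n\<close> inside the arguments takes the place of a mollification: for
  growing \<open>n\<close> the functions stay between 0 and 1 and tend pointwise to the indicator of
  the open box, which is what dominated convergence asks for.\<close>

definition box_bump :: "'a::euclidean_space \<Rightarrow> 'a \<Rightarrow> nat \<Rightarrow> 'a \<Rightarrow> real" where
  "box_bump a b n x = (\<Prod>i\<in>Basis. flat_exp 0 (real n * (x \<bullet> i - a \<bullet> i)) * flat_exp 0 (real n * (b \<bullet> i - x \<bullet> i)))"

lemma smooth_box_bump: "smooth (box_bump a b n)"
proof -
  have *: "C_diff k (\<lambda>x::'a. real n * (x \<bullet> i - a \<bullet> i))" "C_diff k (\<lambda>x::'a. real n * (b \<bullet> i - x \<bullet> i))" for k i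
    using C_diff_add[OF C_diff_bounded_linear[OF bounded_linear_inner_left[of "real n *\<^sub>R i"]] C_diff_const[of k "- real n * (a \<bullet> i)"]]
      C_diff_add[OF C_diff_bounded_linear[OF bounded_linear_inner_left[of "- real n *\<^sub>R i"]] C_diff_const[of k "real n * (b \<bullet> i)"]]
    by (auto simp: algebra_simps)
  then show ?thesis
    unfolding smooth_def box_bump_def
    by (intro allI C_diff_prod C_diff_compose_real[OF C_diff_flat_exp] * C_diff_mult[where f="\<lambda>x. flat_exp _ (_ x)"]) auto
qed

lemma box_bump_zero: "x \<notin> box a b \<Longrightarrow> box_bump a b n x = 0"
  unfolding box_bump_def by (auto simp: box_def flat_exp_def zero_less_mult_iff intro!: prod_zero)

lemma box_bump_abs_le: "\<bar>box_bump a b n x\<bar> \<le> 1"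
proof -
  have "0 \<le> flat_exp 0 t" "flat_exp 0 t \<le> 1" for t by (auto simp: flat_exp_def)
  then have "0 \<le> box_bump a b n x" "box_bump a b n x \<le> 1"
    unfolding box_bump_def by (auto intro!: prod_nonneg prod_le_1 mult_le_one)
  then show ?thesis by simp
qed

lemma box_bump_tendsto: "(\<lambda>n. box_bump a b n x) \<longlonglongrightarrow> indicator (box a b) x"
proof (cases "x \<in> box a b")
  case True
  have *: "(\<lambda>n. flat_exp 0 (real n * t)) \<longlonglongrightarrow> 1" if "t > 0" for t
  proof -
    have "(\<lambda>n. exp (- (1 / (real n * t)))) \<longlonglongrightarrow> exp (- 0)"
      using that by (intro tendsto_intros tendsto_divide_0[OF tendsto_const] filterlim_at_top_imp_at_infinity
          filterlim_at_top_mult_tendsto_pos[OF tendsto_const that filterlim_real_sequentially])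
    moreover have "\<forall>\<^sub>F n in sequentially. exp (- (1 / (real n * t))) = flat_exp 0 (real n * t)"
      using that by (auto simp: flat_exp_def eventually_sequentially intro!: exI[of _ 1])
    ultimately show ?thesis using Lim_transform_eventually by force
  qed
  have "(\<lambda>n. box_bump a b n x) \<longlonglongrightarrow> (\<Prod>i\<in>(Basis::'a set). 1 * 1)"
    unfolding box_bump_def by (intro tendsto_prod tendsto_mult *) (use True in \<open>auto simp: box_def\<close>)
  with True show ?thesis by simp
qed (simp add: box_bump_zero)

lemma test_function_box_bump:
  assumes "cbox a b \<subseteq> U"
  shows "test_function U (box_bump a b n)"
proof -
  have "closure {x. box_bump a b n x \<noteq> 0} \<subseteq> cbox a b"
    using box_bump_zero box_subset_cbox by (intro closure_minimal) blast+
  then show ?thesis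
    unfolding test_function_def using smooth_box_bump assms
    by (metis bounded_cbox bounded_subset closed_closure compact_eq_bounded_closed subset_trans)
qed

section \<open>Integration by parts and weak derivatives\<close>

lemma linear_partial_deriv: "f differentiable (at x) \<Longrightarrow> linear (\<lambda>h. partial_deriv h f x)"
  using has_derivative_frechet has_derivative_linear by blast

lemma has_vector_derivative_compose_partial:
  assumes "f differentiable (at (\<gamma> t))" "(\<gamma> has_vector_derivative h) (at t within S)"
  shows "((\<lambda>t. f (\<gamma> t)) has_vector_derivative partial_deriv h f (\<gamma> t)) (at t within S)"
  using has_derivative_compose[OF assms(2)[unfolded has_vector_derivative_def] has_derivative_frechet[OF assms(1)]]
  by (simp add: has_vector_derivative_def linear_scale[OF linear_partial_deriv[OF assms(1)]])

lemma integrable_lborel_compact_support: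
  fixes g :: "'a::euclidean_space \<Rightarrow> 'b::euclidean_space"
  assumes "continuous_on UNIV g" "compact K" "\<And>x. x \<notin> K \<Longrightarrow> g x = 0"
  shows "integrable lborel g"
proof -
  have "integrable lborel (\<lambda>x. indicator K x *\<^sub>R g x)"
    using assms(2) continuous_on_subset[OF assms(1) subset_UNIV] by (rule borel_integrable_compact)
  moreover have "(\<lambda>x. indicator K x *\<^sub>R g x) = g" using assms(3) by (auto simp: indicator_def)
  ultimately show ?thesis by simp
qed

text \<open>Lebesgue measure is translation invariant, so every difference quotient of
  \<open>g\<close> in direction \<open>b\<close> has integral 0. The quotients converge to the
  derivative, and dominated convergence carries the value 0 to the limit.\<close>

lemma integral_partial_deriv_eq_0:
  fixes g :: "'a::euclidean_space \<Rightarrow> 'b::euclidean_space"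
  assumes g: "C_diff (Suc 0) g" and K: "compact K" "\<And>x. x \<notin> K \<Longrightarrow> g x = 0" and b: "b \<in> Basis"
  shows "(LINT x|lborel. partial_deriv b g x) = 0"
proof -
  obtain R where R: "K \<subseteq> ball 0 R" using compact_imp_bounded[OF K(1)] bounded_subset_ballD by blast
  have diff: "g differentiable (at x)" for x using g by simp
  have cont: "continuous_on UNIV (partial_deriv b g)" using g b by simp
  \<comment> \<open>The steps \<open>h n\<close> are at most 1, so the quotients vanish outside the
    ball of radius \<open>R + 1\<close>; the mean value estimate there looks at the derivative up to
    radius \<open>R + 2\<close>.\<close>
  have "bounded (partial_deriv b g ` cball 0 (R + 2))"
    by (intro compact_imp_bounded compact_continuous_image continuous_on_subset[OF cont]) auto
  then obtain M where M: "M > 0" "\<And>x. norm x \<le> R + 2 \<Longrightarrow> norm (partial_deriv b g x) \<le> M"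
    unfolding bounded_pos by auto
  define h where "h n = 1 / (real n + 1)" for n
  have h: "0 < h n" "h n \<le> 1" for n by (auto simp: h_def field_simps)
  define q where "q n x = (g (x + h n *\<^sub>R b) - g x) /\<^sub>R h n" for n x
  have gi: "integrable lborel g"
    using C_diff_imp_continuous[OF g] K by (rule integrable_lborel_compact_support)
  have gi': "integrable lborel (\<lambda>x. g (x + h n *\<^sub>R b))" "(LINT x|lborel. g (x + h n *\<^sub>R b)) = (LINT x|lborel. g x)" for n
  proof -
    have d: "lborel = distr lborel borel (\<lambda>x. x + h n *\<^sub>R b)"
    proof -
      have "(\<lambda>x. x + h n *\<^sub>R b) = (+) (h n *\<^sub>R b)" by (simp add: fun_eq_iff add.commute)
      then show ?thesis by (simp only: lborel_distr_plus)
    qed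
    have [measurable]: "g \<in> borel_measurable borel" using gi by auto
    show "integrable lborel (\<lambda>x. g (x + h n *\<^sub>R b))"
      using gi by (subst (asm) d) (simp add: integrable_distr_eq)
    show "(LINT x|lborel. g (x + h n *\<^sub>R b)) = (LINT x|lborel. g x)"
      by (subst (2) d) (simp add: integral_distr)
  qed
  have "(\<lambda>n. LINT x|lborel. q n x) \<longlonglongrightarrow> (LINT x|lborel. partial_deriv b g x)"
  proof (rule integral_dominated_convergence[where w="\<lambda>x. indicator (cball 0 (R + 1)) x *\<^sub>R M"])
    show "partial_deriv b g \<in> borel_measurable lborel" using borel_measurable_continuous_onI[OF cont] by simp
    show "q n \<in> borel_measurable lborel" for n
      using gi gi'(1)[of n] unfolding q_def by (intro borel_measurable_integrable) auto
    show "integrable lborel (\<lambda>x::'a. indicator (cball 0 (R + 1)) x *\<^sub>R M)"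
      by (intro borel_integrable_compact) auto
    show "AE x in lborel. (\<lambda>n. q n x) \<longlonglongrightarrow> partial_deriv b g x"
    proof (rule AE_I2)
      fix x
      have "((\<lambda>t. g (x + t *\<^sub>R b)) has_vector_derivative partial_deriv b g (x + 0 *\<^sub>R b)) (at 0)"
        by (intro has_vector_derivative_compose_partial diff) (auto intro!: derivative_eq_intros)
      then have l: "((\<lambda>t. (g (x + t *\<^sub>R b) - g x) /\<^sub>R t) \<longlongrightarrow> partial_deriv b g x) (at 0)"
      proof -
        assume "((\<lambda>t. g (x + t *\<^sub>R b)) has_vector_derivative partial_deriv b g (x + 0 *\<^sub>R b)) (at 0)"
        then have "((\<lambda>t. norm ((g (x + t *\<^sub>R b) - g x - t *\<^sub>R partial_deriv b g x) /\<^sub>R norm t)) \<longlongrightarrow> 0) (at 0)"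
          by (auto simp: has_vector_derivative_def has_derivative_def dest: tendsto_norm_zero)
        then have "((\<lambda>t. norm ((g (x + t *\<^sub>R b) - g x) /\<^sub>R t - partial_deriv b g x)) \<longlongrightarrow> 0) (at 0)"
        proof (rule Lim_transform_eventually)
          have "norm ((y - t *\<^sub>R v) /\<^sub>R norm t) = norm (y /\<^sub>R t - v)" if "t \<noteq> 0" for t :: real and y v :: 'b
          proof -
            have "y /\<^sub>R t - v = (y - t *\<^sub>R v) /\<^sub>R t" using that by (simp add: scaleR_diff_right)
            then show ?thesis by simp
          qed
          then show "\<forall>\<^sub>F t in at 0. norm ((g (x + t *\<^sub>R b) - g x - t *\<^sub>R partial_deriv b g x) /\<^sub>R norm t)
              = norm ((g (x + t *\<^sub>R b) - g x) /\<^sub>R t - partial_deriv b g x)"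
            by (auto simp: eventually_at_filter)
        qed
        then show ?thesis by (simp add: tendsto_norm_zero_iff LIM_zero_iff)
      qed
      have "h = (\<lambda>n. inverse (real (Suc n)))" by (simp add: h_def fun_eq_iff inverse_eq_divide add.commute)
      then have "h \<longlonglongrightarrow> 0" using LIMSEQ_inverse_real_of_nat by simp
      then have "filterlim h (at 0) sequentially"
        using h(1) by (auto simp: filterlim_at less_imp_neq[symmetric] intro!: always_eventually)
      from filterlim_compose[OF l this] show "(\<lambda>n. q n x) \<longlonglongrightarrow> partial_deriv b g x"
        by (simp add: q_def)
    qed
    show "AE x in lborel. norm (q n x) \<le> indicator (cball 0 (R + 1)) x *\<^sub>R M" for n
    proof (rule AE_I2)
      fix x
      have nb: "norm (h n *\<^sub>R b) \<le> 1" using h[of n] b by simp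
      show "norm (q n x) \<le> indicator (cball 0 (R + 1)) x *\<^sub>R M"
      proof (cases "x \<in> cball 0 (R + 1)")
        case True
        have "norm (g (x + h n *\<^sub>R b) - g (x + 0 *\<^sub>R b)) \<le> M * norm (h n - 0)"
        proof (rule differentiable_bound[where S="{0..h n}" and f="\<lambda>t. g (x + t *\<^sub>R b)" and f'="\<lambda>t s. s *\<^sub>R partial_deriv b g (x + t *\<^sub>R b)"])
          fix t assume t: "t \<in> {0..h n}"
          have "((\<lambda>t. g (x + t *\<^sub>R b)) has_vector_derivative partial_deriv b g (x + t *\<^sub>R b)) (at t within {0..h n})"
            by (intro has_vector_derivative_compose_partial diff) (auto intro!: derivative_eq_intros)
          then show "((\<lambda>t. g (x + t *\<^sub>R b)) has_derivative (\<lambda>s. s *\<^sub>R partial_deriv b g (x + t *\<^sub>R b))) (at t within {0..h n})"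
            by (simp add: has_vector_derivative_def)
          have "norm (x + t *\<^sub>R b) \<le> norm x + norm (t *\<^sub>R b)" by (rule norm_triangle_ineq)
          also have "\<dots> \<le> R + 2" using True t h(2)[of n] b by auto
          finally have "norm (partial_deriv b g (x + t *\<^sub>R b)) \<le> M" by (rule M(2))
          then show "onorm (\<lambda>s. s *\<^sub>R partial_deriv b g (x + t *\<^sub>R b)) \<le> M"
            using M(1) by (intro onorm_bound) (auto simp: mult.commute[of M] intro: mult_left_mono)
        qed (use h(1)[of n] in auto)
        then have le: "norm (g (x + h n *\<^sub>R b) - g x) \<le> M * h n"
          using h(1)[of n] by simp
        have "norm (q n x) = inverse (h n) * norm (g (x + h n *\<^sub>R b) - g x)"
          using h(1)[of n] by (simp add: q_def)
        also have "\<dots> \<le> inverse (h n) * (M * h n)"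
          using h(1)[of n] le by (intro mult_left_mono) auto
        also have "\<dots> = M" using h(1)[of n] by simp
        finally have "norm (q n x) \<le> M" .
        with True show ?thesis by simp
      next
        case False
        then have "norm x > R + 1" by simp
        moreover have "norm x \<le> norm (x + h n *\<^sub>R b) + norm (h n *\<^sub>R b)" using norm_triangle_ineq4[of "x + h n *\<^sub>R b" "h n *\<^sub>R b"] by simp
        ultimately have "x \<notin> K" "x + h n *\<^sub>R b \<notin> K" using R nb by auto
        with K(2) False show ?thesis by (simp add: q_def)
      qed
    qed
  qed
  moreover have "(LINT x|lborel. q n x) = 0" for n
    unfolding q_def using gi gi'[of n] by (simp add: Bochner_Integration.integral_diff)
  ultimately show ?thesis by (simp add: LIMSEQ_const_iff)
qed

lemma lebesgue_on_integral_eq_lborel: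
  fixes f :: "'a::euclidean_space \<Rightarrow> 'b::euclidean_space"
  assumes "U \<in> sets lebesgue" "f \<in> borel_measurable lborel" "\<And>x. x \<notin> U \<Longrightarrow> f x = 0"
  shows "(LINT x|lebesgue_on U. f x) = (LINT x|lborel. f x)"
proof -
  have "(\<lambda>x. indicator U x *\<^sub>R f x) = f" using assms(3) by (auto simp: indicator_def)
  then show ?thesis
    using assms by (simp add: integral_restrict_space integral_completion)
qed

lemma absolutely_integrable_on_compact:
  fixes f :: "'a::euclidean_space \<Rightarrow> 'b::euclidean_space"
  assumes "compact K" "continuous_on K f"
  shows "f absolutely_integrable_on K"
proof -
  have "integrable lborel (\<lambda>x. indicator K x *\<^sub>R f x)" using assms by (rule borel_integrable_compact)
  then show ?thesis
    unfolding set_integrable_def by (subst integrable_completion) auto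
qed

lemma locally_integrable_continuous:
  assumes "continuous_on U f"
  shows "locally_integrable U f"
  unfolding locally_integrable_def
  by (intro allI impI absolutely_integrable_on_compact continuous_on_subset[OF assms]) auto

lemma test_functionD:
  assumes "test_function U \<phi>"
  obtains K where "compact K" "K \<subseteq> U" "\<And>x. x \<notin> K \<Longrightarrow> \<phi> x = 0" "\<And>x b. x \<notin> K \<Longrightarrow> partial_deriv b \<phi> x = 0"
    "continuous_on UNIV \<phi>" "\<And>b. b \<in> Basis \<Longrightarrow> continuous_on UNIV (partial_deriv b \<phi>)"
proof
  define K where "K = closure {x. \<phi> x \<noteq> 0}"
  show K: "compact K" "K \<subseteq> U" using assms by (auto simp: test_function_def K_def)
  show z: "\<phi> x = 0" if "x \<notin> K" for x
    using that subsetD[OF closure_subset, of x "{x. \<phi> x \<noteq> 0}"] unfolding K_def by blast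
  show "partial_deriv b \<phi> x = 0" if "x \<notin> K" for b x
  proof -
    have "((\<lambda>x. 0) has_derivative (\<lambda>x. 0)) (at x)" by simp
    then have "(\<phi> has_derivative (\<lambda>x. 0)) (at x)"
      by (rule has_derivative_transform_within_open[where s="- K"])
        (use that z K(1) in \<open>simp_all add: open_Compl compact_imp_closed\<close>)
    then show ?thesis by (rule partial_deriv_eq)
  qed
  have "C_diff 0 \<phi>" "C_diff (Suc 0) \<phi>" using assms by (auto simp: test_function_def smooth_def simp del: C_diff.simps)
  then show "continuous_on UNIV \<phi>" "\<And>b. b \<in> Basis \<Longrightarrow> continuous_on UNIV (partial_deriv b \<phi>)" by auto
qed

text \<open>Integration by parts: the product of the test function and \<open>u\<close> is
  continuously differentiable with compact support, so its derivative has integral 0 over the whole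
  space, and the product rule splits this integral into the two sides.\<close>

lemma has_weak_partial_classical:
  fixes u :: "'a::euclidean_space \<Rightarrow> 'b::euclidean_space"
  assumes U: "open U" and u: "C_diff (Suc 0) u" and b: "b \<in> Basis"
  shows "has_weak_partial U b u (partial_deriv b u)"
  unfolding has_weak_partial_def
proof (intro conjI allI impI)
  have c: "continuous_on UNIV u" "continuous_on UNIV (partial_deriv b u)"
    using C_diff_imp_continuous[OF u] u b by auto
  then show "locally_integrable U u" "locally_integrable U (partial_deriv b u)"
    by (auto intro!: locally_integrable_continuous continuous_on_subset[OF _ subset_UNIV])
  fix \<phi> :: "'a \<Rightarrow> real" assume t: "test_function U \<phi>"
  then obtain K where K: "compact K" "K \<subseteq> U" "\<And>x. x \<notin> K \<Longrightarrow> \<phi> x = 0" "\<And>x b. x \<notin> K \<Longrightarrow> partial_deriv b \<phi> x = 0"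
    "continuous_on UNIV \<phi>" "\<And>b. b \<in> Basis \<Longrightarrow> continuous_on UNIV (partial_deriv b \<phi>)"
    by (rule test_functionD) blast
  have "C_diff (Suc 0) \<phi>" using t by (auto simp: test_function_def smooth_def simp del: C_diff.simps)
  note C1 = C_diff_scaleR[OF this u]
  have pd: "partial_deriv b (\<lambda>x. \<phi> x *\<^sub>R u x) x = \<phi> x *\<^sub>R partial_deriv b u x + partial_deriv b \<phi> x *\<^sub>R u x" for x
    using \<open>C_diff (Suc 0) \<phi>\<close> u
    by (intro partial_deriv_eq bounded_bilinear.FDERIV[OF bounded_bilinear_scaleR] has_derivative_frechet) auto
  have i1: "integrable lborel (\<lambda>x. \<phi> x *\<^sub>R partial_deriv b u x)"
    using K(1) by (rule integrable_lborel_compact_support[rotated]) (use K c in \<open>auto intro!: continuous_intros\<close>)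
  have i2: "integrable lborel (\<lambda>x. partial_deriv b \<phi> x *\<^sub>R u x)"
    using K(1) by (rule integrable_lborel_compact_support[rotated]) (use K c b in \<open>auto intro!: continuous_intros\<close>)
  have "(LINT x|lborel. \<phi> x *\<^sub>R partial_deriv b u x + partial_deriv b \<phi> x *\<^sub>R u x) = 0"
    using integral_partial_deriv_eq_0[OF C1 K(1) _ b] K(3) by (simp add: pd)
  then have "(LINT x|lborel. \<phi> x *\<^sub>R partial_deriv b u x) + (LINT x|lborel. partial_deriv b \<phi> x *\<^sub>R u x) = 0"
    using i1 i2 by simp
  moreover have "U \<in> sets lebesgue" using U by auto
  ultimately show "(LINT x|lebesgue_on U. partial_deriv b \<phi> x *\<^sub>R u x) = - (LINT x|lebesgue_on U. \<phi> x *\<^sub>R partial_deriv b u x)"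
    using K i1 i2 by (subst (1 2) lebesgue_on_integral_eq_lborel) (auto simp: add_eq_0_iff)
qed

lemma integrable_test_scaleR:
  fixes f :: "'a::euclidean_space \<Rightarrow> 'b::euclidean_space"
  assumes f: "locally_integrable U f" and U: "U \<in> sets lebesgue" and K: "compact K" "K \<subseteq> U"
    and \<psi>: "continuous_on UNIV \<psi>" "\<And>x. x \<notin> K \<Longrightarrow> \<psi> x = 0"
  shows "integrable (lebesgue_on U) (\<lambda>x. \<psi> x *\<^sub>R f x)"
proof -
  have fi: "integrable lebesgue (\<lambda>x. indicator K x *\<^sub>R f x)"
    using f K unfolding locally_integrable_def set_integrable_def by auto
  have "bounded (\<psi> ` K)"
    using K(1) by (intro compact_imp_bounded compact_continuous_image continuous_on_subset[OF \<psi>(1)]) auto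
  then obtain M where M: "M > 0" "\<And>x. x \<in> K \<Longrightarrow> \<bar>\<psi> x\<bar> \<le> M" unfolding bounded_pos by auto
  have m: "\<psi> \<in> borel_measurable lebesgue"
    using borel_measurable_continuous_onI[OF \<psi>(1)] by (intro measurable_completion) simp
  have "integrable lebesgue (\<lambda>x. \<psi> x *\<^sub>R indicator K x *\<^sub>R f x)"
  proof (rule Bochner_Integration.integrable_bound[where f="\<lambda>x. M *\<^sub>R (indicator K x *\<^sub>R f x)"])
    show "integrable lebesgue (\<lambda>x. M *\<^sub>R indicator K x *\<^sub>R f x)"
      using fi by (rule integrable_scaleR_right)
    show "(\<lambda>x. \<psi> x *\<^sub>R indicat_real K x *\<^sub>R f x) \<in> borel_measurable lebesgue"
      using fi m by (intro borel_measurable_scaleR[OF _ borel_measurable_integrable]) auto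
    show "AE x in lebesgue. norm (\<psi> x *\<^sub>R indicat_real K x *\<^sub>R f x) \<le> norm (M *\<^sub>R indicat_real K x *\<^sub>R f x)"
      using M by (intro AE_I2) (auto simp: indicator_def intro!: mult_right_mono)
  qed
  moreover have "(\<lambda>x. \<psi> x *\<^sub>R indicator K x *\<^sub>R f x) = (\<lambda>x. indicator U x *\<^sub>R (\<psi> x *\<^sub>R f x))"
    using \<psi>(2) K(2) by (auto simp: indicator_def fun_eq_iff)
  ultimately show ?thesis using U by (simp add: integrable_restrict_space)
qed

lemma AE_lebesgue_on_iff_negligible:
  assumes "U \<in> sets lebesgue"
  shows "(AE x in lebesgue_on U. P x) \<longleftrightarrow> negligible {x \<in> U. \<not> P x}"
  using assms by (simp add: AE_restrict_space_iff completion.AE_iff_null_sets negligible_iff_null_sets)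

lemma locally_integrable_AE:
  fixes f :: "'a::euclidean_space \<Rightarrow> 'b::euclidean_space"
  assumes "locally_integrable U f" "U \<in> sets lebesgue" "AE x in lebesgue_on U. f x = g x"
  shows "locally_integrable U g"
  unfolding locally_integrable_def
proof (intro allI impI)
  fix K assume K: "compact K \<and> K \<subseteq> U"
  then have "f absolutely_integrable_on K" using assms(1) by (auto simp: locally_integrable_def)
  then show "g absolutely_integrable_on K"
    using assms(2,3) K by (auto simp: AE_lebesgue_on_iff_negligible elim!: absolutely_integrable_spike)
qed

lemma has_weak_partial_AE:
  fixes u :: "'a::euclidean_space \<Rightarrow> 'b::euclidean_space"
  assumes w: "has_weak_partial U b u v" and U: "U \<in> sets lebesgue" and b: "b \<in> Basis"
    and eq: "AE x in lebesgue_on U. u x = u' x"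
  shows "has_weak_partial U b u' v"
proof -
  have l: "locally_integrable U u" "locally_integrable U u'"
    using w eq U locally_integrable_AE by (auto simp: has_weak_partial_def)
  have "(LINT x|lebesgue_on U. partial_deriv b \<phi> x *\<^sub>R u' x) = (LINT x|lebesgue_on U. partial_deriv b \<phi> x *\<^sub>R u x)"
    if "test_function U \<phi>" for \<phi>
  proof -
    from that obtain K where K: "compact K" "K \<subseteq> U" "\<And>x. x \<notin> K \<Longrightarrow> \<phi> x = 0" "\<And>x b. x \<notin> K \<Longrightarrow> partial_deriv b \<phi> x = 0"
      "continuous_on UNIV \<phi>" "\<And>b. b \<in> Basis \<Longrightarrow> continuous_on UNIV (partial_deriv b \<phi>)"
      by (rule test_functionD) blast
    have "integrable (lebesgue_on U) (\<lambda>x. partial_deriv b \<phi> x *\<^sub>R u x)"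
      "integrable (lebesgue_on U) (\<lambda>x. partial_deriv b \<phi> x *\<^sub>R u' x)"
      using l U K b by (auto intro!: integrable_test_scaleR)
    then show ?thesis using eq by (intro integral_cong_AE) auto
  qed
  with w l show ?thesis by (auto simp: has_weak_partial_def)
qed

lemma has_weak_partial_diff:
  fixes u :: "'a::euclidean_space \<Rightarrow> 'b::euclidean_space"
  assumes "has_weak_partial U b u v" "has_weak_partial U b u' v'" and U: "U \<in> sets lebesgue" and b: "b \<in> Basis"
  shows "has_weak_partial U b (\<lambda>x. u x - u' x) (\<lambda>x. v x - v' x)"
proof -
  have l: "locally_integrable U u" "locally_integrable U v" "locally_integrable U u'" "locally_integrable U v'"
    using assms by (auto simp: has_weak_partial_def)
  have "(LINT x|lebesgue_on U. partial_deriv b \<phi> x *\<^sub>R (u x - u' x)) = - (LINT x|lebesgue_on U. \<phi> x *\<^sub>R (v x - v' x))"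
    if t: "test_function U \<phi>" for \<phi>
  proof -
    from that obtain K where K: "compact K" "K \<subseteq> U" "\<And>x. x \<notin> K \<Longrightarrow> \<phi> x = 0" "\<And>x b. x \<notin> K \<Longrightarrow> partial_deriv b \<phi> x = 0"
      "continuous_on UNIV \<phi>" "\<And>b. b \<in> Basis \<Longrightarrow> continuous_on UNIV (partial_deriv b \<phi>)"
      by (rule test_functionD) blast
    have "integrable (lebesgue_on U) (\<lambda>x. partial_deriv b \<phi> x *\<^sub>R u x)"
      "integrable (lebesgue_on U) (\<lambda>x. partial_deriv b \<phi> x *\<^sub>R u' x)"
      "integrable (lebesgue_on U) (\<lambda>x. \<phi> x *\<^sub>R v x)" "integrable (lebesgue_on U) (\<lambda>x. \<phi> x *\<^sub>R v' x)"
      using l U K b by (auto intro!: integrable_test_scaleR)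
    then show ?thesis using assms(1,2) t
      by (simp add: scaleR_diff_right has_weak_partial_def)
  qed
  moreover have "locally_integrable U (\<lambda>x. u x - u' x)" "locally_integrable U (\<lambda>x. v x - v' x)"
    using l by (auto simp: locally_integrable_def intro: set_integral_diff)
  ultimately show ?thesis by (auto simp: has_weak_partial_def)
qed

text \<open>The fundamental lemma of the calculus of variations. Box bumps show that
  \<open>d\<close> has integral 0 over every closed box in \<open>U\<close>; Lebesgue
  differentiation along shrinking cubes then gives \<open>d = 0\<close> almost everywhere in each
  box, and countably many boxes exhaust \<open>U\<close>.\<close>

lemma AE_eq_0_if_test_integrals_0:
  fixes d :: "'a::euclidean_space \<Rightarrow> 'b::euclidean_space"
  assumes U: "open U" and d: "locally_integrable U d"
    and 0: "\<And>\<phi>. test_function U \<phi> \<Longrightarrow> (LINT x|lebesgue_on U. \<phi> x *\<^sub>R d x) = 0"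
  shows "AE x in lebesgue_on U. d x = 0"
proof -
  have Um: "U \<in> sets lebesgue" using U by auto
  have di: "d absolutely_integrable_on cbox a b" if "cbox a b \<subseteq> U" for a b
    using d that by (auto simp: locally_integrable_def)
  have box0: "integral (cbox a b) d = 0" if ab: "cbox a b \<subseteq> U" for a b
  proof -
    have ii: "integrable lebesgue (\<lambda>x. indicator (cbox a b) x *\<^sub>R d x)" using di[OF ab] by (simp add: set_integrable_def)
    have ib: "integrable lebesgue (\<lambda>x. indicator (box a b) x *\<^sub>R d x)"
      using di[OF ab] unfolding absolutely_integrable_on_open_interval[symmetric] by (simp add: set_integrable_def)
    have eq: "indicator U x *\<^sub>R box_bump a b n x *\<^sub>R d x = box_bump a b n x *\<^sub>R indicator (cbox a b) x *\<^sub>R d x" for n x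
      using box_bump_zero[of x a b n] ab box_subset_cbox[of a b] by (cases "x \<in> cbox a b") auto
    have cb: "continuous_on UNIV (box_bump a b n)" for n
      using smooth_box_bump[of a b n] C_diff_imp_continuous by (auto simp: smooth_def)
    have "(\<lambda>n. LINT x|lebesgue. box_bump a b n x *\<^sub>R indicator (cbox a b) x *\<^sub>R d x) \<longlonglongrightarrow> (LINT x|lebesgue. indicator (box a b) x *\<^sub>R d x)"
    proof (rule integral_dominated_convergence[where w="\<lambda>x. norm (indicator (cbox a b) x *\<^sub>R d x)"])
      show "(\<lambda>x. box_bump a b n x *\<^sub>R indicat_real (cbox a b) x *\<^sub>R d x) \<in> borel_measurable lebesgue" for n
        by (intro borel_measurable_scaleR[OF _ borel_measurable_integrable[OF ii]] measurable_completion)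
          (use borel_measurable_continuous_onI[OF cb[of n]] in simp)
      show "AE x in lebesgue. (\<lambda>n. box_bump a b n x *\<^sub>R indicat_real (cbox a b) x *\<^sub>R d x) \<longlonglongrightarrow> indicat_real (box a b) x *\<^sub>R d x"
      proof (rule AE_I2)
        fix x
        have "(\<lambda>n. box_bump a b n x *\<^sub>R indicat_real (cbox a b) x *\<^sub>R d x) \<longlonglongrightarrow> indicat_real (box a b) x *\<^sub>R indicat_real (cbox a b) x *\<^sub>R d x"
          by (intro tendsto_intros box_bump_tendsto)
        then show "(\<lambda>n. box_bump a b n x *\<^sub>R indicat_real (cbox a b) x *\<^sub>R d x) \<longlonglongrightarrow> indicat_real (box a b) x *\<^sub>R d x"
          using box_subset_cbox[of a b] by (cases "x \<in> box a b") auto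
      qed
      show "AE x in lebesgue. norm (box_bump a b n x *\<^sub>R indicat_real (cbox a b) x *\<^sub>R d x) \<le> norm (indicat_real (cbox a b) x *\<^sub>R d x)" for n
      proof (rule AE_I2)
        fix x
        have "\<bar>box_bump a b n x\<bar> * norm (indicat_real (cbox a b) x *\<^sub>R d x) \<le> 1 * norm (indicat_real (cbox a b) x *\<^sub>R d x)"
          using box_bump_abs_le by (rule mult_right_mono) simp
        then show "norm (box_bump a b n x *\<^sub>R indicat_real (cbox a b) x *\<^sub>R d x) \<le> norm (indicat_real (cbox a b) x *\<^sub>R d x)"
          by (simp add: mult.assoc abs_mult)
      qed
      show "integrable lebesgue (\<lambda>x. norm (indicat_real (cbox a b) x *\<^sub>R d x))"
        using ii by (rule integrable_norm)
    qed (use ib in auto)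
    moreover have "(LINT x|lebesgue. box_bump a b n x *\<^sub>R indicator (cbox a b) x *\<^sub>R d x) = 0" for n
    proof -
      have "(LINT x|lebesgue_on U. box_bump a b n x *\<^sub>R d x) = (LINT x|lebesgue. indicator U x *\<^sub>R box_bump a b n x *\<^sub>R d x)"
        by (rule integral_restrict_space) (use Um in simp)
      then show ?thesis
        using 0[OF test_function_box_bump[OF ab], of n] by (simp only: eq)
    qed
    ultimately have "(LINT x|lebesgue. indicator (box a b) x *\<^sub>R d x) = 0" by (simp add: LIMSEQ_const_iff)
    then have "integral (box a b) d = 0"
      using di[OF ab] set_lebesgue_integral_eq_integral(2)[of "box a b" d]
      by (simp add: absolutely_integrable_on_open_interval set_lebesgue_integral_def)
    then show ?thesis by (simp add: integral_open_interval)
  qed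
  have neg: "negligible {x \<in> cbox a b. d x \<noteq> 0}" if ab: "cbox a b \<subseteq> U" for a b
  proof -
    let ?f = "\<lambda>x. if x \<in> cbox a b then d x else 0"
    \<comment> \<open>The differentiation theorem asks for integrability on all boxes, hence the
      cut-off. As the intersection of two boxes is a box, the integrals of the cut-off function are
      still 0.\<close>
    have int: "?f integrable_on cbox l r" "integral (cbox l r) ?f = 0" for l r
    proof -
      obtain l' r' where I: "cbox l r \<inter> cbox a b = cbox l' r'" using Int_interval by blast
      then have s: "cbox l' r' \<subseteq> U" using ab by blast
      have "d integrable_on cbox l' r'" using di[OF s] set_lebesgue_integral_eq_integral(1) by blast
      then show "?f integrable_on cbox l r"
        using integrable_restrict_Int[of "cbox a b" d "cbox l r"] I by (simp add: Int_commute)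
      show "integral (cbox l r) ?f = 0"
        using integral_restrict_Int[of "cbox l r" "cbox a b" d] I box0[OF s] by (simp add: Int_commute)
    qed
    obtain N where N: "negligible N" "\<And>x e. x \<notin> N \<Longrightarrow> 0 < e \<Longrightarrow>
        \<exists>\<delta>>0. \<forall>h. 0 < h \<and> h < \<delta> \<longrightarrow> norm (integral (cbox x (x + h *\<^sub>R One)) ?f /\<^sub>R h ^ DIM('a) - ?f x) < e"
      using integrable_ccontinuous_explicit[OF int(1)] by blast
    have "?f x = 0" if "x \<notin> N" for x
    proof (rule ccontr)
      assume "?f x \<noteq> 0"
      then have "norm (?f x) > 0" by simp
      from N(2)[OF that this] obtain \<delta> where "\<delta> > 0"
        and "\<And>h. 0 < h \<Longrightarrow> h < \<delta> \<Longrightarrow> norm (integral (cbox x (x + h *\<^sub>R One)) ?f /\<^sub>R h ^ DIM('a) - ?f x) < norm (?f x)"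
        by blast
      from this(2)[of "\<delta> / 2"] \<open>\<delta> > 0\<close> show False by (simp add: int(2) del: real_norm_def)
    qed
    then have "{x \<in> cbox a b. d x \<noteq> 0} \<subseteq> N" by (smt (verit) mem_Collect_eq subsetI)
    with N(1) show ?thesis using negligible_subset by blast
  qed
  obtain \<D> where D: "countable \<D>" "\<D> \<subseteq> Pow U" "\<And>X. X \<in> \<D> \<Longrightarrow> \<exists>a b. X = cbox a b" "\<Union>\<D> = U"
    using open_countable_Union_open_cbox[OF U] by metis
  have "negligible (\<Union>X\<in>\<D>. {x \<in> X. d x \<noteq> 0})"
    using D neg by (intro negligible_countable_Union countable_image) (auto, metis Pow_iff subsetD)
  moreover have "{x \<in> U. \<not> d x = 0} = (\<Union>X\<in>\<D>. {x \<in> X. d x \<noteq> 0})" using D(4) by auto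
  ultimately show ?thesis using Um by (simp add: AE_lebesgue_on_iff_negligible)
qed

text \<open>The difference of the two candidates is a weak derivative of \<open>u - u\<close>, so it
  integrates to 0 against every test function.\<close>

lemma has_weak_partial_unique:
  fixes u :: "'a::euclidean_space \<Rightarrow> 'b::euclidean_space"
  assumes v: "has_weak_partial U b u v" "has_weak_partial U b u w" and U: "open U" and b: "b \<in> Basis"
  shows "AE x in lebesgue_on U. v x = w x"
proof -
  have Um: "U \<in> sets lebesgue" using U by auto
  have d: "has_weak_partial U b (\<lambda>x. u x - u x) (\<lambda>x. v x - w x)"
    using v Um b by (rule has_weak_partial_diff)
  then have "locally_integrable U (\<lambda>x. v x - w x)" by (simp add: has_weak_partial_def)
  moreover have "(LINT x|lebesgue_on U. \<phi> x *\<^sub>R (v x - w x)) = 0" if "test_function U \<phi>" for \<phi>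
    using d that unfolding has_weak_partial_def by fastforce
  ultimately have "AE x in lebesgue_on U. v x - w x = 0" by (rule AE_eq_0_if_test_integrals_0[OF U])
  then show ?thesis by simp
qed

lemma has_weak_partial_weak_partial:
  "has_weak_partial U b u v \<Longrightarrow> has_weak_partial U b u (weak_partial U b u)"
  unfolding weak_partial_def by (rule someI[where P="has_weak_partial U b u"])

lemma weak_partial_AE_eq:
  fixes u :: "'a::euclidean_space \<Rightarrow> 'b::euclidean_space"
  assumes "has_weak_partial U b u v" "open U" "b \<in> Basis"
  shows "AE x in lebesgue_on U. weak_partial U b u x = v x"
  using has_weak_partial_unique[OF has_weak_partial_weak_partial[OF assms(1)] assms] .

lemma square_integrable_AE:
  fixes f :: "'a::euclidean_space \<Rightarrow> 'b::euclidean_space"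
  assumes "square_integrable U f" "U \<in> sets lebesgue" "AE x in lebesgue_on U. f x = g x"
  shows "square_integrable U g"
proof -
  have g: "g \<in> borel_measurable (lebesgue_on U)"
  proof -
    have "(\<lambda>x. if x \<in> U then f x else 0) \<in> borel_measurable lebesgue"
      using assms(1,2) by (simp add: borel_measurable_if square_integrable_def)
    moreover have "AE x in lebesgue. (if x \<in> U then f x else 0) = (if x \<in> U then g x else 0)"
      using assms(2,3) by (auto simp: AE_restrict_space_iff elim: AE_mp)
    ultimately have "(\<lambda>x. if x \<in> U then g x else 0) \<in> borel_measurable lebesgue" by (rule borel_measurable_AE)
    then show ?thesis using assms(2) by (simp add: borel_measurable_if)
  qed
  moreover have "integrable (lebesgue_on U) (\<lambda>x. (norm (g x))\<^sup>2)"
  proof -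
    have "(\<lambda>x. (norm (f x))\<^sup>2) \<in> borel_measurable (lebesgue_on U)" "(\<lambda>x. (norm (g x))\<^sup>2) \<in> borel_measurable (lebesgue_on U)"
      using g assms(1) by (auto simp: square_integrable_def)
    moreover have "AE x in lebesgue_on U. (norm (f x))\<^sup>2 = (norm (g x))\<^sup>2" using assms(3) by auto
    ultimately show ?thesis
      using assms(1) integrable_cong_AE[of "\<lambda>x. (norm (f x))\<^sup>2" "lebesgue_on U" "\<lambda>x. (norm (g x))\<^sup>2"]
      by (simp add: square_integrable_def)
  qed
  ultimately show ?thesis by (simp add: square_integrable_def)
qed

lemma square_integrable_continuous:
  fixes f :: "'a::euclidean_space \<Rightarrow> 'b::euclidean_space"
  assumes "continuous_on (closure U) f" "bounded U" "U \<in> sets lebesgue"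
  shows "square_integrable U f"
proof -
  have c: "compact (closure U)" using assms(2) by simp
  have "f \<in> borel_measurable (lebesgue_on U)"
    by (rule continuous_imp_measurable_on_sets_lebesgue[OF continuous_on_subset[OF assms(1) closure_subset] assms(3)])
  moreover have "integrable (lebesgue_on U) (\<lambda>x. (norm (f x))\<^sup>2)"
  proof -
    have "(\<lambda>x. (norm (f x))\<^sup>2) absolutely_integrable_on closure U"
      using c by (rule absolutely_integrable_on_compact) (intro continuous_intros assms)
    then have "(\<lambda>x. (norm (f x))\<^sup>2) absolutely_integrable_on U"
      using assms(3) closure_subset by (rule set_integrable_subset)
    then show ?thesis using assms(3) by (rule absolutely_integrable_imp_integrable)
  qed
  ultimately show ?thesis by (simp add: square_integrable_def)
qed

section \<open>Polar coordinates on the disc\<close>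

lemma emeasure_lborel_negligible_diff:
  fixes A B :: "'a::euclidean_space set"
  assumes "A \<in> sets borel" "B \<in> sets borel" "B \<subseteq> A" "negligible (A - B)"
  shows "emeasure lborel A = emeasure lborel B"
proof -
  have "A - B \<in> null_sets lborel"
    using assms by (auto simp: negligible_iff_null_sets null_sets_completion_iff)
  then have "emeasure lborel (B \<union> (A - B)) = emeasure lborel B"
    using assms by (intro emeasure_Un_null_set) auto
  moreover have "B \<union> (A - B) = A" using assms(3) by auto
  ultimately show ?thesis by simp
qed

text \<open>Up to a null set, an open set is a countable disjoint union of balls, and rotations preserve balls.\<close>

lemma lborel_distr_rotation:
  fixes c :: complex
  assumes c: "cmod c = 1"
  shows "distr lborel borel (\<lambda>z. c * z) = lborel"
proof (rule sym, rule lborel_eqI)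
  show "sets (distr lborel borel (\<lambda>z. c * z)) = sets borel" by simp
  fix l u :: complex assume lu: "\<And>b. b \<in> Basis \<Longrightarrow> l \<bullet> b \<le> u \<bullet> b"
  define S where "S = box l u"
  have S: "open S" unfolding S_def by (rule open_box)
  have c0: "c \<noteq> 0" using c by auto
  define K where "K = {(x, r). 0 < r \<and> ball x r \<subseteq> S}"
  have "\<exists>i. i \<in> K \<and> x \<in> ball (fst i) (snd i) \<and> snd i < d" if xd: "x \<in> S" "0 < d" for x d
  proof -
    obtain e where e: "e > 0" "ball x e \<subseteq> S" using S \<open>x \<in> S\<close> openE by blast
    have "ball x (min e (d / 2)) \<subseteq> ball x e" by (rule subset_ball) simp
    with e xd show ?thesis by (intro exI[of _ "(x, min e (d / 2))"]) (auto simp: K_def)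
  qed
  then obtain C where C: "countable C" "C \<subseteq> K"
    "pairwise (\<lambda>i j. disjnt (ball (fst i) (snd i)) (ball (fst j) (snd j))) C"
    "negligible (S - (\<Union>i\<in>C. ball (fst i) (snd i)))"
    by (rule Vitali_covering_theorem_balls) blast
  let ?B = "\<lambda>i. ball (fst i) (snd i)" and ?B' = "\<lambda>i. ball (fst i / c) (snd i)"
  have mem: "c * z \<in> ball x r \<longleftrightarrow> z \<in> ball (x / c) r" for x r z
  proof -
    have "cmod (x - c * z) = cmod (c * (x / c - z))" using c0 by (simp add: algebra_simps)
    also have "\<dots> = cmod (x / c - z)" using c by (simp add: norm_mult)
    finally show ?thesis by (simp add: dist_norm)
  qed
  have BS: "(\<Union>i\<in>C. ?B i) \<subseteq> S"
  proof (rule UN_least)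
    fix i assume "i \<in> C"
    then have "i \<in> K" using C(2) by blast
    then show "?B i \<subseteq> S" by (cases i) (simp add: K_def)
  qed
  have pre: "(\<lambda>z. c * z) -` (\<Union>i\<in>C. ?B i) = (\<Union>i\<in>C. ?B' i)" using mem by blast
  have "emeasure (distr lborel borel (\<lambda>z. c * z)) S = emeasure lborel ((\<lambda>z. c * z) -` S)"
    using S by (subst emeasure_distr) auto
  also have "\<dots> = emeasure lborel (\<Union>i\<in>C. ?B' i)"
  proof (rule emeasure_lborel_negligible_diff)
    show "(\<lambda>z. c * z) -` S \<in> sets borel"
      using S by (intro borel_open continuous_open_vimage) (auto intro!: continuous_intros)
    show "(\<Union>i\<in>C. ?B' i) \<in> sets borel" by (intro borel_open) auto
    show "(\<Union>i\<in>C. ?B' i) \<subseteq> (\<lambda>z. c * z) -` S"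
      unfolding pre[symmetric] using BS by (rule vimage_mono)
    have "negligible ((\<lambda>z. z / c) ` (S - (\<Union>i\<in>C. ?B i)))"
      using C(4) by (rule negligible_differentiable_image_negligible[rotated])
        (auto intro!: derivative_intros simp: differentiable_on_def c0)
    moreover have "(\<lambda>z. c * z) -` S - (\<Union>i\<in>C. ?B' i) \<subseteq> (\<lambda>z. z / c) ` (S - (\<Union>i\<in>C. ?B i))"
    proof
      fix z assume "z \<in> (\<lambda>z. c * z) -` S - (\<Union>i\<in>C. ?B' i)"
      then have "c * z \<in> S - (\<Union>i\<in>C. ?B i)" using mem by blast
      then show "z \<in> (\<lambda>z. z / c) ` (S - (\<Union>i\<in>C. ?B i))" using c0 by (intro image_eqI[of _ _ "c * z"]) auto
    qed
    ultimately show "negligible ((\<lambda>z. c * z) -` S - (\<Union>i\<in>C. ?B' i))" by (rule negligible_subset)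
  qed
  also have "\<dots> = (\<integral>\<^sup>+i. emeasure lborel (?B' i) \<partial>count_space C)"
  proof (rule emeasure_UN_countable)
    show "disjoint_family_on ?B' C"
      using C(3) mem by (fastforce simp: disjoint_family_on_def pairwise_def disjnt_def)
  qed (use C in auto)
  also have "\<dots> = (\<integral>\<^sup>+i. emeasure lborel (?B i) \<partial>count_space C)"
    using C(2) by (intro nn_integral_cong) (auto simp: K_def emeasure_ball)
  also have "\<dots> = emeasure lborel (\<Union>i\<in>C. ?B i)"
    by (rule emeasure_UN_countable[symmetric])
      (use C in \<open>auto simp: disjoint_family_on_def pairwise_def disjnt_def\<close>)
  also have "\<dots> = emeasure lborel S"
    by (rule emeasure_lborel_negligible_diff[symmetric]) (use S C(4) BS in \<open>auto intro!: borel_open\<close>)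
  finally show "emeasure (distr lborel borel (\<lambda>z. c * z)) (box l u) = (\<Prod>b\<in>Basis. (u - l) \<bullet> b)"
    using lu by (simp add: S_def emeasure_lborel_box_eq inner_diff_left)
qed

text \<open>Finite measures on the line that agree on all \<open>{a<..}\<close> are equal. For
  \<open>0 \<le> a < 1\<close> both sides are the area \<open>pi * (1 - a\<^sup>2)\<close> of an
  annulus, on the right by integrating \<open>2 * pi * r\<close>.\<close>

lemma distr_cmod_unit_disc:
  "distr (restrict_space lborel (cball 0 1)) borel cmod = density lborel (\<lambda>r. ennreal (2 * pi * r * indicator {0..1} r))"
    (is "?M = ?N")
proof (rule measure_eqI_lessThan)
  have M: "emeasure ?M {a<..} = emeasure lborel ({z. a < cmod z} \<inter> cball 0 1)" for a
  proof -
    have "emeasure ?M {a<..} = emeasure (restrict_space lborel (cball 0 1)) ({z. a < cmod z} \<inter> cball 0 1)"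
      by (subst emeasure_distr) (auto simp: vimage_def intro!: measurable_restrict_space1)
    also have "\<dots> = emeasure lborel ({z. a < cmod z} \<inter> cball 0 1)"
      by (rule emeasure_restrict_space) auto
    finally show ?thesis .
  qed
  have N: "emeasure ?N {a<..} = (if a < 0 then ennreal pi else if a < 1 then ennreal (pi * (1 - a\<^sup>2)) else 0)" for a
  proof -
    have F: "((\<lambda>r. pi * r\<^sup>2) has_real_derivative 2 * pi * r) (at r)" for r
      by (auto intro!: derivative_eq_intros)
    have e: "emeasure ?N {a<..} = (\<integral>\<^sup>+r. ennreal (2 * pi * r * indicator {0..1} r) * indicator {a<..} r \<partial>lborel)"
      by (rule emeasure_density) auto
    consider "a < 0" | "0 \<le> a" "a < 1" | "a \<ge> 1" by linarith
    then show ?thesis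
    proof cases
      case 1
      have "emeasure ?N {a<..} = (\<integral>\<^sup>+r. ennreal (2 * pi * r) * indicator {0..1} r \<partial>lborel)"
        unfolding e using 1 by (intro nn_integral_cong) (auto simp: indicator_def)
      also have "\<dots> = ennreal (pi * 1\<^sup>2 - pi * 0\<^sup>2)"
        by (rule nn_integral_FTC_Icc[where F="\<lambda>r. pi * r\<^sup>2"]) (auto intro!: F DERIV_subset[OF F])
      finally show ?thesis using 1 by simp
    next
      case 2
      have "emeasure ?N {a<..} = (\<integral>\<^sup>+r. ennreal (2 * pi * r) * indicator {a..1} r \<partial>lborel)"
        unfolding e using 2
        by (intro nn_integral_cong_AE AE_I[where N="{a}"]) (auto simp: indicator_def split: if_splits)
      also have "\<dots> = ennreal (pi * 1\<^sup>2 - pi * a\<^sup>2)"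
        using 2 by (intro nn_integral_FTC_Icc[where F="\<lambda>r. pi * r\<^sup>2"]) (auto intro!: F DERIV_subset[OF F])
      finally show ?thesis using 2 by (simp add: algebra_simps)
    next
      case 3
      have "emeasure ?N {a<..} = (\<integral>\<^sup>+(r::real). 0 \<partial>lborel)"
        unfolding e using 3 by (intro nn_integral_cong) (auto simp: indicator_def)
      then show ?thesis using 3 by simp
    qed
  qed
  have disc: "emeasure lborel (cball (0::complex) r) = ennreal (pi * r\<^sup>2)" if "r \<ge> 0" for r
    using that by (simp add: emeasure_cball unit_ball_vol_2)
  have eq: "emeasure ?M {a<..} = emeasure ?N {a<..}" for a
  proof -
    consider "a < 0" | "0 \<le> a" "a < 1" | "a \<ge> 1" by linarith
    then show ?thesis
    proof cases
      case 1
      then have "{z. a < cmod z} \<inter> cball 0 1 = cball 0 1" by (auto intro: less_le_trans)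
      with 1 show ?thesis unfolding M N by (simp add: disc)
    next
      case 2
      then have "{z. a < cmod z} \<inter> cball 0 1 = cball 0 1 - cball 0 a" by auto
      moreover have "emeasure lborel (cball 0 1 - cball (0::complex) a) = ennreal (pi * 1\<^sup>2) - ennreal (pi * a\<^sup>2)"
        using 2 by (subst emeasure_Diff) (auto simp: disc)
      ultimately show ?thesis using 2 unfolding M N by (simp add: ennreal_minus[symmetric] algebra_simps)
    next
      case 3
      then have "{z. a < cmod z} \<inter> cball 0 1 = {}" by auto
      with 3 show ?thesis unfolding M N by simp
    qed
  qed
  show "emeasure ?M {a<..} = emeasure ?N {a<..}" for a by (rule eq)
  show "emeasure ?M {a<..} < \<infinity>" for a unfolding eq N by auto
qed auto

lemma integral_periodic_shift:
  fixes g :: "real \<Rightarrow> real"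
  assumes g: "continuous_on UNIV g" and per: "\<And>t. g (t + p) = g t" and p: "0 \<le> a" "a \<le> p"
  shows "integral {0..p} (\<lambda>t. g (t + a)) = integral {0..p} g"
proof -
  have int: "g integrable_on {l..r}" for l r
    using g by (intro integrable_continuous_real) (rule continuous_on_subset, auto)
  have "integral {0..p} (\<lambda>t. g (t + a)) = integral {a..p + a} g"
    using integral_shift_Icc_real[of 0 p g a] by (simp add: o_def add.commute)
  also have "\<dots> = integral {a..p} g + integral {p..p + a} g"
    using p by (intro Henstock_Kurzweil_Integration.integral_combine[symmetric] int) auto
  also have "integral {p..p + a} g = integral {0..a} (\<lambda>t. g (t + p))"
    using integral_shift_Icc_real[of 0 a g p] by (simp add: o_def add.commute)
  also have "\<dots> = integral {0..a} g" by (simp add: per)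
  also have "integral {a..p} g + integral {0..a} g = integral {0..p} g"
    using p Henstock_Kurzweil_Integration.integral_combine[of 0 a p g] int by simp
  finally show ?thesis .
qed

lemma circle_integral_rotate:
  fixes G :: "complex \<Rightarrow> real"
  assumes G: "continuous_on UNIV G"
  shows "integral {0..2 * pi} (\<lambda>t. G (cis t * z)) = integral {0..2 * pi} (\<lambda>t. G (cmod z * cis t))"
proof -
  define a where "a = Arg2pi z"
  have z: "z = cmod z * cis a" using Arg2pi_eq[of z] by (simp add: a_def cis_conv_exp)
  have "integral {0..2 * pi} (\<lambda>t. G (cis t * z)) = integral {0..2 * pi} (\<lambda>t. G (cmod z * cis (t + a)))"
    by (subst z) (simp add: cis_mult[symmetric] mult_ac del: cis_mult)
  also have "\<dots> = integral {0..2 * pi} (\<lambda>t. G (cmod z * cis t))"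
  proof (rule integral_periodic_shift)
    show "continuous_on UNIV (\<lambda>t. G (cmod z * cis t))"
      by (intro continuous_on_compose2[OF G] continuous_intros) auto
    show "G (cmod z * cis (t + 2 * pi)) = G (cmod z * cis t)" for t
      by (simp add: cis_mult[symmetric] del: cis_mult)
    show "0 \<le> a" "a \<le> 2 * pi" using Arg2pi[of z] by (auto simp: a_def)
  qed
  finally show ?thesis .
qed

text \<open>Rotation invariance takes the place of a change of variables. The integral over the disc
  equals its mean over all rotations of \<open>G\<close>; after Fubini the inner integral runs over
  the circle through \<open>z\<close> and depends on \<open>cmod z\<close> only, and the
  distribution of \<open>cmod\<close> on the disc turns the rest into an integral over
  radii.\<close>

lemma lborel_integral_polar:
  fixes G :: "complex \<Rightarrow> real"
  assumes G: "continuous_on UNIV G"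
  shows "(LINT z|lborel. indicator (cball 0 1) z *\<^sub>R G z) =
    integral {0..1} (\<lambda>r. r * integral {0..2 * pi} (\<lambda>t. G (r * cis t)))"
proof -
  define I where "I = (LINT z|lborel. indicator (cball 0 1) z *\<^sub>R G z)"
  define h where "h r = integral {0..2 * pi} (\<lambda>t. G (of_real r * cis t))" for r
  let ?f = "\<lambda>(t, z). indicator ({0..2 * pi} \<times> cball 0 1) (t, z) *\<^sub>R G (cis t * z)"
  have [measurable]: "G \<in> borel_measurable borel" by (rule borel_measurable_continuous_onI[OF G])
  have hc: "continuous_on UNIV h"
  proof -
    have "continuous_on (UNIV \<times> cbox 0 (2 * pi)) (\<lambda>x. G (of_real (fst x) * cis (snd x)))"
      by (rule continuous_on_compose2[OF G]) (auto intro!: continuous_intros)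
    then have "continuous_on (UNIV \<times> cbox 0 (2 * pi)) (\<lambda>(r, t). G (of_real r * cis t))" by (simp add: split_beta)
    from integral_continuous_on_param[OF this] show ?thesis by (simp add: h_def[abs_def])
  qed
  have [measurable]: "h \<in> borel_measurable borel" by (rule borel_measurable_continuous_onI[OF hc])
  have rot: "(LINT z|lborel. indicator (cball 0 1) z *\<^sub>R G (cis t * z)) = I" for t
  proof -
    have "I = (LINT z|distr lborel borel (\<lambda>z. cis t * z). indicator (cball 0 1) z *\<^sub>R G z)"
      by (simp add: I_def lborel_distr_rotation)
    also have "\<dots> = (LINT z|lborel. indicator (cball 0 1) (cis t * z) *\<^sub>R G (cis t * z))"
      by (rule integral_distr) (auto intro!: borel_measurable_times borel_measurable_indicator)
    finally show ?thesis by (simp add: indicator_def norm_mult)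
  qed
  have fi: "integrable (lborel \<Otimes>\<^sub>M lborel) ?f"
  proof -
    have "integrable lborel (\<lambda>x::real \<times> complex. indicator ({0..2 * pi} \<times> cball 0 1) x *\<^sub>R G (cis (fst x) * snd x))"
      by (intro borel_integrable_compact compact_Times continuous_on_compose2[OF G] continuous_intros) auto
    then show ?thesis by (simp add: lborel_prod split_def)
  qed
  have "2 * pi * I = (LINT t|lborel. indicator {0..2 * pi} t *\<^sub>R I)" by simp
  also have "\<dots> = (LINT t|lborel. LINT z|lborel. ?f (t, z))"
  proof (rule Bochner_Integration.integral_cong[OF refl])
    fix t
    have "(LINT z|lborel. ?f (t, z)) = (LINT z|lborel. indicator {0..2 * pi} t *\<^sub>R indicator (cball 0 1) z *\<^sub>R G (cis t * z))"
      by (intro Bochner_Integration.integral_cong) (auto simp: indicator_def)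
    also have "\<dots> = indicator {0..2 * pi} t *\<^sub>R I" by (subst integral_scaleR_right) (simp only: rot)
    finally show "indicator {0..2 * pi} t *\<^sub>R I = (LINT z|lborel. ?f (t, z))" by simp
  qed
  also have "\<dots> = (LINT z|lborel. LINT t|lborel. ?f (t, z))"
    using lborel_pair.Fubini_integral[of "\<lambda>t z. ?f (t, z)"] fi by (simp add: split_def)
  also have "\<dots> = (LINT z|lborel. indicator (cball 0 1) z *\<^sub>R h (cmod z))"
  proof (rule Bochner_Integration.integral_cong[OF refl])
    fix z :: complex
    have c: "continuous_on {0..2 * pi} (\<lambda>t. G (cis t * z))"
      by (intro continuous_on_compose2[OF G] continuous_intros) auto
    have "(LINT t|lborel. ?f (t, z)) = (LINT t|lborel. indicator (cball 0 1) z *\<^sub>R indicator {0..2 * pi} t *\<^sub>R G (cis t * z))"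
      by (intro Bochner_Integration.integral_cong) (auto simp: indicator_def)
    also have "\<dots> = indicator (cball 0 1) z *\<^sub>R (LINT t:{0..2 * pi}|lborel. G (cis t * z))"
      by (subst integral_scaleR_right) (simp only: set_lebesgue_integral_def)
    also have "(LINT t:{0..2 * pi}|lborel. G (cis t * z)) = integral {0..2 * pi} (\<lambda>t. G (cis t * z))"
      using c by (intro set_borel_integral_eq_integral borel_integrable_atLeastAtMost') 
    also have "\<dots> = h (cmod z)" unfolding h_def by (rule circle_integral_rotate[OF G])
    finally show "(LINT t|lborel. ?f (t, z)) = indicator (cball 0 1) z *\<^sub>R h (cmod z)" .
  qed
  also have "\<dots> = (LINT z|restrict_space lborel (cball 0 1). h (cmod z))"
    by (simp add: integral_restrict_space)
  also have "\<dots> = (LINT r|distr (restrict_space lborel (cball (0::complex) 1)) borel cmod. h r)"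
    by (rule integral_distr[symmetric]) (auto intro!: measurable_restrict_space1)
  also have "\<dots> = (LINT r|lborel. (2 * pi * r * indicator {0..1} r) *\<^sub>R h r)"
    unfolding distr_cmod_unit_disc by (rule integral_density) (auto simp: indicator_def)
  also have "\<dots> = (LINT r:{0..1}|lborel. 2 * pi * (r * h r))"
    unfolding set_lebesgue_integral_def by (intro Bochner_Integration.integral_cong) (auto simp: indicator_def)
  also have "\<dots> = integral {0..1} (\<lambda>r. 2 * pi * (r * h r))"
    using hc by (intro set_borel_integral_eq_integral borel_integrable_atLeastAtMost')
      (auto intro!: continuous_intros intro: continuous_on_subset)
  finally show ?thesis by (simp add: I_def h_def)
qed

lemma disc_integral_polar:
  fixes G :: "complex \<Rightarrow> real"
  assumes G: "continuous_on (cball 0 1) G"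
  shows "(LINT z|lebesgue_on unit_disc. G z) =
    integral {0..1} (\<lambda>r. r * integral {0..2 * pi} (\<lambda>t. G (r * cis t)))"
proof -
  \<comment> \<open>\<open>G\<close> is continuous only on the closed disc. Composing it with the
    radial retraction onto the disc extends it continuously to the plane.\<close>
  define F where "F z = G (z / max 1 (cmod z))" for z
  have F: "continuous_on UNIV F"
    unfolding F_def by (intro continuous_on_compose2[OF G] continuous_intros) (auto simp: norm_divide divide_le_eq)
  have FG: "F z = G z" if "z \<in> cball 0 1" for z using that by (simp add: F_def max_def)
  have "G absolutely_integrable_on cball 0 1" by (rule absolutely_integrable_on_compact[OF compact_cball G])
  then have Gi: "G absolutely_integrable_on ball 0 1"
    by (rule set_integrable_subset) auto
  have "(LINT z|lebesgue_on unit_disc. G z) = integral (ball 0 1) G"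
    using Gi by (intro lebesgue_integral_eq_integral absolutely_integrable_imp_integrable) auto
  also have "\<dots> = integral (cball 0 1) G"
  proof (rule integral_spike_set)
    have "negligible (sphere (0::complex) 1)" by (rule negligible_sphere)
    then show "negligible {x \<in> ball 0 1 - cball 0 1. G x \<noteq> 0}" "negligible {x \<in> cball 0 1 - ball 0 1. G x \<noteq> 0}"
      by (auto elim!: negligible_subset)
  qed
  also have "\<dots> = integral (cball 0 1) F" by (intro Henstock_Kurzweil_Integration.integral_cong) (simp add: FG)
  also have "\<dots> = (LINT z|lborel. indicator (cball 0 1) z *\<^sub>R F z)"
  proof -
    have "integrable lborel (\<lambda>z. indicator (cball 0 1) z *\<^sub>R F z)"
      using F by (intro borel_integrable_compact) (auto intro: continuous_on_subset)
    then show ?thesis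
      using set_borel_integral_eq_integral(2)[of "cball 0 1" F]
      by (simp add: set_integrable_def set_lebesgue_integral_def)
  qed
  also have "\<dots> = integral {0..1} (\<lambda>r. r * integral {0..2 * pi} (\<lambda>t. F (r * cis t)))" by (rule lborel_integral_polar[OF F])
  also have "\<dots> = integral {0..1} (\<lambda>r. r * integral {0..2 * pi} (\<lambda>t. G (r * cis t)))"
    by (intro Henstock_Kurzweil_Integration.integral_cong arg_cong2[where f="(*)"] refl)
      (auto simp: FG norm_mult)
  finally show ?thesis .
qed

section \<open>The calibration\<close>

text \<open>The squared speed of the orbit through \<open>p\<close> under the circle action, whose
  weights are 0, 1 and 2.\<close>

definition angular_energy :: "R5 \<Rightarrow> real" where
  "angular_energy p = (cmod (fst (snd p)))\<^sup>2 + 4 * (cmod (snd (snd p)))\<^sup>2"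

definition calibration :: "R5 \<Rightarrow> real" where
  "calibration p = sqrt ((2 * fst p + 1)\<^sup>2 + 3 * (cmod (fst (snd p)))\<^sup>2)"

text \<open>The tangential gradient of the calibration on the sphere. Where the calibration vanishes it has
  only a junk value.\<close>

definition calib_field :: "R5 \<Rightarrow> R5" where
  "calib_field p = ((2 * fst p + 1) * (fst p + 2) / calibration p - fst p * calibration p,
     (2 * (fst p + 2) / calibration p - calibration p) *\<^sub>R fst (snd p),
     ((2 * fst p + 1) / calibration p - calibration p) *\<^sub>R snd (snd p))"

lemma calibration_sq: "(calibration p)\<^sup>2 = (2 * fst p + 1)\<^sup>2 + 3 * (cmod (fst (snd p)))\<^sup>2"
  by (simp add: calibration_def)

lemma calibration_nonneg: "0 \<le> calibration p"
  by (simp add: calibration_def)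

lemma norm_R5_sq: "(norm (p :: R5))\<^sup>2 = (fst p)\<^sup>2 + (cmod (fst (snd p)))\<^sup>2 + (cmod (snd (snd p)))\<^sup>2"
  by (cases p) (simp add: norm_Pair)

lemma inner_R5: "(p :: R5) \<bullet> q = fst p * fst q + fst (snd p) \<bullet> fst (snd q) + snd (snd p) \<bullet> snd (snd q)"
  by (simp add: inner_prod_def)

text \<open>This is the eikonal equation. After multiplication by the square of the calibration it
  becomes a polynomial identity in \<open>x\<close> and \<open>a\<close>, because the sphere
  determines \<open>b\<close> and the definition determines \<open>v\<^sup>2\<close>.\<close>

lemma norm_calib_field:
  assumes n: "norm p = 1" and V: "calibration p > 0"
  shows "(norm (calib_field p))\<^sup>2 = angular_energy p"
proof -
  define x a b v where "x = fst p" and "a = (cmod (fst (snd p)))\<^sup>2" and "b = (cmod (snd (snd p)))\<^sup>2" and "v = calibration p"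
  have b: "b = 1 - x\<^sup>2 - a" using norm_R5_sq[of p] n by (simp add: x_def a_def b_def)
  have v2: "v\<^sup>2 = (2 * x + 1)\<^sup>2 + 3 * a" by (simp add: v_def calibration_sq x_def a_def)
  have v: "v > 0" using V by (simp add: v_def)
  have X: "(norm (calib_field p))\<^sup>2 = ((2 * x + 1) * (x + 2) / v - x * v)\<^sup>2 + (2 * (x + 2) / v - v)\<^sup>2 * a + ((2 * x + 1) / v - v)\<^sup>2 * b"
    by (simp add: norm_R5_sq calib_field_def x_def a_def b_def v_def power_mult_distrib)
  have e: "(c / v - d * v) * v = c - d * v\<^sup>2" for c d using v by (simp add: field_simps power2_eq_square)
  have "v\<^sup>2 * (norm (calib_field p))\<^sup>2 =
      (((2 * x + 1) * (x + 2) / v - x * v) * v)\<^sup>2 + ((2 * (x + 2) / v - 1 * v) * v)\<^sup>2 * a + (((2 * x + 1) / v - 1 * v) * v)\<^sup>2 * b"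
    unfolding X by (simp add: power_mult_distrib distrib_left mult_ac)
  also have "\<dots> = ((2 * x + 1) * (x + 2) - x * v\<^sup>2)\<^sup>2 + (2 * (x + 2) - v\<^sup>2)\<^sup>2 * a + ((2 * x + 1) - v\<^sup>2)\<^sup>2 * b"
    unfolding e by simp
  also have "\<dots> = v\<^sup>2 * (a + 4 * b)" unfolding v2 b by algebra
  finally show ?thesis using v by (simp add: angular_energy_def a_def b_def)
qed

lemma angular_energy_sphere:
  assumes "norm p = 1"
  shows "angular_energy p = 5 + 4 * fst p - (calibration p)\<^sup>2"
  using norm_R5_sq[of p] assms unfolding calibration_sq angular_energy_def by (simp add: power2_eq_square algebra_simps)

lemma has_vector_derivative_components:
  assumes "(g has_vector_derivative d) (at r within S)"
  shows "((\<lambda>r. fst (g r)) has_vector_derivative fst d) (at r within S)"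
    "((\<lambda>r. snd (g r)) has_vector_derivative snd d) (at r within S)"
  using bounded_linear.has_vector_derivative[OF bounded_linear_fst assms]
    bounded_linear.has_vector_derivative[OF bounded_linear_snd assms] by auto

lemma has_real_derivative_norm_sq:
  fixes g :: "real \<Rightarrow> 'a::real_inner"
  assumes "(g has_vector_derivative d) (at r within S)"
  shows "((\<lambda>r. (norm (g r))\<^sup>2) has_real_derivative 2 * (g r \<bullet> d)) (at r within S)"
proof -
  have "((\<lambda>r. g r \<bullet> g r) has_vector_derivative g r \<bullet> d + d \<bullet> g r) (at r within S)"
    using bounded_bilinear.has_vector_derivative[OF bounded_bilinear_inner assms assms] .
  then show ?thesis
    by (simp add: power2_norm_eq_inner has_real_derivative_iff_has_vector_derivative inner_commute)
qed

lemma sphere_curve_orthogonal: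
  fixes g :: "real \<Rightarrow> 'a::real_inner"
  assumes g: "\<And>t. t \<in> {a..b} \<Longrightarrow> norm (g t) = 1" and ab: "a < b" "r \<in> {a..b}"
    and d: "(g has_vector_derivative d) (at r within {a..b})"
  shows "g r \<bullet> d = 0"
proof -
  have "((\<lambda>r. (norm (g r))\<^sup>2) has_real_derivative 2 * (g r \<bullet> d)) (at r within {a..b})"
    by (rule has_real_derivative_norm_sq[OF d])
  moreover have "((\<lambda>r. (norm (g r))\<^sup>2) has_real_derivative 0) (at r within {a..b})"
  proof -
    have "((\<lambda>_. 1) has_derivative (*) (0::real)) (at r within {a..b})"
      using DERIV_const[of "1::real" "at r within {a..b}"] by (simp only: has_field_derivative_def)
    then show ?thesis
      unfolding has_field_derivative_def by (rule has_derivative_transform[rotated 2]) (use g ab in auto)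
  qed
  moreover have "at r within {a..b} \<noteq> bot" using ab by (simp add: trivial_limit_within islimpt_Icc)
  ultimately have "2 * (g r \<bullet> d) = 0"
    using has_field_derivative_unique by blast
  then show ?thesis by simp
qed

text \<open>\<open>calib_field\<close> is the Euclidean gradient of the calibration minus its radial
  part, so it computes the derivative only in directions tangent to the sphere. Assumption
  \<open>o\<close> expresses the tangency and eliminates the third component of
  \<open>d\<close>.\<close>

lemma calibration_has_derivative:
  assumes n: "norm (g r) = 1" and V: "calibration (g r) > 0" and o: "g r \<bullet> d = 0"
    and d: "(g has_vector_derivative d) (at r within S)"
  shows "((\<lambda>r. calibration (g r)) has_real_derivative calib_field (g r) \<bullet> d) (at r within S)"
proof -
  define x v k1 k2 where "x = fst (g r)" and "v = calibration (g r)"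
    and "k1 = fst (snd (g r)) \<bullet> fst (snd d)" and "k2 = snd (snd (g r)) \<bullet> snd (snd d)"
  note comps = has_vector_derivative_components[OF d] 
  note comp1 = has_vector_derivative_components(1)[OF comps(2)]
  have x: "((\<lambda>r. fst (g r)) has_real_derivative fst d) (at r within S)"
    using comps(1) by (simp add: has_real_derivative_iff_has_vector_derivative)
  have c: "((\<lambda>r. (cmod (fst (snd (g r))))\<^sup>2) has_real_derivative 2 * k1) (at r within S)"
    unfolding k1_def by (rule has_real_derivative_norm_sq[OF comp1])
  have "((\<lambda>r. (2 * fst (g r) + 1)\<^sup>2 + 3 * (cmod (fst (snd (g r))))\<^sup>2) has_real_derivative
      4 * (2 * x + 1) * fst d + 6 * k1) (at r within S)"
  proof -
    have "((\<lambda>r. (2 * fst (g r) + 1)\<^sup>2) has_real_derivative 4 * (2 * x + 1) * fst d) (at r within S)"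
      by (auto intro!: derivative_eq_intros x simp: x_def)
    from DERIV_add[OF this DERIV_cmult[OF c, of 3]] show ?thesis by simp
  qed
  from DERIV_real_sqrt[THEN DERIV_chain2, OF _ this]
  have "((\<lambda>r. calibration (g r)) has_real_derivative inverse v / 2 * (4 * (2 * x + 1) * fst d + 6 * k1)) (at r within S)"
    using V by (simp add: calibration_def v_def)
  moreover have "inverse v / 2 * (4 * (2 * x + 1) * fst d + 6 * k1) = calib_field (g r) \<bullet> d"
  proof -
    have k2: "k2 = - x * fst d - k1" using o by (simp add: inner_R5 x_def k1_def k2_def)
    have "calib_field (g r) \<bullet> d = ((2 * x + 1) * (x + 2) / v - x * v) * fst d + (2 * (x + 2) / v - v) * k1 + ((2 * x + 1) / v - v) * k2"
      by (simp add: inner_R5 calib_field_def x_def v_def k1_def k2_def)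
    also have "\<dots> = inverse v / 2 * (4 * (2 * x + 1) * fst d + 6 * k1)"
      using V unfolding k2 v_def[symmetric] by (simp add: field_simps)
    finally show ?thesis ..
  qed
  ultimately show ?thesis by simp
qed

lemma continuous_on_calibration [continuous_intros]:
  "continuous_on S g \<Longrightarrow> continuous_on S (\<lambda>r. calibration (g r))"
  unfolding calibration_def by (intro continuous_intros)

lemma continuous_on_angular_energy [continuous_intros]:
  "continuous_on S g \<Longrightarrow> continuous_on S (\<lambda>r. angular_energy (g r))"
  unfolding angular_energy_def by (intro continuous_intros)

lemma continuous_on_calib_field:
  "continuous_on S g \<Longrightarrow> (\<And>r. r \<in> S \<Longrightarrow> calibration (g r) > 0) \<Longrightarrow> continuous_on S (\<lambda>r. calib_field (g r))"
  unfolding calib_field_def by (intro continuous_intros) force+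

lemma angular_energy_nonneg: "0 \<le> angular_energy p"
  by (simp add: angular_energy_def)

section \<open>Completing the square along curves on the sphere\<close>

definition radial_energy :: "(real \<Rightarrow> R5) \<Rightarrow> (real \<Rightarrow> R5) \<Rightarrow> real \<Rightarrow> real" where
  "radial_energy g g' r = r * (norm (g' r))\<^sup>2 + angular_energy (g r) / r"

text \<open>In the expanded square the cross term is the derivative of the calibration along
  \<open>g\<close>, and the last term is the angular energy by the eikonal equation. The interval
  stays away from the origin and from the zeros of the calibration, where \<open>calib_field\<close>
  loses its meaning.\<close>

lemma calibration_identity:
  assumes s: "0 < s" "s < t"
    and d: "\<And>r. r \<in> {s..t} \<Longrightarrow> (g has_vector_derivative g' r) (at r within {s..t})"
    and c: "continuous_on {s..t} g'" and n: "\<And>r. r \<in> {s..t} \<Longrightarrow> norm (g r) = 1"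
    and V: "\<And>r. r \<in> {s..t} \<Longrightarrow> calibration (g r) > 0"
  shows "integral {s..t} (radial_energy g g') =
    integral {s..t} (\<lambda>r. r * (norm (g' r + calib_field (g r) /\<^sub>R r))\<^sup>2) + 2 * (calibration (g s) - calibration (g t))"
proof -
  have gc: "continuous_on {s..t} g" using d by (rule continuous_on_vector_derivative)
  have Xc: "continuous_on {s..t} (\<lambda>r. calib_field (g r))" using gc V by (rule continuous_on_calib_field)
  have r0: "r \<noteq> 0" if "r \<in> {s..t}" for r using that s by auto
  have i1: "(\<lambda>r. r * (norm (g' r + calib_field (g r) /\<^sub>R r))\<^sup>2) integrable_on {s..t}"
    using r0 by (intro integrable_continuous_real continuous_intros c Xc) auto
  have i2: "((\<lambda>r. calib_field (g r) \<bullet> g' r) has_integral (calibration (g t) - calibration (g s))) {s..t}"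
  proof (rule fundamental_theorem_of_calculus)
    fix r assume r: "r \<in> {s..t}"
    have "g r \<bullet> g' r = 0" by (rule sphere_curve_orthogonal[OF n s(2) r d[OF r]])
    from calibration_has_derivative[OF n[OF r] V[OF r] this d[OF r]]
    show "((\<lambda>r. calibration (g r)) has_vector_derivative calib_field (g r) \<bullet> g' r) (at r within {s..t})"
      by (simp add: has_real_derivative_iff_has_vector_derivative)
  qed (use s in simp)
  have "integral {s..t} (radial_energy g g') =
      integral {s..t} (\<lambda>r. r * (norm (g' r + calib_field (g r) /\<^sub>R r))\<^sup>2 - 2 * (calib_field (g r) \<bullet> g' r))"
  proof (rule Henstock_Kurzweil_Integration.integral_cong)
    fix r assume r: "r \<in> {s..t}"
    have "(norm (g' r + calib_field (g r) /\<^sub>R r))\<^sup>2 = (norm (g' r))\<^sup>2 + 2 * (calib_field (g r) \<bullet> g' r) / r + (norm (calib_field (g r)))\<^sup>2 / r\<^sup>2"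
    proof -
      have "(norm (a + b))\<^sup>2 = (norm a)\<^sup>2 + 2 * (b \<bullet> a) + (norm b)\<^sup>2" for a b :: R5
        unfolding power2_norm_eq_inner by (simp add: inner_add_left inner_add_right inner_commute)
      from this[of "g' r" "calib_field (g r) /\<^sub>R r"] show ?thesis
        by (simp add: power_mult_distrib power_inverse divide_inverse_commute)
    qed
    with r0[OF r] show "radial_energy g g' r = r * (norm (g' r + calib_field (g r) /\<^sub>R r))\<^sup>2 - 2 * (calib_field (g r) \<bullet> g' r)"
      unfolding norm_calib_field[OF n[OF r] V[OF r]] radial_energy_def
      by (simp add: field_simps power2_eq_square)
  qed
  also have "\<dots> = integral {s..t} (\<lambda>r. r * (norm (g' r + calib_field (g r) /\<^sub>R r))\<^sup>2) - integral {s..t} (\<lambda>r. 2 * (calib_field (g r) \<bullet> g' r))"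
    using i1 i2 by (intro Henstock_Kurzweil_Integration.integral_diff) (auto intro!: integrable_on_mult_right)
  also have "integral {s..t} (\<lambda>r. 2 * (calib_field (g r) \<bullet> g' r)) = 2 * (calibration (g t) - calibration (g s))"
    using i2 by (simp add: integral_unique)
  finally show ?thesis by simp
qed

text \<open>The calibration is the norm of an affine map whose linear part scales the components by
  2, \<open>sqrt 3\<close> and 0.\<close>

lemma calibration_lipschitz: "\<bar>calibration p - calibration q\<bar> \<le> 2 * norm (p - q)"
proof -
  let ?N = "\<lambda>p :: R5. (2 * fst p + 1, sqrt 3 *\<^sub>R fst (snd p))"
  have N: "calibration p = norm (?N p)" for p by (simp add: calibration_def norm_Pair power_mult_distrib)
  have "\<bar>calibration p - calibration q\<bar> \<le> norm (?N p - ?N q)" unfolding N by (rule norm_triangle_ineq3)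
  also have "?N p - ?N q = (2 * fst (p - q), sqrt 3 *\<^sub>R fst (snd (p - q)))" by (simp add: scaleR_diff_right)
  also have "norm (2 * fst d, sqrt 3 *\<^sub>R fst (snd d)) \<le> 2 * norm d" for d :: R5
  proof (rule power2_le_imp_le)
    show "(norm (2 * fst d, sqrt 3 *\<^sub>R fst (snd d)))\<^sup>2 \<le> (2 * norm d)\<^sup>2"
      unfolding power_mult_distrib norm_R5_sq by (simp add: norm_Pair power_mult_distrib)
  qed simp
  finally show ?thesis .
qed

text \<open>On the unit ball the squared modulus of each complex component changes by at most twice
  the distance, and the weights 1 and 4 give \<open>2 + 4 * 2 = 10\<close>.\<close>

lemma angular_energy_lipschitz:
  assumes "norm p = 1" "norm q = 1"
  shows "\<bar>angular_energy p - angular_energy q\<bar> \<le> 10 * norm (p - q)"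
proof -
  have sq: "\<bar>(norm c)\<^sup>2 - (norm d)\<^sup>2\<bar> \<le> 2 * \<delta>" if "norm c \<le> 1" "norm d \<le> 1" "norm (c - d) \<le> \<delta>" for c d :: complex and \<delta>
  proof -
    have "\<bar>(norm c)\<^sup>2 - (norm d)\<^sup>2\<bar> = \<bar>norm c + norm d\<bar> * \<bar>norm c - norm d\<bar>"
      unfolding abs_mult[symmetric] by (simp add: power2_eq_square algebra_simps)
    also have "\<dots> \<le> 2 * \<delta>"
      using that norm_triangle_ineq3[of c d] by (intro mult_mono) auto
    finally show ?thesis .
  qed
  have comp: "norm (fst (snd p)) \<le> norm p" "norm (snd (snd p)) \<le> norm p" for p :: R5
    by (cases p; auto intro: order_trans[OF norm_fst_le norm_snd_le] order_trans[OF norm_snd_le norm_snd_le])+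
  have "\<bar>(norm (fst (snd p)))\<^sup>2 - (norm (fst (snd q)))\<^sup>2\<bar> \<le> 2 * norm (p - q)"
    using comp[of p] comp[of q] comp[of "p - q"] assms by (intro sq) auto
  moreover have "\<bar>(norm (snd (snd p)))\<^sup>2 - (norm (snd (snd q)))\<^sup>2\<bar> \<le> 2 * norm (p - q)"
    using comp[of p] comp[of q] comp[of "p - q"] assms by (intro sq) auto
  ultimately show ?thesis unfolding angular_energy_def by linarith
qed

lemma calibration_zero:
  assumes "norm p = 1" "calibration p = 0"
  shows "angular_energy p = 3"
proof -
  have "(2 * fst p + 1)\<^sup>2 + 3 * (cmod (fst (snd p)))\<^sup>2 = 0" using assms(2) calibration_sq[of p] by simp
  then have "fst p = - 1 / 2" by (simp add: add_nonneg_eq_0_iff)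
  then show ?thesis using angular_energy_sphere[OF assms(1)] assms(2) by simp
qed

text \<open>The profile need not be differentiable, so its energy enters only as an upper bound \<open>E\<close> for the
  energies of nearby smooth curves on the sphere.\<close>

locale approximable_profile =
  fixes f :: "real \<Rightarrow> R5" and E :: real
  assumes cont: "continuous_on {0..1} f"
    and norm1: "\<And>r. r \<in> {0..1} \<Longrightarrow> norm (f r) = 1"
    and end1: "calibration (f 1) = 0"
    and start: "calibration (f 0) > 0"
    and approx: "\<And>\<epsilon> \<eta>. 0 < \<epsilon> \<Longrightarrow> \<epsilon> < 1 \<Longrightarrow> 0 < \<eta> \<Longrightarrow> \<exists>g g'.
      (\<forall>r\<in>{\<epsilon>..1}. (g has_vector_derivative g' r) (at r within {\<epsilon>..1}) \<and> norm (g r) = 1 \<and> norm (g r - f r) \<le> \<eta>) \<and>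
      continuous_on {\<epsilon>..1} g' \<and> pi * integral {\<epsilon>..1} (radial_energy g g') \<le> E + \<eta>"
begin

abbreviation defect :: "(real \<Rightarrow> R5) \<Rightarrow> (real \<Rightarrow> R5) \<Rightarrow> real \<Rightarrow> real" where
  "defect g g' r \<equiv> r * (norm (g' r + calib_field (g r) /\<^sub>R r))\<^sup>2"

text \<open>The square is completed only on \<open>[s, t]\<close>, where the calibration of
  \<open>f\<close> is positive. On \<open>[t, 1]\<close> the radial derivative is dropped and the
  angular energy is kept, since it is what rules out an early zero.\<close>

lemma approx_bound:
  assumes s: "0 < s" "s < t" "t \<le> 1" and V: "\<And>r. r \<in> {s..t} \<Longrightarrow> calibration (f r) > 0" and \<eta>: "\<eta> > 0"
  obtains g g' where "\<And>r. r \<in> {s..1} \<Longrightarrow> (g has_vector_derivative g' r) (at r within {s..1})"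
    "\<And>r. r \<in> {s..1} \<Longrightarrow> norm (g r) = 1" "\<And>r. r \<in> {s..1} \<Longrightarrow> norm (g r - f r) \<le> \<eta>"
    "continuous_on {s..1} g'" "\<And>r. r \<in> {s..t} \<Longrightarrow> calibration (g r) \<ge> calibration (f r) / 2"
    "pi * integral {s..t} (defect g g') + pi * integral {t..1} (\<lambda>r. angular_energy (g r) / r)
       + 2 * pi * (calibration (f s) - calibration (f t)) \<le> E + 40 * \<eta>"
proof -
  have fc: "continuous_on {s..t} (\<lambda>r. calibration (f r))"
    using s by (intro continuous_intros continuous_on_subset[OF cont]) auto
  have "{s..t} \<noteq> {}" using s by auto
  from continuous_attains_inf[OF compact_Icc this fc]
  obtain r0 where r0: "r0 \<in> {s..t}" "\<And>r. r \<in> {s..t} \<Longrightarrow> calibration (f r0) \<le> calibration (f r)" by blast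
  \<comment> \<open>The calibration is 2-Lipschitz, so closeness within a quarter of its minimum
    along \<open>f\<close> leaves at least half of it along \<open>g\<close>.\<close>
  define \<eta>' where "\<eta>' = min \<eta> (calibration (f r0) / 4)"
  have \<eta>': "0 < \<eta>'" "\<eta>' \<le> \<eta>" "\<And>r. r \<in> {s..t} \<Longrightarrow> 4 * \<eta>' \<le> calibration (f r)"
    using \<eta> V[OF r0(1)] r0(2) by (force simp: \<eta>'_def)+
  have "s < 1" using s by simp
  from approx[OF s(1) this \<eta>'(1)] obtain g g' where g:
    "\<And>r. r \<in> {s..1} \<Longrightarrow> (g has_vector_derivative g' r) (at r within {s..1})"
    "\<And>r. r \<in> {s..1} \<Longrightarrow> norm (g r) = 1" "\<And>r. r \<in> {s..1} \<Longrightarrow> norm (g r - f r) \<le> \<eta>'"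
    "continuous_on {s..1} g'" "pi * integral {s..1} (radial_energy g g') \<le> E + \<eta>'"
    by metis
  have gV: "\<bar>calibration (g r) - calibration (f r)\<bar> \<le> 2 * \<eta>'" if "r \<in> {s..1}" for r
    using calibration_lipschitz[of "g r" "f r"] g(3)[OF that] by linarith
  have half: "calibration (g r) \<ge> calibration (f r) / 2" if "r \<in> {s..t}" for r
    using gV[of r] \<eta>'(3)[OF that] that s by auto
  have pos: "calibration (g r) > 0" if "r \<in> {s..t}" for r
    using half[OF that] V[OF that] by linarith
  have gc: "continuous_on {s..1} g" using g(1) by (rule continuous_on_vector_derivative)
  have rc: "continuous_on {s..1} (radial_energy g g')"
    unfolding radial_energy_def[abs_def] using s by (intro continuous_intros gc g(4)) auto
  have ri: "radial_energy g g' integrable_on {s..1}" using rc by (rule integrable_continuous_real)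
  have "integral {s..1} (radial_energy g g') = integral {s..t} (radial_energy g g') + integral {t..1} (radial_energy g g')"
    using s by (intro Henstock_Kurzweil_Integration.integral_combine[symmetric] ri) auto
  moreover have "integral {t..1} (radial_energy g g') \<ge> integral {t..1} (\<lambda>r. angular_energy (g r) / r)"
  proof (rule integral_le)
    show "(\<lambda>r. angular_energy (g r) / r) integrable_on {t..1}"
      using s by (intro integrable_continuous_real continuous_intros continuous_on_subset[OF gc]) auto
    show "radial_energy g g' integrable_on {t..1}"
      using s by (intro integrable_continuous_real continuous_on_subset[OF rc]) auto
    show "angular_energy (g r) / r \<le> radial_energy g g' r" if "r \<in> {t..1}" for r
      using that s by (simp add: radial_energy_def)
  qed
  moreover have "integral {s..t} (radial_energy g g') = integral {s..t} (defect g g') + 2 * (calibration (g s) - calibration (g t))"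
  proof (rule calibration_identity[OF s(1,2)])
    show "(g has_vector_derivative g' r) (at r within {s..t})" if "r \<in> {s..t}" for r
      using g(1)[of r] that s by (auto intro: has_vector_derivative_within_subset)
    show "continuous_on {s..t} g'" using s by (intro continuous_on_subset[OF g(4)]) auto
  qed (use g(2) pos s in auto)
  ultimately have "integral {s..t} (defect g g') + integral {t..1} (\<lambda>r. angular_energy (g r) / r)
      + 2 * (calibration (g s) - calibration (g t)) \<le> integral {s..1} (radial_energy g g')" by linarith
  then have "pi * (integral {s..t} (defect g g') + integral {t..1} (\<lambda>r. angular_energy (g r) / r)
      + 2 * (calibration (g s) - calibration (g t))) \<le> E + \<eta>'"
    using g(5) by (meson mult_left_mono order_trans pi_ge_zero)
  then have 1: "pi * integral {s..t} (defect g g') + pi * integral {t..1} (\<lambda>r. angular_energy (g r) / r)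
      + pi * (2 * (calibration (g s) - calibration (g t))) \<le> E + \<eta>'"
    by (simp only: distrib_left)
  \<comment> \<open>Passing from \<open>g\<close> to \<open>f\<close> costs at most
    \<open>2 * \<eta>'\<close> at each end, hence \<open>8 * \<eta>'\<close> after doubling and less
    than \<open>32 * \<eta>'\<close> after the factor \<open>pi\<close>. With the
    \<open>\<eta>'\<close> from the energy bound this is 33, rounded up to 40.\<close>
  have "pi * (2 * (calibration (f s) - calibration (f t))) \<le> pi * (2 * (calibration (g s) - calibration (g t)) + 8 * \<eta>')"
    using gV[of s] gV[of t] s by (intro mult_left_mono) auto
  also have "\<dots> = pi * (2 * (calibration (g s) - calibration (g t))) + pi * (8 * \<eta>')" by (rule distrib_left)
  also have "pi * (8 * \<eta>') \<le> 4 * (8 * \<eta>')" using \<eta>'(1) pi_less_4 by (intro mult_right_mono) auto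
  finally have 2: "2 * pi * (calibration (f s) - calibration (f t)) \<le> pi * (2 * (calibration (g s) - calibration (g t))) + 4 * (8 * \<eta>')"
    by (simp only: mult_ac)
  from 1 2 have "pi * integral {s..t} (defect g g') + pi * integral {t..1} (\<lambda>r. angular_energy (g r) / r)
       + 2 * pi * (calibration (f s) - calibration (f t)) \<le> E + 40 * \<eta>"
    using \<eta>'(1,2) by linarith
  moreover have "\<And>r. r \<in> {s..1} \<Longrightarrow> norm (g r - f r) \<le> \<eta>" using g(3) \<eta>'(2) order_trans by blast
  ultimately show thesis using that g(1,2,4) half by blast
qed

lemma calibration_cont: "continuous_on {0..1} (\<lambda>r. calibration (f r))"
  by (intro continuous_intros cont)

lemma first_zero:
  obtains \<tau> where "0 < \<tau>" "\<tau> \<le> 1" "calibration (f \<tau>) = 0" "\<And>r. 0 \<le> r \<Longrightarrow> r < \<tau> \<Longrightarrow> calibration (f r) > 0"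
proof -
  define Z where "Z = {r \<in> {0..1}. calibration (f r) = 0}"
  have "closed Z" unfolding Z_def
    by (intro continuous_closed_preimage_constant calibration_cont closed_atLeastAtMost)
  then have "compact ({0..1} \<inter> Z)" by (intro compact_Int_closed compact_Icc)
  moreover have "{0..1} \<inter> Z = Z" by (auto simp: Z_def)
  ultimately have "compact Z" by simp
  moreover have "Z \<noteq> {}" using end1 by (auto simp: Z_def)
  ultimately obtain \<tau> where \<tau>: "\<tau> \<in> Z" "\<And>r. r \<in> Z \<Longrightarrow> \<tau> \<le> r" using compact_attains_inf by metis
  have "\<tau> \<noteq> 0" using \<tau>(1) start by (auto simp: Z_def)
  moreover have "calibration (f r) > 0" if "0 \<le> r" "r < \<tau>" for r
  proof -
    have "r \<notin> Z" using \<tau>(2)[of r] that by auto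
    then show ?thesis using that \<tau>(1) calibration_nonneg[of "f r"] by (auto simp: Z_def)
  qed
  moreover have "0 \<le> \<tau>" "\<tau> \<le> 1" "calibration (f \<tau>) = 0" using \<tau>(1) by (auto simp: Z_def)
  ultimately show thesis using that[of \<tau>] by simp
qed

text \<open>The bound holds for all smaller \<open>s\<close> and all larger \<open>t\<close>, so
  that a window prescribed in advance can later be enlarged until it is nearly optimal.\<close>

lemma near_optimal_window:
  assumes \<tau>: "0 < \<tau>" "\<tau> \<le> 1" "calibration (f \<tau>) = 0" and \<delta>: "\<delta> > 0"
  obtains s0 t0 where "0 < s0" "s0 < t0" "t0 < \<tau>"
    "\<And>s t. 0 < s \<Longrightarrow> s \<le> s0 \<Longrightarrow> t0 \<le> t \<Longrightarrow> t < \<tau> \<Longrightarrow> calibration (f 0) - \<delta> \<le> calibration (f s) - calibration (f t)"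
proof -
  have ex: "\<exists>d>0. \<forall>r\<in>{0..1}. \<bar>r - a\<bar> < d \<longrightarrow> \<bar>calibration (f r) - calibration (f a)\<bar> < \<delta> / 2" if "a \<in> {0..1}" for a
  proof -
    have "0 < \<delta> / 2" using \<delta> by simp
    then show ?thesis using calibration_cont that unfolding continuous_on_iff dist_real_def by blast
  qed
  obtain d1 where d1: "d1 > 0" "\<And>r. r \<in> {0..1} \<Longrightarrow> \<bar>r\<bar> < d1 \<Longrightarrow> \<bar>calibration (f r) - calibration (f 0)\<bar> < \<delta> / 2"
    using ex[of 0] by auto
  obtain d2 where d2: "d2 > 0" "\<And>r. r \<in> {0..1} \<Longrightarrow> \<bar>r - \<tau>\<bar> < d2 \<Longrightarrow> \<bar>calibration (f r)\<bar> < \<delta> / 2"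
    using ex[of \<tau>] \<tau> by auto
  define s0 t0 where "s0 = min (d1 / 2) (\<tau> / 3)" and "t0 = max (\<tau> - d2 / 2) (\<tau> / 2)"
  show thesis
  proof
    show "0 < s0" "s0 < t0" "t0 < \<tau>" using d1(1) d2(1) \<tau> by (auto simp: s0_def t0_def)
    fix s t assume st: "0 < s" "s \<le> s0" "t0 \<le> t" "t < \<tau>"
    have "\<bar>calibration (f s) - calibration (f 0)\<bar> < \<delta> / 2" using st d1(1) \<tau> by (intro d1(2)) (auto simp: s0_def)
    moreover have "\<bar>calibration (f t)\<bar> < \<delta> / 2" using st d2(1) \<tau> by (intro d2(2)) (auto simp: t0_def)
    ultimately show "calibration (f 0) - \<delta> \<le> calibration (f s) - calibration (f t)" by linarith
  qed
qed

text \<open>For a non-integrable integrand the claim holds because \<open>integral\<close> is then 0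
  by convention. The same applies to \<open>defect_nonneg\<close>.\<close>

lemma angular_part_nonneg: "0 < t \<Longrightarrow> 0 \<le> integral {t..1} (\<lambda>r. angular_energy (g r) / r)"
  by (cases "(\<lambda>r. angular_energy (g r) / r) integrable_on {t..1}")
    (auto intro!: integral_nonneg divide_nonneg_nonneg angular_energy_nonneg simp: not_integrable_integral)

lemma defect_nonneg: "0 < s \<Longrightarrow> 0 \<le> integral {s..t} (defect g g')"
  by (cases "defect g g' integrable_on {s..t}")
    (auto intro!: integral_nonneg simp: not_integrable_integral)

lemma energy_ge: "2 * pi * calibration (f 0) \<le> E"
proof (rule field_le_epsilon)
  fix e :: real assume e: "e > 0"
  obtain \<tau> where \<tau>: "0 < \<tau>" "\<tau> \<le> 1" "calibration (f \<tau>) = 0" "\<And>r. 0 \<le> r \<Longrightarrow> r < \<tau> \<Longrightarrow> calibration (f r) > 0"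
    by (rule first_zero) blast
  \<comment> \<open>The error \<open>e\<close> is spent in two halves:
    \<open>2 * pi * (e / 16)\<close> is at most \<open>e / 2\<close> because \<open>pi < 4\<close>,
    and \<open>40 * (e / 80)\<close> is \<open>e / 2\<close>.\<close>
  obtain s t where w: "0 < s" "s < t" "t < \<tau>" "calibration (f 0) - e / 16 \<le> calibration (f s) - calibration (f t)"
    using near_optimal_window[OF \<tau>(1-3), of "e / 16"] e by (metis divide_pos_pos order_refl zero_less_numeral)
  obtain g g' where g: "pi * integral {s..t} (defect g g') + pi * integral {t..1} (\<lambda>r. angular_energy (g r) / r)
       + 2 * pi * (calibration (f s) - calibration (f t)) \<le> E + 40 * (e / 80)"
    by (rule approx_bound[of s t "e / 80"]) (use w \<tau> e in auto)
  have "0 \<le> pi * integral {s..t} (defect g g')" "0 \<le> pi * integral {t..1} (\<lambda>r. angular_energy (g r) / r)"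
    using w by (auto intro!: mult_nonneg_nonneg defect_nonneg angular_part_nonneg)
  moreover have "2 * pi * (calibration (f 0) - e / 16) \<le> 2 * pi * (calibration (f s) - calibration (f t))"
    using w by (intro mult_left_mono) auto
  moreover have "pi * e \<le> 4 * e" using e pi_less_4 by (intro mult_right_mono) auto
  ultimately show "2 * pi * calibration (f 0) \<le> E + e"
    using g by (simp add: algebra_simps)
qed

context
  assumes minimal: "E \<le> 2 * pi * calibration (f 0)"
begin

text \<open>For a minimizer the difference of the calibrations already uses up the energy except for
  \<open>e\<close>. The two remaining terms, the defect and the angular energy after the zero, are
  nonnegative, so each of them is at most \<open>e\<close>.\<close>

lemma minimal_approx:
  assumes \<tau>: "0 < \<tau>" "\<tau> \<le> 1" "calibration (f \<tau>) = 0" "\<And>r. 0 \<le> r \<Longrightarrow> r < \<tau> \<Longrightarrow> calibration (f r) > 0"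
    and s: "0 < s" "s < t" "t < \<tau>" and e: "e > 0"
  obtains g g' where "\<And>r. r \<in> {s..1} \<Longrightarrow> (g has_vector_derivative g' r) (at r within {s..1})"
    "\<And>r. r \<in> {s..1} \<Longrightarrow> norm (g r) = 1" "\<And>r. r \<in> {s..1} \<Longrightarrow> norm (g r - f r) \<le> e"
    "continuous_on {s..1} g'" "\<And>r. r \<in> {s..t} \<Longrightarrow> calibration (g r) \<ge> calibration (f r) / 2"
    "integral {s..t} (defect g g') \<le> e" "integral {\<tau>..1} (\<lambda>r. angular_energy (g r) / r) \<le> e"
proof -
  obtain s0 t0 where w: "0 < s0" "s0 < t0" "t0 < \<tau>"
    "\<And>s t. 0 < s \<Longrightarrow> s \<le> s0 \<Longrightarrow> t0 \<le> t \<Longrightarrow> t < \<tau> \<Longrightarrow> calibration (f 0) - e / 16 \<le> calibration (f s) - calibration (f t)"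
    using near_optimal_window[OF \<tau>(1-3), of "e / 16"] e by auto
  \<comment> \<open>The prescribed window is enlarged until it is nearly optimal; the defect on the
    smaller window is bounded by that on the larger one.\<close>
  define s1 t1 where "s1 = min s s0" and "t1 = max t t0"
  have s1: "0 < s1" "s1 \<le> s" "s1 < t1" "t \<le> t1" "t1 < \<tau>" using w s by (auto simp: s1_def t1_def)
  have win: "calibration (f 0) - e / 16 \<le> calibration (f s1) - calibration (f t1)"
    using w(4)[of s1 t1] s1 by (auto simp: s1_def t1_def)
  obtain g g' where g: "\<And>r. r \<in> {s1..1} \<Longrightarrow> (g has_vector_derivative g' r) (at r within {s1..1})"
    "\<And>r. r \<in> {s1..1} \<Longrightarrow> norm (g r) = 1" "\<And>r. r \<in> {s1..1} \<Longrightarrow> norm (g r - f r) \<le> e / 80"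
    "continuous_on {s1..1} g'" "\<And>r. r \<in> {s1..t1} \<Longrightarrow> calibration (g r) \<ge> calibration (f r) / 2"
    "pi * integral {s1..t1} (defect g g') + pi * integral {t1..1} (\<lambda>r. angular_energy (g r) / r)
       + 2 * pi * (calibration (f s1) - calibration (f t1)) \<le> E + 40 * (e / 80)"
    by (rule approx_bound[of s1 t1 "e / 80"]) (use s1 \<tau> e in auto)
  have gc: "continuous_on {s1..1} g" using g(1) by (rule continuous_on_vector_derivative)
  have "continuous_on {s1..t1} (\<lambda>r. calib_field (g r))"
  proof (rule continuous_on_calib_field)
    show "continuous_on {s1..t1} g" using s1 \<tau> by (intro continuous_on_subset[OF gc]) auto
    show "calibration (g r) > 0" if "r \<in> {s1..t1}" for r
    proof -
      have "calibration (f r) > 0" using that s1 by (intro \<tau>(4)) auto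
      with g(5)[OF that] show ?thesis by linarith
    qed
  qed
  moreover have "continuous_on {s1..t1} g'" using s1 \<tau> by (intro continuous_on_subset[OF g(4)]) auto
  ultimately have dc: "continuous_on {s1..t1} (defect g g')" using s1 by (intro continuous_intros) auto
  have d1: "integral {s..t} (defect g g') \<le> integral {s1..t1} (defect g g')"
    using s1 s by (intro integral_subset_le integrable_continuous_real continuous_on_subset[OF dc]) auto
  have wc: "continuous_on {t1..1} (\<lambda>r. angular_energy (g r) / r)"
    using s1 by (intro continuous_intros continuous_on_subset[OF gc]) auto
  have d2: "integral {\<tau>..1} (\<lambda>r. angular_energy (g r) / r) \<le> integral {t1..1} (\<lambda>r. angular_energy (g r) / r)"
    using s1 \<tau> by (intro integral_subset_le integrable_continuous_real continuous_on_subset[OF wc])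
      (auto intro!: divide_nonneg_nonneg angular_energy_nonneg)
  have n: "0 \<le> integral {s1..t1} (defect g g')" "0 \<le> integral {t1..1} (\<lambda>r. angular_energy (g r) / r)"
    using s1 by (auto intro!: defect_nonneg angular_part_nonneg)
  have "2 * pi * (calibration (f 0) - e / 16) \<le> 2 * pi * (calibration (f s1) - calibration (f t1))"
    using win by (intro mult_left_mono) auto
  moreover have "pi * e \<le> 4 * e" using e pi_less_4 by (intro mult_right_mono) auto
  ultimately have p1: "pi * (integral {s1..t1} (defect g g') + integral {t1..1} (\<lambda>r. angular_energy (g r) / r)) \<le> e"
    using g(6) minimal by (simp add: algebra_simps)
  have p2: "1 * (integral {s1..t1} (defect g g') + integral {t1..1} (\<lambda>r. angular_energy (g r) / r))
      \<le> pi * (integral {s1..t1} (defect g g') + integral {t1..1} (\<lambda>r. angular_energy (g r) / r))"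
    using n pi_gt3 by (intro mult_right_mono) auto
  have sum: "integral {s1..t1} (defect g g') + integral {t1..1} (\<lambda>r. angular_energy (g r) / r) \<le> e"
    using order_trans[OF p2 p1] by (simp only: mult_1)
  show thesis
  proof (rule that[of g g'])
    show "(g has_vector_derivative g' r) (at r within {s..1})" if "r \<in> {s..1}" for r
      using g(1)[of r] that s1 by (auto intro: has_vector_derivative_within_subset)
    show "norm (g r - f r) \<le> e" if "r \<in> {s..1}" for r
      using g(3)[of r] that s1 e by auto
    show "continuous_on {s..1} g'" using s1 by (intro continuous_on_subset[OF g(4)]) auto
    show "integral {s..t} (defect g g') \<le> e" using d1 n sum by linarith
    show "integral {\<tau>..1} (\<lambda>r. angular_energy (g r) / r) \<le> e" using d2 n sum by linarith
  qed (use g(2,5) s1 in auto)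
qed

text \<open>At a zero of the calibration the potential is 3. If there were a zero before the boundary, then
  the angular energy beyond it would be wasted.\<close>

lemma no_early_zero:
  assumes "0 \<le> r" "r < 1"
  shows "calibration (f r) > 0"
proof -
  obtain \<tau> where \<tau>: "0 < \<tau>" "\<tau> \<le> 1" "calibration (f \<tau>) = 0" "\<And>r. 0 \<le> r \<Longrightarrow> r < \<tau> \<Longrightarrow> calibration (f r) > 0"
    by (rule first_zero) blast
  have "\<tau> = 1"
  proof (rule ccontr)
    assume "\<tau> \<noteq> 1"
    with \<tau>(2) have t1: "\<tau> < 1" by simp
    have W3: "angular_energy (f \<tau>) = 3" using \<tau> norm1 by (intro calibration_zero) auto
    have "continuous_on {0..1} (\<lambda>r. angular_energy (f r))" by (intro continuous_intros cont)
    then have "\<exists>d>0. \<forall>r\<in>{0..1}. dist r \<tau> < d \<longrightarrow> dist (angular_energy (f r)) (angular_energy (f \<tau>)) < 1"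
      using \<tau>(1,2) unfolding continuous_on_iff by (meson atLeastAtMost_iff less_imp_le zero_less_one)
    then obtain d where d: "d > 0" "\<And>r. r \<in> {0..1} \<Longrightarrow> \<bar>r - \<tau>\<bar> < d \<Longrightarrow> \<bar>angular_energy (f r) - 3\<bar> < 1"
      unfolding dist_real_def W3 by blast
    define \<rho> where "\<rho> = min (d / 2) (1 - \<tau>)"
    have \<rho>: "0 < \<rho>" "\<rho> < d" "\<tau> + \<rho> \<le> 1" using d(1) t1 by (auto simp: \<rho>_def)
    \<comment> \<open>Near \<open>\<tau>\<close> the angular energy of \<open>f\<close> exceeds 2.
      With Lipschitz constant 10 and \<open>10 * e \<le> 1\<close> that of \<open>g\<close> is at
      least 1, so the tail integral is at least \<open>\<rho>\<close>, while minimality bounds it by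
      \<open>e < \<rho>\<close>.\<close>
    define e where "e = min (\<rho> / 2) (1 / 10)"
    have e: "0 < e" "e < \<rho>" "10 * e \<le> 1" using \<rho> by (auto simp: e_def)
    obtain g g' where g: "\<And>r. r \<in> {\<tau> / 3..1} \<Longrightarrow> (g has_vector_derivative g' r) (at r within {\<tau> / 3..1})"
      "\<And>r. r \<in> {\<tau> / 3..1} \<Longrightarrow> norm (g r) = 1" "\<And>r. r \<in> {\<tau> / 3..1} \<Longrightarrow> norm (g r - f r) \<le> e"
      "integral {\<tau>..1} (\<lambda>r. angular_energy (g r) / r) \<le> e"
      by (rule minimal_approx[OF \<tau>, of "\<tau> / 3" "\<tau> / 2" e]) (use \<tau> e in auto)
    have gc: "continuous_on {\<tau> / 3..1} g" using g(1) by (rule continuous_on_vector_derivative)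
    have wi: "(\<lambda>r. angular_energy (g r) / r) integrable_on {a..b}" if "\<tau> \<le> a" "b \<le> 1" for a b
      using \<tau> that by (intro integrable_continuous_real continuous_intros continuous_on_subset[OF gc]) auto
    have "integral {\<tau>..\<tau> + \<rho>} (\<lambda>r. 1) \<le> integral {\<tau>..\<tau> + \<rho>} (\<lambda>r. angular_energy (g r) / r)"
    proof (rule integral_le)
      show "(\<lambda>r. angular_energy (g r) / r) integrable_on {\<tau>..\<tau> + \<rho>}" using \<rho> by (intro wi) auto
      show "1 \<le> angular_energy (g r) / r" if "r \<in> {\<tau>..\<tau> + \<rho>}" for r
      proof -
        have r: "r \<in> {\<tau> / 3..1}" "r \<in> {0..1}" "0 < r" "\<bar>r - \<tau>\<bar> < d" using that \<rho> \<tau> by auto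
        have "\<bar>angular_energy (g r) - angular_energy (f r)\<bar> \<le> 10 * norm (g r - f r)"
          using g(2) norm1 r by (intro angular_energy_lipschitz) auto
        also have "\<dots> \<le> 10 * e" using g(3)[OF r(1)] by simp
        finally have "angular_energy (g r) \<ge> 1" using d(2)[OF r(2,4)] e(3) by linarith
        then show ?thesis using r by (simp add: le_divide_eq)
      qed
    qed auto
    also have "\<dots> \<le> integral {\<tau>..1} (\<lambda>r. angular_energy (g r) / r)"
      using \<rho> \<tau> by (intro integral_subset_le wi) (auto intro!: divide_nonneg_nonneg angular_energy_nonneg)
    finally have "\<rho> \<le> e" using g(4) \<rho> by simp
    with e show False by simp
  qed
  then show ?thesis using \<tau>(4) assms by simp
qed

text \<open>The derivatives of the approximating curves need not converge, so the limit is taken in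
  the integrated equation: its error is the integral of \<open>h\<close>, controlled by the defect,
  and all other terms converge uniformly.\<close>

lemma gradient_flow_integral:
  assumes s: "0 < s" "s < t" "t < 1"
  shows "f t - f s + integral {s..t} (\<lambda>r. calib_field (f r) /\<^sub>R r) = 0" (is "?D = 0")
proof -
  have Vpos: "\<And>r. 0 \<le> r \<Longrightarrow> r < 1 \<Longrightarrow> calibration (f r) > 0" by (rule no_early_zero)
  have fc: "continuous_on {s..t} f" using s by (intro continuous_on_subset[OF cont]) auto
  have fX: "continuous_on {s..t} (\<lambda>r. calib_field (f r))"
    using fc by (rule continuous_on_calib_field) (use s Vpos in auto)
  have fV: "continuous_on {s..t} (\<lambda>r. calibration (f r))" by (intro continuous_intros fc)
  have "{s..t} \<noteq> {}" using s by auto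
  from continuous_attains_inf[OF compact_Icc this fV]
  obtain r0 where r0: "r0 \<in> {s..t}" "\<And>r. r \<in> {s..t} \<Longrightarrow> calibration (f r0) \<le> calibration (f r)" by blast
  define v where "v = calibration (f r0) / 2"
  have v: "v > 0" using Vpos[of r0] r0(1) s by (auto simp: v_def)
  \<comment> \<open>A compact part of the sphere away from the zeros of the calibration. It contains
    the values of \<open>f\<close> and of all approximating curves on \<open>[s, t]\<close>, and
    \<open>calib_field\<close> is uniformly continuous on it.\<close>
  define C where "C = sphere (0::R5) 1 \<inter> {p. v \<le> calibration p}"
  have Cc: "compact C"
    unfolding C_def by (intro compact_Int_closed compact_sphere closed_Collect_le continuous_intros)
  have "continuous_on C calib_field"
    using continuous_on_calib_field[of C "\<lambda>p. p"] v by (auto simp: C_def)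
  then have uc: "uniformly_continuous_on C calib_field" using Cc by (rule compact_uniformly_continuous)
  have small: "norm ?D \<le> 5 * k" if k: "k > 0" for k
  proof -
    obtain \<eta> where \<eta>: "\<eta> > 0" "\<And>p q. p \<in> C \<Longrightarrow> q \<in> C \<Longrightarrow> norm (p - q) < \<eta> \<Longrightarrow> norm (calib_field p - calib_field q) < k * s"
      using uc k s unfolding uniformly_continuous_on_def dist_norm by (metis mult_pos_pos)
    \<comment> \<open>The three entries serve the uniform continuity of the field, the error at the
      two ends, and the defect, which contributes \<open>e / (s * k) \<le> k\<close>. Altogether
      \<open>5 * k\<close>: two from \<open>h\<close>, one from each end and one from the
      field.\<close>
    define e where "e = Min {\<eta> / 2, k, s * k\<^sup>2}"
    have e: "0 < e" "e < \<eta>" "e \<le> k" "e \<le> s * k\<^sup>2" using \<eta> k s by (auto simp: e_def)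
    obtain g g' where g: "\<And>r. r \<in> {s..1} \<Longrightarrow> (g has_vector_derivative g' r) (at r within {s..1})"
      "\<And>r. r \<in> {s..1} \<Longrightarrow> norm (g r) = 1" "\<And>r. r \<in> {s..1} \<Longrightarrow> norm (g r - f r) \<le> e"
      "continuous_on {s..1} g'" "\<And>r. r \<in> {s..t} \<Longrightarrow> calibration (g r) \<ge> calibration (f r) / 2"
      "integral {s..t} (defect g g') \<le> e"
      by (rule minimal_approx[of 1 s t e]) (use s e end1 Vpos in auto)
    have gc: "continuous_on {s..t} g"
      using s continuous_on_vector_derivative[of "{s..1}" g g'] g(1) by (auto elim: continuous_on_subset)
    have gv: "calibration (g r) \<ge> v" if "r \<in> {s..t}" for r
      using g(5)[OF that] r0(2)[OF that] by (simp add: v_def)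
    have gX: "continuous_on {s..t} (\<lambda>r. calib_field (g r))"
      using gc by (rule continuous_on_calib_field) (use gv v in force)
    have g'c: "continuous_on {s..t} g'" using s by (intro continuous_on_subset[OF g(4)]) auto
    define h where "h r = g' r + calib_field (g r) /\<^sub>R r" for r
    have r0': "r \<noteq> 0" if "r \<in> {s..t}" for r using that s by auto
    have hc: "continuous_on {s..t} h" unfolding h_def using r0' by (intro continuous_intros g'c gX) auto
    have hn: "norm (integral {s..t} h) \<le> k + k"
    proof -
      have "norm (integral {s..t} h) \<le> integral {s..t} (\<lambda>r. norm (h r))"
        using hc by (rule continuous_on_imp_absolutely_integrable_on)
      also have "\<dots> \<le> integral {s..t} (\<lambda>r. k + (1 / (s * k)) * defect g g' r)"
      proof (rule integral_le)
        show "(\<lambda>r. norm (h r)) integrable_on {s..t}" by (intro integrable_continuous_real continuous_intros hc)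
        show "(\<lambda>r. k + 1 / (s * k) * defect g g' r) integrable_on {s..t}"
          using r0' by (intro integrable_continuous_real continuous_intros g'c gX) auto
        fix r assume r: "r \<in> {s..t}"
        \<comment> \<open>Young's inequality bounds \<open>norm (h r)\<close> by \<open>k\<close>
          plus its square over \<open>k\<close>; then \<open>s \<le> r\<close> turns the square into
          the defect.\<close>
        have "0 \<le> (norm (h r) - k)\<^sup>2" by simp
        then have "2 * (norm (h r) * k) \<le> k\<^sup>2 + (norm (h r))\<^sup>2" by (simp add: power2_eq_square algebra_simps)
        moreover have "0 \<le> norm (h r) * k" using k by simp
        ultimately have "norm (h r) * k \<le> k\<^sup>2 + (norm (h r))\<^sup>2" by linarith
        then have "norm (h r) \<le> k + (norm (h r))\<^sup>2 / k" using k by (simp add: field_simps power2_eq_square)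
        also have "(norm (h r))\<^sup>2 / k = s * (norm (h r))\<^sup>2 / (s * k)" using s by simp
        also have "\<dots> \<le> r * (norm (h r))\<^sup>2 / (s * k)"
          using r s k by (intro divide_right_mono mult_right_mono) auto
        finally show "norm (h r) \<le> k + 1 / (s * k) * defect g g' r" by (simp add: h_def)
      qed
      also have "\<dots> = k * (t - s) + (1 / (s * k)) * integral {s..t} (defect g g')"
      proof -
        have "defect g g' integrable_on {s..t}"
          using r0' by (intro integrable_continuous_real continuous_intros g'c gX) auto
        then show ?thesis using s
          by (subst Henstock_Kurzweil_Integration.integral_add) (auto intro!: integrable_on_mult_right simp del: times_divide_eq_left)
      qed
      also have "\<dots> \<le> k * 1 + (1 / (s * k)) * (s * k\<^sup>2)"
        using s k g(6) e(4) by (intro add_mono mult_left_mono) auto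
      also have "\<dots> = k + k" using s k by (simp add: power2_eq_square)
      finally show ?thesis .
    qed
    have ftc: "(g' has_integral (g t - g s)) {s..t}"
    proof (rule fundamental_theorem_of_calculus)
      show "(g has_vector_derivative g' r) (at r within {s..t})" if "r \<in> {s..t}" for r
        using g(1)[of r] that s by (auto intro: has_vector_derivative_within_subset)
    qed (use s in simp)
    have gi: "(\<lambda>r. calib_field (g r) /\<^sub>R r) integrable_on {s..t}" "(\<lambda>r. calib_field (f r) /\<^sub>R r) integrable_on {s..t}"
      using s by (auto intro!: integrable_continuous_real continuous_intros gX fX)
    have "integral {s..t} h = (g t - g s) + integral {s..t} (\<lambda>r. calib_field (g r) /\<^sub>R r)"
      unfolding h_def using ftc gi by (subst Henstock_Kurzweil_Integration.integral_add) (auto simp: integral_unique)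
    then have "?D = integral {s..t} h + (f t - g t) - (f s - g s)
        + (integral {s..t} (\<lambda>r. calib_field (f r) /\<^sub>R r) - integral {s..t} (\<lambda>r. calib_field (g r) /\<^sub>R r))"
      by simp
    also have "integral {s..t} (\<lambda>r. calib_field (f r) /\<^sub>R r) - integral {s..t} (\<lambda>r. calib_field (g r) /\<^sub>R r)
        = integral {s..t} (\<lambda>r. (calib_field (f r) - calib_field (g r)) /\<^sub>R r)"
      using gi by (subst Henstock_Kurzweil_Integration.integral_diff[symmetric]) (auto simp: scaleR_diff_right)
    finally have D: "?D = integral {s..t} h + (f t - g t) - (f s - g s)
        + integral {s..t} (\<lambda>r. (calib_field (f r) - calib_field (g r)) /\<^sub>R r)" .
    have "norm (integral {s..t} (\<lambda>r. (calib_field (f r) - calib_field (g r)) /\<^sub>R r)) \<le> k * (t - s)"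
    proof (rule integral_bound)
      show "continuous_on {s..t} (\<lambda>r. (calib_field (f r) - calib_field (g r)) /\<^sub>R r)"
        using r0' by (intro continuous_intros fX gX) auto
      fix r assume r: "r \<in> {s..t}"
      have "v \<le> calibration (f r)" using r0(2)[OF r] calibration_nonneg[of "f r0"] by (simp add: v_def)
      then have "norm (calib_field (f r) - calib_field (g r)) < k * s"
        using r s g(2)[of r] g(3)[of r] norm1[of r] gv[OF r] e(2)
        by (intro \<eta>(2)) (auto simp: C_def norm_minus_commute)
      also have "\<dots> \<le> k * r" using r k by simp
      finally show "norm ((calib_field (f r) - calib_field (g r)) /\<^sub>R r) \<le> k"
        using r s by (simp add: divide_inverse_commute[symmetric] pos_divide_le_eq)
    qed (use s in simp)
    also have "\<dots> \<le> k * 1" using s k by (intro mult_left_mono) auto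
    finally have X: "norm (integral {s..t} (\<lambda>r. (calib_field (f r) - calib_field (g r)) /\<^sub>R r)) \<le> k" by simp
    have "norm (f t - g t) \<le> k" "norm (f s - g s) \<le> k"
      using g(3)[of t] g(3)[of s] s e(3) by (auto simp: norm_minus_commute)
    with hn X show ?thesis unfolding D
      by (smt (verit) norm_triangle_ineq norm_triangle_ineq4)
  qed
  have "norm ?D \<le> 0"
  proof (rule field_le_epsilon)
    fix e :: real assume "e > 0"
    then show "norm ?D \<le> 0 + e" using small[of "e / 5"] by simp
  qed
  then show ?thesis by simp
qed

text \<open>Regularity comes for free: \<open>f\<close> equals a constant minus the integral of a
  continuous function, so the fundamental theorem makes it differentiable.\<close>

lemma gradient_flow:
  assumes r: "0 < r" "r < 1"
  shows "(f has_vector_derivative - (calib_field (f r) /\<^sub>R r)) (at r)"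
proof -
  define s t where "s = r / 2" and "t = (1 + r) / 2"
  have st: "0 < s" "s < r" "r < t" "t < 1" using r by (auto simp: s_def t_def)
  have "continuous_on {s..t} f" using st by (intro continuous_on_subset[OF cont]) auto
  then have "continuous_on {s..t} (\<lambda>r. calib_field (f r))"
    by (rule continuous_on_calib_field) (use st no_early_zero in auto)
  then have c: "continuous_on {s..t} (\<lambda>r. calib_field (f r) /\<^sub>R r)"
    using st by (intro continuous_intros) auto
  have "((\<lambda>u. integral {s..u} (\<lambda>r. calib_field (f r) /\<^sub>R r)) has_vector_derivative calib_field (f r) /\<^sub>R r) (at r within {s..t})"
    using c st by (intro integral_has_vector_derivative) auto
  then have "((\<lambda>u. integral {s..u} (\<lambda>r. calib_field (f r) /\<^sub>R r)) has_vector_derivative calib_field (f r) /\<^sub>R r) (at r)"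
    using st by (simp add: at_within_Icc_at)
  then have "((\<lambda>u. f s - integral {s..u} (\<lambda>r. calib_field (f r) /\<^sub>R r)) has_vector_derivative 0 - calib_field (f r) /\<^sub>R r) (at r)"
    by (intro has_vector_derivative_diff has_vector_derivative_const)
  then have "(f has_vector_derivative 0 - calib_field (f r) /\<^sub>R r) (at r)"
  proof (rule has_vector_derivative_transform_within_open[where S="{s<..<t}"])
    fix u assume "u \<in> {s<..<t}"
    then show "f s - integral {s..u} (\<lambda>r. calib_field (f r) /\<^sub>R r) = f u"
      using gradient_flow_integral[of s u] st by (simp add: algebra_simps)
  qed (use st in auto)
  then show ?thesis by simp
qed

end

end

section \<open>Integration of the gradient flow\<close>

text \<open>The second form reaches \<open>r = 1\<close>, where the flow has stopped, and so
  evaluates a first integral on the boundary datum. The first form is for quantities that divide by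
  \<open>V\<close> and are compared at interior points.\<close>

lemma has_vector_derivative_0_imp_eq:
  fixes Z :: "real \<Rightarrow> 'a::banach"
  assumes "\<And>r. 0 < r \<Longrightarrow> r < 1 \<Longrightarrow> (Z has_vector_derivative 0) (at r)"
  shows "0 < r \<Longrightarrow> r < 1 \<Longrightarrow> 0 < s \<Longrightarrow> s < 1 \<Longrightarrow> Z r = Z s"
    and "continuous_on {0<..1} Z \<Longrightarrow> 0 < r \<Longrightarrow> r \<le> 1 \<Longrightarrow> Z r = Z 1"
proof -
  have d: "(Z has_derivative (\<lambda>h. 0)) (at r within S)" if "0 < r" "r < 1" for r S
    using assms[OF that] by (simp add: has_vector_derivative_def has_derivative_at_withinI)
  show "Z r = Z s" if "0 < r" "r < 1" "0 < s" "s < 1"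
    by (rule has_derivative_zero_unique_strong_convex[of "{0<..<1::real}" "{}"])
      (use that d in \<open>auto intro!: has_derivative_continuous_on\<close>)
  show "Z r = Z 1" if "continuous_on {0<..1} Z" "0 < r" "r \<le> 1"
    by (rule has_derivative_zero_unique_strong_convex[of "{0<..1::real}" "{1}"]) (use that d in auto)
qed

lemma has_vector_derivative_scaled_0:
  fixes w :: "real \<Rightarrow> 'a::real_normed_vector"
  assumes "(w has_vector_derivative a *\<^sub>R w r) (at r)" "(\<phi> has_real_derivative - a * \<phi> r) (at r)"
  shows "((\<lambda>r. \<phi> r *\<^sub>R w r) has_vector_derivative 0) (at r)"
  using has_vector_derivative_scaleR[OF assms(2,1)] by (simp add: mult.commute)

text \<open>The flow equation stops short of \<open>r = 1\<close>, where the calibration vanishes;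
  the terminal value \<open>end1\<close> takes its place.\<close>

locale flow_profile =
  fixes f :: "real \<Rightarrow> R5"
  assumes cont: "continuous_on {0..1} f"
    and norm1: "\<And>r. r \<in> {0..1} \<Longrightarrow> norm (f r) = 1"
    and end1: "f 1 = (- 1 / 2, 0, of_real (sqrt 3 / 2))"
    and pos: "\<And>r. 0 \<le> r \<Longrightarrow> r < 1 \<Longrightarrow> calibration (f r) > 0"
    and flow: "\<And>r. 0 < r \<Longrightarrow> r < 1 \<Longrightarrow> (f has_vector_derivative - (calib_field (f r) /\<^sub>R r)) (at r)"
begin

definition x where "x r = fst (f r)"
definition c1 where "c1 r = fst (snd (f r))"
definition c2 where "c2 r = snd (snd (f r))"
definition V where "V r = calibration (f r)"
text \<open>\<open>\<alpha>\<close> and \<open>\<beta>\<close> are the derivatives of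
  \<open>x\<close> and \<open>V\<close> with respect to \<open>ln r\<close> along the flow. On the
  sphere \<open>\<beta>\<close> is minus the angular energy.\<close>

definition \<alpha> where "\<alpha> r = x r * V r - (2 * x r + 1) * (x r + 2) / V r"
definition \<beta> where "\<beta> r = (V r)\<^sup>2 - 4 * x r - 5"
text \<open>In polar form, \<open>(2 x + 1, sqrt 3 \<bar>c1\<bar>) = V (cos \<theta>, sin \<theta>)\<close> and \<open>\<kappa> = sin\<^sup>2 (\<theta> / 2)\<close>. Along the flow
  \<open>\<kappa>\<close> solves a logistic equation in the variable \<open>ln r\<close>.\<close>

definition \<kappa> where "\<kappa> r = (1 - (1 + 2 * x r) / V r) / 2"

lemma V_pos: "0 \<le> r \<Longrightarrow> r < 1 \<Longrightarrow> V r > 0"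
  using pos by (simp add: V_def)

lemma V_sq: "(V r)\<^sup>2 = (2 * x r + 1)\<^sup>2 + 3 * (cmod (c1 r))\<^sup>2"
  by (simp add: V_def x_def c1_def calibration_sq)

lemma x_ge: "r \<in> {0..1} \<Longrightarrow> x r + 2 > 0"
  using norm1[of r] norm_fst_le[of "fst (f r)" "snd (f r)"] by (auto simp: x_def)

lemma at_1: "x 1 = - 1 / 2" "c1 1 = 0" "c2 1 = of_real (sqrt 3 / 2)" "V 1 = 0"
  by (auto simp: x_def c1_def c2_def V_def end1 calibration_def)

lemma conts: "continuous_on {0..1} x" "continuous_on {0..1} c1" "continuous_on {0..1} c2" "continuous_on {0..1} V"
  unfolding x_def c1_def c2_def V_def by (intro continuous_intros cont)+

lemma \<alpha>_V: "0 \<le> r \<Longrightarrow> r < 1 \<Longrightarrow> \<alpha> r * V r = x r * (V r)\<^sup>2 - (2 * x r + 1) * (x r + 2)"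
  using V_pos[of r] by (simp add: \<alpha>_def field_simps power2_eq_square)

text \<open>The components \<open>c1\<close> and \<open>c2\<close> only get multiplied by real
  factors, so their phases are constant. \<open>V\<close> falls along its own gradient flow at the
  rate of the squared gradient, which is the angular energy.\<close>

lemma derivs:
  assumes r: "0 < r" "r < 1"
  shows "(x has_real_derivative \<alpha> r / r) (at r)"
    "(c1 has_vector_derivative ((V r - 2 * (x r + 2) / V r) / r) *\<^sub>R c1 r) (at r)"
    "(c2 has_vector_derivative ((V r - (2 * x r + 1) / V r) / r) *\<^sub>R c2 r) (at r)"
    "(V has_real_derivative \<beta> r / r) (at r)"
proof -
  note comps = has_vector_derivative_components[OF flow[OF r]]
  note comps2 = has_vector_derivative_components[OF comps(2)]
  have X: "fst (calib_field (f r)) = - \<alpha> r"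
    "fst (snd (calib_field (f r))) = - ((V r - 2 * (x r + 2) / V r) *\<^sub>R c1 r)"
    "snd (snd (calib_field (f r))) = - ((V r - (2 * x r + 1) / V r) *\<^sub>R c2 r)"
    by (simp_all add: calib_field_def \<alpha>_def x_def V_def c1_def c2_def scaleR_diff_left)
  show "(x has_real_derivative \<alpha> r / r) (at r)"
    using comps(1) unfolding has_real_derivative_iff_has_vector_derivative
    by (simp add: x_def[abs_def] X divide_inverse_commute)
  show "(c1 has_vector_derivative ((V r - 2 * (x r + 2) / V r) / r) *\<^sub>R c1 r) (at r)"
    using comps2(1) by (simp add: X c1_def[abs_def] divide_inverse_commute[of _ r])
  show "(c2 has_vector_derivative ((V r - (2 * x r + 1) / V r) / r) *\<^sub>R c2 r) (at r)"
    using comps2(2) by (simp add: X c2_def[abs_def] divide_inverse_commute[of _ r])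
  have n: "norm (f r) = 1" and p: "calibration (f r) > 0" using norm1 pos r by auto
  have "f r \<bullet> (- (calib_field (f r) /\<^sub>R r)) = 0"
    by (rule sphere_curve_orthogonal[of "r / 2" "(1 + r) / 2" f])
      (use r norm1 flow[OF r] in \<open>auto intro: has_vector_derivative_at_within\<close>)
  from calibration_has_derivative[OF n p this flow[OF r]]
  have "(V has_real_derivative - ((norm (calib_field (f r)))\<^sup>2 / r)) (at r)"
    by (simp add: V_def[abs_def] power2_norm_eq_inner divide_inverse_commute)
  then show "(V has_real_derivative \<beta> r / r) (at r)"
    unfolding norm_calib_field[OF n p] angular_energy_sphere[OF n]
    by (rule DERIV_cong) (use r in \<open>simp add: \<beta>_def V_def x_def field_simps\<close>)
qed

text \<open>The quotient \<open>(x + 2 - V) / ((x + 2 + V) r\<^sup>4)\<close> is a first integral of the flow.\<close>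

lemma V_x_relation:
  assumes r: "0 < r" "r \<le> 1"
  shows "V r * (1 + r ^ 4) = (x r + 2) * (1 - r ^ 4)"
proof -
  define Z where "Z r = (x r + 2 - V r) / ((x r + 2 + V r) * r ^ 4)" for r
  have M: "x r + 2 + V r > 0" if "r \<in> {0..1}" for r
    using x_ge[OF that] calibration_nonneg[of "f r"] by (simp add: V_def)
  have M': "(x r + 2 + V r) * r ^ 4 \<noteq> 0" if "r \<in> {0<..1}" for r
    using M[of r] that by auto
  have "Z r = Z 1"
  proof (rule has_vector_derivative_0_imp_eq(2)[OF _ _ r])
    show "continuous_on {0<..1} Z"
      unfolding Z_def by (intro continuous_intros continuous_on_subset[OF conts(1)] continuous_on_subset[OF conts(4)])
        (use M' in auto)
    fix r :: real assume r: "0 < r" "r < 1"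
    have M0: "x r + 2 + V r \<noteq> 0" using M[of r] r by auto
    have key: "(\<alpha> r - \<beta> r) * (x r + 2 + V r) - (x r + 2 - V r) * (\<alpha> r + \<beta> r) - 4 * (x r + 2 - V r) * (x r + 2 + V r) = 0"
    proof -
      have "(\<alpha> r - \<beta> r) * (x r + 2 + V r) - (x r + 2 - V r) * (\<alpha> r + \<beta> r) - 4 * (x r + 2 - V r) * (x r + 2 + V r)
        = 2 * (\<alpha> r * V r) - 2 * \<beta> r * (x r + 2) - 4 * (x r + 2 - V r) * (x r + 2 + V r)" by algebra
      also have "\<dots> = 0" unfolding \<alpha>_V[OF less_imp_le[OF r(1)] r(2)] \<beta>_def by algebra
      finally show ?thesis .
    qed
    have "(Z has_real_derivative
        ((\<alpha> r / r - \<beta> r / r) * ((x r + 2 + V r) * r ^ 4) - (x r + 2 - V r) * ((\<alpha> r / r + \<beta> r / r) * r ^ 4 + (x r + 2 + V r) * (4 * r ^ 3)))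
        / (((x r + 2 + V r) * r ^ 4) * ((x r + 2 + V r) * r ^ 4))) (at r)"
      unfolding Z_def
      by (rule derivative_eq_intros derivs(1,4)[OF r] refl | use M0 r in simp)+
    also have "(\<alpha> r / r - \<beta> r / r) * ((x r + 2 + V r) * r ^ 4) - (x r + 2 - V r) * ((\<alpha> r / r + \<beta> r / r) * r ^ 4 + (x r + 2 + V r) * (4 * r ^ 3))
      = r ^ 3 * ((\<alpha> r - \<beta> r) * (x r + 2 + V r) - (x r + 2 - V r) * (\<alpha> r + \<beta> r) - 4 * (x r + 2 - V r) * (x r + 2 + V r))"
      using r by (simp add: field_simps power_numeral_reduce)
    finally show "(Z has_vector_derivative 0) (at r)"
      by (simp only: key mult_zero_right div_0 has_real_derivative_iff_has_vector_derivative)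
  qed
  moreover have "Z 1 = 1" by (simp add: Z_def at_1)
  ultimately have "Z r = 1" by simp
  then have "x r + 2 - V r = (x r + 2 + V r) * r ^ 4" using M'[of r] r by (simp add: Z_def)
  then show ?thesis by algebra
qed

text \<open>\<open>c2\<close> solves a scalar linear equation, and by \<open>V_x_relation\<close> so
  does \<open>r\<^sup>2 * (x r + 2) / (1 + r ^ 4)\<close>. Their quotient is constant, and its value
  at \<open>r = 1\<close> is read off the boundary datum.\<close>

lemma c2_formula:
  assumes r: "0 < r" "r \<le> 1"
  shows "c2 r = of_real (2 * sqrt 3 / 3 * r\<^sup>2 * (x r + 2) / (1 + r ^ 4))"
proof -
  define \<phi> where "\<phi> r = (1 + r ^ 4) / (r\<^sup>2 * (x r + 2))" for r
  have x0: "x r + 2 \<noteq> 0" if "r \<in> {0..1}" for r using x_ge[OF that] by simp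
  have "\<phi> r *\<^sub>R c2 r = \<phi> 1 *\<^sub>R c2 1"
  proof (rule has_vector_derivative_0_imp_eq(2)[OF _ _ r])
    show "continuous_on {0<..1} (\<lambda>r. \<phi> r *\<^sub>R c2 r)"
      unfolding \<phi>_def
      by (intro continuous_intros continuous_on_subset[OF conts(1)] continuous_on_subset[OF conts(3)]) (use x0 in force)+
    fix r :: real assume r: "0 < r" "r < 1"
    have x0r: "x r + 2 \<noteq> 0" and V0: "V r \<noteq> 0" using x0[of r] V_pos[of r] r by auto
    have "(\<phi> has_real_derivative (4 * r ^ 3 * (r\<^sup>2 * (x r + 2)) - (1 + r ^ 4) * (2 * r * (x r + 2) + r\<^sup>2 * (\<alpha> r / r)))
        / ((r\<^sup>2 * (x r + 2)) * (r\<^sup>2 * (x r + 2)))) (at r)"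
      unfolding \<phi>_def
      by (rule derivative_eq_intros derivs(1)[OF r] refl | use x0r r in simp)+
    also have "4 * r ^ 3 * (r\<^sup>2 * (x r + 2)) - (1 + r ^ 4) * (2 * r * (x r + 2) + r\<^sup>2 * (\<alpha> r / r))
      = - (r * (1 + r ^ 4) * (x r + 2) * (V r - (2 * x r + 1) / V r))"
    proof -
      have "4 * r ^ 3 * (r\<^sup>2 * (x r + 2)) - (1 + r ^ 4) * (2 * r * (x r + 2) + r\<^sup>2 * (\<alpha> r / r))
          + r * (1 + r ^ 4) * (x r + 2) * (V r - (2 * x r + 1) / V r)
        = 2 * r * (V r * (1 + r ^ 4) - (x r + 2) * (1 - r ^ 4))"
        using r V0 by (simp add: \<alpha>_def field_simps power2_eq_square power_numeral_reduce)
      then show ?thesis using V_x_relation[of r] r by simp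
    qed
    also have "- (r * (1 + r ^ 4) * (x r + 2) * (V r - (2 * x r + 1) / V r)) / ((r\<^sup>2 * (x r + 2)) * (r\<^sup>2 * (x r + 2)))
      = - ((V r - (2 * x r + 1) / V r) / r) * \<phi> r"
    proof -
      have "- (r * a * p * k) / ((r\<^sup>2 * p) * (r\<^sup>2 * p)) = - (k / r) * (a / (r\<^sup>2 * p))" if "p \<noteq> 0" for a p k
        using r that by (simp add: divide_simps power2_eq_square)
      from this[OF x0r] show ?thesis unfolding \<phi>_def .
    qed
    finally show "((\<lambda>r. \<phi> r *\<^sub>R c2 r) has_vector_derivative 0) (at r)"
      by (rule has_vector_derivative_scaled_0[OF derivs(3)[OF r]])
  qed
  also have "\<phi> 1 *\<^sub>R c2 1 = of_real (2 * sqrt 3 / 3)" by (simp add: \<phi>_def at_1 scaleR_conv_of_real)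
  finally have e: "\<phi> r *\<^sub>R c2 r = of_real (2 * sqrt 3 / 3)" .
  have "\<phi> r \<noteq> 0" using x0[of r] r by (auto simp: \<phi>_def add_nonneg_eq_0_iff)
  then have "c2 r = (1 / \<phi> r) *\<^sub>R (\<phi> r *\<^sub>R c2 r)" by simp
  also have "\<dots> = of_real (1 / \<phi> r * (2 * sqrt 3 / 3))" unfolding e by (simp only: scaleR_conv_of_real of_real_mult)
  also have "1 / \<phi> r * (2 * sqrt 3 / 3) = 2 * sqrt 3 / 3 * r\<^sup>2 * (x r + 2) / (1 + r ^ 4)"
    by (simp add: \<phi>_def mult.commute mult.left_commute)
  finally show ?thesis .
qed

lemma \<kappa>_derivative:
  assumes r: "0 < r" "r < 1"
  shows "(\<kappa> has_real_derivative 2 * \<kappa> r * (1 - \<kappa> r) / r) (at r)"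
proof -
  have V0: "V r \<noteq> 0" using V_pos[of r] r by auto
  have "((\<lambda>r. 1 + 2 * x r) has_real_derivative 0 + 2 * (\<alpha> r / r)) (at r)"
    by (intro DERIV_add DERIV_const DERIV_cmult derivs(1)[OF r])
  from DERIV_divide[OF this derivs(4)[OF r] V0]
  have d: "((\<lambda>r. (1 + 2 * x r) / V r) has_real_derivative
      (2 * (\<alpha> r / r) * V r - (1 + 2 * x r) * (\<beta> r / r)) / (V r * V r)) (at r)" by (simp only: add_0)
  have "(\<kappa> has_real_derivative (0 - (2 * (\<alpha> r / r) * V r - (1 + 2 * x r) * (\<beta> r / r)) / (V r * V r)) / 2) (at r)"
    unfolding \<kappa>_def[abs_def] by (intro DERIV_cdivide DERIV_diff DERIV_const d)
  moreover have "(0 - (2 * (\<alpha> r / r) * V r - (1 + 2 * x r) * (\<beta> r / r)) / (V r * V r)) / 2 = 2 * \<kappa> r * (1 - \<kappa> r) / r"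
  proof -
    have "2 * (\<alpha> r / r) * V r - (1 + 2 * x r) * (\<beta> r / r) = (2 * (\<alpha> r * V r) - (1 + 2 * x r) * \<beta> r) / r"
      by (simp add: diff_divide_distrib)
    also have "2 * (\<alpha> r * V r) - (1 + 2 * x r) * \<beta> r = (1 + 2 * x r)\<^sup>2 - (V r)\<^sup>2"
      unfolding \<alpha>_V[OF less_imp_le[OF r(1)] r(2)] \<beta>_def by algebra
    finally have e: "2 * (\<alpha> r / r) * V r - (1 + 2 * x r) * (\<beta> r / r) = ((1 + 2 * x r)\<^sup>2 - (V r)\<^sup>2) / r" .
    have "(0 - ((y\<^sup>2 - v\<^sup>2) / r) / (v * v)) / 2 = 2 * ((1 - y / v) / 2) * (1 - (1 - y / v) / 2) / r" if "v \<noteq> 0" for y v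
      using that r by (simp add: field_simps power2_eq_square)
    from this[OF V0] show ?thesis unfolding e \<kappa>_def .
  qed
  ultimately show ?thesis by simp
qed

text \<open>In terms of the angle this is
  \<open>sin\<^sup>2 \<theta> = 4 * \<kappa> * (1 - \<kappa>)\<close>.\<close>

lemma \<kappa>_product: "0 \<le> r \<Longrightarrow> r < 1 \<Longrightarrow> 4 * \<kappa> r * (1 - \<kappa> r) * (V r)\<^sup>2 = 3 * (cmod (c1 r))\<^sup>2"
proof -
  assume r: "0 \<le> r" "r < 1"
  then have V0: "V r \<noteq> 0" using V_pos[of r] by auto
  have "4 * \<kappa> r * (1 - \<kappa> r) * (V r)\<^sup>2 = (V r)\<^sup>2 - (1 + 2 * x r)\<^sup>2"
    using V0 by (simp add: \<kappa>_def field_simps power2_eq_square)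
  then show ?thesis by (simp add: V_sq add.commute)
qed

lemma \<kappa>_bounds:
  assumes "0 \<le> r" "r < 1"
  shows "0 \<le> \<kappa> r" "\<kappa> r \<le> 1"
proof -
  have V: "V r > 0" using V_pos assms by auto
  have "\<bar>1 + 2 * x r\<bar> \<le> V r"
    using V by (intro abs_le_square_iff[THEN iffD2, of _ "V r", simplified abs_of_pos[OF V]]) (simp add: V_sq add.commute)
  then show "0 \<le> \<kappa> r" "\<kappa> r \<le> 1" using V by (auto simp: \<kappa>_def field_simps abs_le_iff)
qed

lemma \<kappa>_eq: "0 \<le> r \<Longrightarrow> r < 1 \<Longrightarrow> 1 + 2 * x r = V r * (1 - 2 * \<kappa> r)"
  using V_pos[of r] by (simp add: \<kappa>_def field_simps)

lemma \<kappa>_near_0: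
  assumes "e > 0"
  obtains d where "0 < d" "d < 1" "\<And>r. 0 < r \<Longrightarrow> r < d \<Longrightarrow> \<bar>\<kappa> r - \<kappa> 0\<bar> < e"
proof -
  have "continuous_on {0..1/2} \<kappa>"
    unfolding \<kappa>_def using V_pos
    by (intro continuous_intros continuous_on_subset[OF conts(1)] continuous_on_subset[OF conts(4)]) (auto simp: less_imp_neq[symmetric])
  then obtain d where "d > 0" "\<And>r. r \<in> {0..1/2} \<Longrightarrow> dist r 0 < d \<Longrightarrow> dist (\<kappa> r) (\<kappa> 0) < e"
    unfolding continuous_on_iff using assms by (metis atLeastAtMost_iff divide_nonneg_nonneg order_refl zero_le_numeral zero_le_one)
  then show thesis using that[of "min d (1 / 2)"] by (auto simp: dist_real_def)
qed

text \<open>At the south pole \<open>\<kappa> = 1\<close>. Since \<open>\<kappa>\<close> is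
  nondecreasing, a value below 1 at \<open>r\<close> would keep it below that value near 0, against
  continuity. So \<open>\<kappa>\<close> is constantly 1, which gives \<open>c1 = 0\<close> and
  \<open>V = - (1 + 2 * x)\<close>, and \<open>V_x_relation\<close> becomes a linear equation for
  \<open>x\<close>.\<close>

lemma south_solution:
  assumes 0: "f 0 = (- 1, 0, 0)" and r: "0 < r" "r < 1"
  shows "f r = u_S (of_real r)"
proof -
  have k0: "\<kappa> 0 = 1" by (simp add: \<kappa>_def V_def x_def 0 calibration_def)
  have k1: "\<kappa> r = 1"
  proof (rule ccontr)
    assume "\<kappa> r \<noteq> 1"
    then have lt: "1 - \<kappa> r > 0" using \<kappa>_bounds[of r] r by auto
    obtain d where d: "0 < d" "d < 1" "\<And>s. 0 < s \<Longrightarrow> s < d \<Longrightarrow> \<bar>\<kappa> s - \<kappa> 0\<bar> < 1 - \<kappa> r"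
      using \<kappa>_near_0[OF lt] by blast
    define s where "s = min (d / 2) (r / 2)"
    have s: "0 < s" "s < d" "s \<le> r" using d(1) r by (auto simp: s_def)
    have "\<kappa> s \<le> \<kappa> r"
    proof (rule DERIV_nonneg_imp_nondecreasing[OF s(3)])
      fix t assume "s \<le> t" "t \<le> r"
      then have t: "0 < t" "t < 1" using s r by auto
      have "0 \<le> 2 * \<kappa> t * (1 - \<kappa> t) / t" using \<kappa>_bounds[of t] t by auto
      with \<kappa>_derivative[OF t] show "\<exists>y. (\<kappa> has_real_derivative y) (at t) \<and> 0 \<le> y" by blast
    qed
    with d(3)[OF s(1,2)] k0 show False by simp
  qed
  have V: "V r = - (1 + 2 * x r)" using \<kappa>_eq[of r] r k1 by simp
  have c1: "c1 r = 0" using \<kappa>_product[of r] r k1 by simp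
  have "- (1 + 2 * x r) * (1 + r ^ 4) = (x r + 2) * (1 - r ^ 4)" using V_x_relation[of r] r V by simp
  then have x: "x r * (r ^ 4 + 3) = r ^ 4 - 3" by (simp add: algebra_simps)
  have p: "r ^ 4 + 3 \<noteq> 0" "1 + r ^ 4 \<noteq> 0" using r by (auto simp: add_nonneg_eq_0_iff)
  have x': "x r = (r ^ 4 - 3) / (r ^ 4 + 3)" using x p by (simp add: field_simps)
  have xx: "x r + 2 = 3 * (1 + r ^ 4) / (r ^ 4 + 3)" unfolding x' using p by (simp add: field_simps)
  have "2 * sqrt 3 / 3 * r\<^sup>2 * (x r + 2) / (1 + r ^ 4) = 2 * sqrt 3 * r\<^sup>2 / (r ^ 4 + 3)"
  proof -
    have "2 * sqrt 3 / 3 * a * (3 * q / d) / q = 2 * sqrt 3 * a / d" if "q \<noteq> 0" for a d q :: real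
      using that by simp
    then show ?thesis unfolding xx using p(2) .
  qed
  then have "c2 r = of_real (2 * sqrt 3 * r\<^sup>2 / (r ^ 4 + 3))" using c2_formula[of r] r by simp
  moreover have "f r = (x r, c1 r, c2 r)" by (simp add: x_def c1_def c2_def)
  ultimately show ?thesis using x' c1 r by (simp add: u_S_def)
qed

text \<open>Here \<open>\<kappa>\<close> starts at the repelling rest point 0 of the logistic
  equation, so the initial value leaves one real constant free; the constant direction of
  \<open>c1\<close> adds the phase.\<close>

lemma north_solution:
  assumes 0: "f 0 = (1, 0, 0)"
  obtains \<mu> where "\<And>r. 0 < r \<Longrightarrow> r < 1 \<Longrightarrow> f r = u_N \<mu> (of_real r)"
proof -
  have k0: "\<kappa> 0 = 0" by (simp add: \<kappa>_def V_def x_def 0 calibration_def)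
  \<comment> \<open>\<open>r\<^sup>2 * (1 - \<kappa> r)\<close> has the derivative
    \<open>2 * r * (1 - \<kappa> r)\<^sup>2\<close>, so it does not decrease. It is positive near 0
    and therefore can never reach 0.\<close>
  have lt: "\<kappa> r < 1" if r: "0 < r" "r < 1" for r
  proof (rule ccontr)
    assume "\<not> \<kappa> r < 1"
    then have k1: "\<kappa> r = 1" using \<kappa>_bounds[of r] r by auto
    obtain d where d: "0 < d" "d < 1" "\<And>r. 0 < r \<Longrightarrow> r < d \<Longrightarrow> \<bar>\<kappa> r - \<kappa> 0\<bar> < 1"
      using \<kappa>_near_0[of 1] by auto
    define s where "s = min (d / 2) (r / 2)"
    have s: "0 < s" "s < d" "s \<le> r" using d(1) r by (auto simp: s_def)
    have "s\<^sup>2 * (1 - \<kappa> s) \<le> r\<^sup>2 * (1 - \<kappa> r)"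
    proof (rule DERIV_nonneg_imp_nondecreasing[OF s(3), where f="\<lambda>r. r\<^sup>2 * (1 - \<kappa> r)"])
      fix t assume "s \<le> t" "t \<le> r"
      then have t: "0 < t" "t < 1" using s r by auto
      have "((\<lambda>r. r\<^sup>2 * (1 - \<kappa> r)) has_real_derivative 2 * t * (1 - \<kappa> t) - t\<^sup>2 * (2 * \<kappa> t * (1 - \<kappa> t) / t)) (at t)"
        by (rule derivative_eq_intros \<kappa>_derivative[OF t] refl | simp)+
      moreover have "2 * t * (1 - \<kappa> t) - t\<^sup>2 * (2 * \<kappa> t * (1 - \<kappa> t) / t) = 2 * t * (1 - \<kappa> t)\<^sup>2"
        using t by (simp add: field_simps power2_eq_square)
      ultimately show "\<exists>y. ((\<lambda>r. r\<^sup>2 * (1 - \<kappa> r)) has_real_derivative y) (at t) \<and> 0 \<le> y"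
        using t by (metis less_imp_le mult_nonneg_nonneg zero_le_numeral zero_le_power2)
    qed
    then have "s\<^sup>2 * (1 - \<kappa> s) \<le> 0" using k1 by simp
    moreover have "s\<^sup>2 * (1 - \<kappa> s) > 0" using d(3)[OF s(1,2)] k0 s(1) by (intro mult_pos_pos) auto
    ultimately show False by simp
  qed
  \<comment> \<open>the first integral that becomes \<open>\<bar>\<mu>\<bar>\<^sup>2\<close>\<close>
  define M where "M r = 3 * \<kappa> r / ((1 - \<kappa> r) * r\<^sup>2)" for r
  define m where "m = M (1 / 2)"
  have M: "M r = m" if r: "0 < r" "r < 1" for r
    unfolding m_def
  proof (rule has_vector_derivative_0_imp_eq(1)[OF _ r])
    fix r :: real assume r: "0 < r" "r < 1"
    have k: "1 - \<kappa> r \<noteq> 0" using lt[OF r] by simp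
    have "(M has_real_derivative (3 * (2 * \<kappa> r * (1 - \<kappa> r) / r) * ((1 - \<kappa> r) * r\<^sup>2)
        - 3 * \<kappa> r * (- (2 * \<kappa> r * (1 - \<kappa> r) / r) * r\<^sup>2 + (1 - \<kappa> r) * (2 * r))) / (((1 - \<kappa> r) * r\<^sup>2) * ((1 - \<kappa> r) * r\<^sup>2))) (at r)"
      unfolding M_def
      by (rule derivative_eq_intros \<kappa>_derivative[OF r] refl | use k r in simp)+
    also have "3 * (2 * \<kappa> r * (1 - \<kappa> r) / r) * ((1 - \<kappa> r) * r\<^sup>2)
        - 3 * \<kappa> r * (- (2 * \<kappa> r * (1 - \<kappa> r) / r) * r\<^sup>2 + (1 - \<kappa> r) * (2 * r)) = 0"
    proof -
      have "3 * (2 * k * (1 - k) / r) * ((1 - k) * r\<^sup>2) - 3 * k * (- (2 * k * (1 - k) / r) * r\<^sup>2 + (1 - k) * (2 * r)) = 0" for k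
        using r by (simp add: field_simps power2_eq_square)
      then show ?thesis .
    qed
    finally show "(M has_vector_derivative 0) (at r)" by (simp add: has_real_derivative_iff_has_vector_derivative)
  qed auto
  have m0: "m \<ge> 0" using \<kappa>_bounds[of "1/2"] by (auto simp: m_def M_def)
  have den: "3 + m * r\<^sup>2 > 0" for r using m0 by (simp add: add_pos_nonneg)
  have k: "\<kappa> r * (3 + m * r\<^sup>2) = m * r\<^sup>2" if r: "0 < r" "r < 1" for r
  proof -
    have "m * ((1 - \<kappa> r) * r\<^sup>2) = 3 * \<kappa> r"
      using M[OF r] lt[OF r] r by (simp add: M_def divide_eq_eq)
    then show ?thesis by algebra
  qed
  \<comment> \<open>The integrating factor of the linear equation for \<open>c1\<close>: its
    logarithmic derivative is the negative of the rate of \<open>c1\<close>, once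
    \<open>\<kappa>\<close> is expressed by \<open>m\<close>.\<close>
  define \<phi> where "\<phi> r = (3 + m * r\<^sup>2) / (r * V r)" for r
  define \<mu> where "\<mu> = (\<phi> (1 / 2) / 2) *\<^sub>R c1 (1 / 2)"
  have Q: "\<phi> r *\<^sub>R c1 r = 2 *\<^sub>R \<mu>" if r: "0 < r" "r < 1" for r
  proof -
    have "\<phi> r *\<^sub>R c1 r = \<phi> (1/2) *\<^sub>R c1 (1/2)"
    proof (rule has_vector_derivative_0_imp_eq(1)[OF _ r])
      fix r :: real assume r: "0 < r" "r < 1"
      have V0: "V r \<noteq> 0" using V_pos[of r] r by auto
      have "(\<phi> has_real_derivative ((m * (2 * r)) * (r * V r) - (3 + m * r\<^sup>2) * (V r + r * (\<beta> r / r))) / ((r * V r) * (r * V r))) (at r)"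
        unfolding \<phi>_def
        by (rule derivative_eq_intros derivs(4)[OF r] refl | use V0 r in simp)+
      also have "(m * (2 * r)) * (r * V r) - (3 + m * r\<^sup>2) * (V r + r * (\<beta> r / r))
          = - ((3 + m * r\<^sup>2) * (V r * (V r - 2 * (x r + 2) / V r)))"
      proof -
        have "(m * (2 * r)) * (r * V r) = 2 * (\<kappa> r * (3 + m * r\<^sup>2)) * V r" unfolding k[OF r] by (simp add: power2_eq_square)
        also have "\<dots> = (3 + m * r\<^sup>2) * (V r - V r * (1 - 2 * \<kappa> r))" by algebra
        also have "\<dots> = (3 + m * r\<^sup>2) * (V r - (1 + 2 * x r))" using \<kappa>_eq[of r] r by simp
        finally have e: "(m * (2 * r)) * (r * V r) = (3 + m * r\<^sup>2) * (V r - (1 + 2 * x r))" .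
        have e': "V r * (V r - 2 * (x r + 2) / V r) = (V r)\<^sup>2 - 2 * (x r + 2)"
          using V0 by (simp add: field_simps power2_eq_square)
        have e'': "r * (\<beta> r / r) = (V r)\<^sup>2 - 4 * x r - 5" using r by (simp add: \<beta>_def)
        show ?thesis unfolding e e' e'' by (simp add: algebra_simps)
      qed
      also have "- ((3 + m * r\<^sup>2) * (V r * (V r - 2 * (x r + 2) / V r))) / ((r * V r) * (r * V r))
          = - ((V r - 2 * (x r + 2) / V r) / r) * \<phi> r"
        using V0 r unfolding \<phi>_def by (simp add: divide_simps)
      finally show "((\<lambda>r. \<phi> r *\<^sub>R c1 r) has_vector_derivative 0) (at r)"
        by (rule has_vector_derivative_scaled_0[OF derivs(2)[OF r]])
    qed auto
    then show ?thesis by (simp add: \<mu>_def)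
  qed
  have c1: "c1 r = (2 * r * V r / (3 + m * r\<^sup>2)) *\<^sub>R \<mu>" if r: "0 < r" "r < 1" for r
  proof -
    have "\<phi> r \<noteq> 0" using V_pos[of r] r den[of r] by (simp add: \<phi>_def)
    then have "c1 r = (1 / \<phi> r) *\<^sub>R (\<phi> r *\<^sub>R c1 r)" by simp
    also have "\<dots> = (2 * r * V r / (3 + m * r\<^sup>2)) *\<^sub>R \<mu>"
      unfolding Q[OF r] by (simp add: \<phi>_def)
    finally show ?thesis .
  qed
  \<comment> \<open>Two expressions for the modulus of \<open>c1\<close> at one radius, from
    \<open>\<kappa>_product\<close> and from the formula \<open>c1\<close>, tie the real constant to
    \<open>\<mu>\<close>.\<close>
  have m: "m = (cmod \<mu>)\<^sup>2"
  proof -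
    define s v d where "s = (1 / 2 :: real)" and "v = V s" and "d = 3 + m * s\<^sup>2"
    have s: "0 < s" "s < 1" by (auto simp: s_def)
    have v: "v > 0" and d: "d > 0" using V_pos[of s] den[of s] s by (auto simp: v_def d_def)
    have kk: "\<kappa> s = m * s\<^sup>2 / d" using k[OF s] d by (simp add: eq_divide_eq d_def)
    have kk1: "1 - \<kappa> s = 3 / d" unfolding kk using d by (simp add: d_def field_simps)
    have "cmod (c1 s) = 2 * s * v / d * cmod \<mu>"
      using c1[OF s] v d s by (simp add: v_def[symmetric] d_def[symmetric] abs_mult)
    then have "4 * (m * s\<^sup>2 / d) * (3 / d) * v\<^sup>2 = 3 * (2 * s * v / d * cmod \<mu>)\<^sup>2"
      using \<kappa>_product[of s] kk kk1 s by (simp add: v_def)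
    moreover have "4 * (m * s\<^sup>2 / d) * (3 / d) * v\<^sup>2 = m * (12 * (s * v / d)\<^sup>2)"
      "3 * (2 * s * v / d * cmod \<mu>)\<^sup>2 = (cmod \<mu>)\<^sup>2 * (12 * (s * v / d)\<^sup>2)"
      by (simp_all add: power2_eq_square mult_ac)
    ultimately have "m * (12 * (s * v / d)\<^sup>2) = (cmod \<mu>)\<^sup>2 * (12 * (s * v / d)\<^sup>2)" by simp
    then show ?thesis using v d s by simp
  qed
  show thesis
  proof (rule that[of \<mu>])
    fix r :: real assume r: "0 < r" "r < 1"
    define D where "D = 1 + m * r\<^sup>2 + 3 * r ^ 4 + m / 3 * r ^ 6"
    have D: "D > 0" unfolding D_def using m0 r by (intro add_pos_nonneg) auto
    have d0: "3 + m * r\<^sup>2 \<noteq> 0" using den[of r] by simp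
    have r4: "1 - r ^ 4 \<noteq> 0" "1 + r ^ 4 \<noteq> 0" using r power_strict_decreasing[of 0 4 r] by (auto simp: add_nonneg_eq_0_iff)
    \<comment> \<open>\<open>e1\<close> comes from the solution for \<open>\<kappa>\<close> and
      \<open>e2\<close> from \<open>V_x_relation\<close>. They are two linear equations for
      \<open>x\<close> and \<open>V\<close>; eliminating \<open>x\<close> produces the denominator
      \<open>D\<close>.\<close>
    have e1: "(1 + 2 * x r) * (3 + m * r\<^sup>2) = V r * (3 - m * r\<^sup>2)"
    proof -
      have "(1 + 2 * x r) * (3 + m * r\<^sup>2) = V r * ((3 + m * r\<^sup>2) - 2 * (\<kappa> r * (3 + m * r\<^sup>2)))"
        unfolding \<kappa>_eq[OF less_imp_le[OF r(1)] r(2)] by algebra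
      also have "\<dots> = V r * (3 - m * r\<^sup>2)" unfolding k[OF r] by simp
      finally show ?thesis .
    qed
    have e2: "V r * (1 + r ^ 4) = (x r + 2) * (1 - r ^ 4)" using V_x_relation r by simp
    have VD: "V r * D = (1 - r ^ 4) * (3 + m * r\<^sup>2)"
    proof -
      have "2 * (V r * (1 + r ^ 4)) * (3 + m * r\<^sup>2) = ((1 + 2 * x r) * (3 + m * r\<^sup>2) + 3 * (3 + m * r\<^sup>2)) * (1 - r ^ 4)"
        unfolding e2 by (simp add: algebra_simps)
      also have "\<dots> = (V r * (3 - m * r\<^sup>2) + 3 * (3 + m * r\<^sup>2)) * (1 - r ^ 4)" unfolding e1 ..
      finally have "2 * (V r * (1 + r ^ 4)) * (3 + m * r\<^sup>2) = (V r * (3 - m * r\<^sup>2) + 3 * (3 + m * r\<^sup>2)) * (1 - r ^ 4)" .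
      moreover have "3 * D = 3 + 3 * m * r\<^sup>2 + 9 * r ^ 4 + m * r ^ 6" by (simp add: D_def)
      ultimately have "3 * (V r * D) = 3 * ((1 - r ^ 4) * (3 + m * r\<^sup>2))" by algebra
      then show ?thesis by simp
    qed
    have V: "V r = (1 - r ^ 4) * (3 + m * r\<^sup>2) / D" using VD D by (simp add: eq_divide_eq)
    have xp: "x r + 2 = (1 + r ^ 4) * (3 + m * r\<^sup>2) / D"
    proof -
      have "(x r + 2) * (1 - r ^ 4) = ((1 + r ^ 4) * (3 + m * r\<^sup>2) / D) * (1 - r ^ 4)"
        unfolding e2[symmetric] V by simp
      then show ?thesis by (rule mult_right_cancel[OF r4(1), THEN iffD1])
    qed
    have x: "x r = (1 - m * r\<^sup>2 - 3 * r ^ 4 + m / 3 * r ^ 6) / D"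
    proof -
      have "x r = ((1 + r ^ 4) * (3 + m * r\<^sup>2) - 2 * D) / D" using xp D by (simp add: field_simps)
      also have "(1 + r ^ 4) * (3 + m * r\<^sup>2) - 2 * D = 1 - m * r\<^sup>2 - 3 * r ^ 4 + m / 3 * r ^ 6"
        by (simp add: D_def field_simps)
      finally show ?thesis .
    qed
    have c1': "c1 r = of_real (1 / D) * (2 * \<mu> * of_real r * of_real (1 - r ^ 4))"
    proof -
      have "c1 r = (2 * r * (1 - r ^ 4) / D) *\<^sub>R \<mu>" unfolding c1[OF r] V using d0 by simp
      then show ?thesis by (simp add: scaleR_conv_of_real mult_ac)
    qed
    have c2': "c2 r = of_real (1 / D) * (of_real (2 * sqrt 3) * (of_real r)\<^sup>2 * of_real (1 + m / 3 * r\<^sup>2))"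
    proof -
      have "2 * sqrt 3 / 3 * r\<^sup>2 * (x r + 2) / (1 + r ^ 4) = 1 / D * (2 * sqrt 3 * r\<^sup>2 * (1 + m / 3 * r\<^sup>2))"
      proof -
        have "2 * sqrt 3 / 3 * a * (q * (3 + m * a) / D) / q = 1 / D * (2 * sqrt 3 * a * (1 + m / 3 * a))" if "q \<noteq> 0" for a q
          using that D by (simp add: field_simps)
        from this[OF r4(2)] show ?thesis unfolding xp .
      qed
      then have "c2 r = of_real (1 / D * (2 * sqrt 3 * r\<^sup>2 * (1 + m / 3 * r\<^sup>2)))" using c2_formula[of r] r by simp
      then show ?thesis by simp
    qed
    have DN: "D_N \<mu> (of_real r) = D" using r by (simp add: D_N_def D_def m)
    have "f r = (x r, c1 r, c2 r)" by (simp add: x_def c1_def c2_def)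
    then show "f r = u_N \<mu> (of_real r)"
      unfolding u_N_def DN using x c1' c2' r by (simp add: m scaleR_conv_of_real)
  qed
qed

end

section \<open>The explicit minimizers\<close>

lemma rot_action_eq: "rot_action \<alpha> p = (fst p, cis \<alpha> * fst (snd p), cis (2 * \<alpha>) * snd (snd p))"
  by (cases p) (simp add: rot_action_def)

lemma norm_rot_action [simp]: "norm (rot_action \<alpha> p) = norm p"
  by (cases p) (simp add: rot_action_def norm_Pair norm_mult)

lemma bounded_linear_rot_action: "bounded_linear (rot_action \<alpha>)"
  unfolding rot_action_eq[abs_def]
  by (intro bounded_linear_Pair bounded_linear_fst
      bounded_linear_compose[OF bounded_linear_mult_right bounded_linear_compose[OF bounded_linear_fst bounded_linear_snd]]
      bounded_linear_compose[OF bounded_linear_mult_right bounded_linear_compose[OF bounded_linear_snd bounded_linear_snd]])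

lemma rot_action_add: "rot_action \<alpha> (rot_action \<beta> p) = rot_action (\<alpha> + \<beta>) p"
  by (simp add: rot_action_eq cis_mult[symmetric] mult_ac distrib_left del: cis_mult)

lemma rot_action_0 [simp]: "rot_action 0 p = p"
  by (simp add: rot_action_eq)

lemma continuous_on_rot_action:
  "continuous_on S a \<Longrightarrow> continuous_on S g \<Longrightarrow> continuous_on S (\<lambda>x. rot_action (a x) (g x))"
  unfolding rot_action_eq by (intro continuous_intros)

text \<open>The infinitesimal generator of the circle action: the derivative of
  \<open>rot_action \<alpha> p\<close> in \<open>\<alpha>\<close> at 0.\<close>

definition rot_generator :: "R5 \<Rightarrow> R5" where
  "rot_generator p = (0, \<i> * fst (snd p), 2 * \<i> * snd (snd p))"

lemma norm_rot_generator: "(norm (rot_generator p))\<^sup>2 = angular_energy p"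
  by (simp add: rot_generator_def angular_energy_def norm_Pair norm_mult power_mult_distrib)

lemma has_vector_derivative_Pair:
  assumes "(f has_vector_derivative f') (at x within S)" "(g has_vector_derivative g') (at x within S)"
  shows "((\<lambda>x. (f x, g x)) has_vector_derivative (f', g')) (at x within S)"
  using has_derivative_Pair[OF assms[unfolded has_vector_derivative_def]] by (simp add: has_vector_derivative_def)

lemma has_vector_derivative_cis:
  "((\<lambda>t. cis (k * t)) has_vector_derivative (k *\<^sub>R (\<i> * cis (k * t)))) (at t within S)"
  unfolding has_vector_derivative_def by (auto intro!: derivative_eq_intros simp: fun_eq_iff mult_ac)

lemma has_vector_derivative_rot_action:
  assumes g: "(g has_vector_derivative g') (at t within S)"
  shows "((\<lambda>t. rot_action (k * t) (g t)) has_vector_derivative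
    rot_action (k * t) (g' + k *\<^sub>R rot_generator (g t))) (at t within S)"
proof -
  note comps = has_vector_derivative_components[OF g]
  note comps2 = has_vector_derivative_components[OF comps(2)]
  have c: "((\<lambda>t. cis (j * t)) has_vector_derivative (j *\<^sub>R (\<i> * cis (j * t)))) (at t within S)" for j
    by (rule has_vector_derivative_cis)
  have A: "((\<lambda>t. (fst (g t), cis (k * t) * fst (snd (g t)), cis (2 * k * t) * snd (snd (g t)))) has_vector_derivative
    (fst g', cis (k * t) * fst (snd g') + (k *\<^sub>R (\<i> * cis (k * t))) * fst (snd (g t)),
     cis (2 * k * t) * snd (snd g') + ((2 * k) *\<^sub>R (\<i> * cis (2 * k * t))) * snd (snd (g t)))) (at t within S)"
    by (intro has_vector_derivative_Pair comps(1) has_vector_derivative_mult comps2 c)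
  have B: "rot_action (k * t) (g' + k *\<^sub>R rot_generator (g t)) =
    (fst g', cis (k * t) * fst (snd g') + (k *\<^sub>R (\<i> * cis (k * t))) * fst (snd (g t)),
     cis (2 * k * t) * snd (snd g') + ((2 * k) *\<^sub>R (\<i> * cis (2 * k * t))) * snd (snd (g t)))"
    by (simp add: rot_action_eq rot_generator_def distrib_left scaleR_conv_of_real mult_ac)
  have "(\<lambda>t. rot_action (k * t) (g t)) = (\<lambda>t. (fst (g t), cis (k * t) * fst (snd (g t)), cis (2 * k * t) * snd (snd (g t))))"
    by (simp add: rot_action_eq mult.assoc)
  then show ?thesis using A by (simp only: B)
qed

definition grad_sq :: "(complex \<Rightarrow> 'b::euclidean_space) \<Rightarrow> complex \<Rightarrow> real" where
  "grad_sq v z = (\<Sum>b\<in>Basis. (norm (partial_deriv b v z))\<^sup>2)"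

lemma grad_sq_eq: "grad_sq v z = (norm (partial_deriv 1 v z))\<^sup>2 + (norm (partial_deriv \<i> v z))\<^sup>2"
  by (simp add: grad_sq_def Basis_complex_def)

lemma partial_deriv_complex:
  assumes "v differentiable (at z)"
  shows "partial_deriv h v z = Re h *\<^sub>R partial_deriv 1 v z + Im h *\<^sub>R partial_deriv \<i> v z"
proof -
  have "h = Re h *\<^sub>R 1 + Im h *\<^sub>R \<i>" by (simp add: complex_eq_iff)
  then have "partial_deriv h v z = partial_deriv (Re h *\<^sub>R 1 + Im h *\<^sub>R \<i>) v z" by simp
  then show ?thesis
    by (simp only: linear_add[OF linear_partial_deriv[OF assms]] linear_scale[OF linear_partial_deriv[OF assms]])
qed

text \<open>The radial direction \<open>cis t\<close> and the angular direction
  \<open>\<i> * cis t\<close> form an orthonormal frame, and the sum of squares does not depend on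
  the frame.\<close>

lemma grad_sq_polar:
  assumes "v differentiable (at z)"
  shows "(norm (partial_deriv (cis t) v z))\<^sup>2 + (norm (partial_deriv (\<i> * cis t) v z))\<^sup>2 = grad_sq v z"
proof -
  have "(norm (c *\<^sub>R A + s *\<^sub>R B))\<^sup>2 + (norm ((- s) *\<^sub>R A + c *\<^sub>R B))\<^sup>2 = (c\<^sup>2 + s\<^sup>2) * ((norm A)\<^sup>2 + (norm B)\<^sup>2)"
    for c s :: real and A B :: 'a
    unfolding power2_norm_eq_inner
    by (simp add: inner_add_left inner_add_right inner_commute[of B A] power2_eq_square algebra_simps)
  from this[of "cos t" "partial_deriv 1 v z" "sin t" "partial_deriv \<i> v z"] show ?thesis
    by (simp add: partial_deriv_complex[OF assms, of "cis t"] partial_deriv_complex[OF assms, of "\<i> * cis t"] grad_sq_eq)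
qed

lemma continuous_on_grad_sq: "C_diff (Suc 0) v \<Longrightarrow> continuous_on S (grad_sq v)"
  unfolding grad_sq_def[abs_def]
  by (intro continuous_intros) (auto intro: continuous_on_subset)

lemma radial_derivative:
  fixes v :: "complex \<Rightarrow> 'b::euclidean_space"
  assumes "\<And>z. v differentiable (at z)"
  shows "((\<lambda>r. v (of_real r * e)) has_vector_derivative partial_deriv e v (of_real r * e)) (at r within S)"
proof (rule has_vector_derivative_compose_partial[OF assms])
  have "((\<lambda>r. of_real r * e) has_vector_derivative of_real 1 * e) (at r within S)"
    by (intro has_vector_derivative_mult_left has_vector_derivative_of_real DERIV_ident)
  then show "((\<lambda>r. of_real r * e) has_vector_derivative e) (at r within S)" by simp
qed

lemma angular_derivative:
  assumes v: "\<And>z. v differentiable (at z)"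
  shows "((\<lambda>t. v (of_real r * cis t)) has_vector_derivative r *\<^sub>R partial_deriv (\<i> * cis t) v (of_real r * cis t)) (at t within S)"
proof -
  have "((\<lambda>t. of_real r * cis t) has_vector_derivative r *\<^sub>R (\<i> * cis t)) (at t within S)"
    unfolding has_vector_derivative_def scaleR_conv_of_real
    by (auto intro!: derivative_eq_intros simp: scaleR_conv_of_real mult_ac)
  from has_vector_derivative_compose_partial[OF v this] show ?thesis
    by (simp only: linear_scale[OF linear_partial_deriv[OF v]])
qed

lemma AE_rotate_disc:
  assumes P: "AE z in lebesgue_on unit_disc. P z"
  shows "AE z in lebesgue_on unit_disc. P (cis a * z)"
proof -
  have m: "unit_disc \<in> sets lebesgue" by auto
  have "negligible {z \<in> unit_disc. \<not> P z}" using P m by (simp only: AE_lebesgue_on_iff_negligible)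
  then have "negligible ((\<lambda>z. cis (- a) * z) ` {z \<in> unit_disc. \<not> P z})"
    by (rule negligible_differentiable_image_negligible[rotated])
      (auto intro!: derivative_intros simp: differentiable_on_def)
  moreover have "{z \<in> unit_disc. \<not> P (cis a * z)} \<subseteq> (\<lambda>z. cis (- a) * z) ` {z \<in> unit_disc. \<not> P z}"
  proof
    fix z assume z: "z \<in> {z \<in> unit_disc. \<not> P (cis a * z)}"
    have "z = cis (- a) * (cis a * z)" by (simp add: mult.assoc[symmetric] cis_mult)
    moreover have "cis a * z \<in> {z \<in> unit_disc. \<not> P z}" using z by (simp add: norm_mult)
    ultimately show "z \<in> (\<lambda>z. cis (- a) * z) ` {z \<in> unit_disc. \<not> P z}" by blast
  qed
  ultimately have "negligible {z \<in> unit_disc. \<not> P (cis a * z)}" by (rule negligible_subset)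
  then show ?thesis using m by (simp only: AE_lebesgue_on_iff_negligible)
qed

lemma disc_sets_lebesgue: "unit_disc \<in> sets lebesgue"
  by auto

lemma weak_partial_smooth_rep:
  assumes w: "C_diff (Suc 0) w" and eq: "AE z in lebesgue_on unit_disc. u z = w z" and b: "b \<in> Basis"
  shows "has_weak_partial unit_disc b u (partial_deriv b w)"
    "AE z in lebesgue_on unit_disc. weak_partial unit_disc b u z = partial_deriv b w z"
    "square_integrable unit_disc (partial_deriv b w)"
proof -
  have "has_weak_partial unit_disc b w (partial_deriv b w)"
    by (rule has_weak_partial_classical[OF open_ball w b])
  moreover have "AE z in lebesgue_on unit_disc. w z = u z" using eq by auto
  ultimately show h: "has_weak_partial unit_disc b u (partial_deriv b w)"
    using has_weak_partial_AE disc_sets_lebesgue b by blast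
  show "AE z in lebesgue_on unit_disc. weak_partial unit_disc b u z = partial_deriv b w z"
    by (rule weak_partial_AE_eq[OF h open_ball b])
  have "continuous_on UNIV (partial_deriv b w)" using w b by simp
  then show "square_integrable unit_disc (partial_deriv b w)"
    by (intro square_integrable_continuous disc_sets_lebesgue) (auto intro: continuous_on_subset)
qed

lemma E0_smooth_rep:
  assumes w: "C_diff (Suc 0) w" and eq: "AE z in lebesgue_on unit_disc. u z = w z"
  shows "E0 u = (LINT z|lebesgue_on unit_disc. 1 / 2 * grad_sq w z)"
  unfolding E0_def
proof (rule integral_cong_AE)
  have [measurable]: "partial_deriv b w \<in> borel_measurable (lebesgue_on unit_disc)" if "b \<in> Basis" for b
    using weak_partial_smooth_rep(3)[OF w eq that] by (simp add: square_integrable_def)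
  have [measurable]: "weak_partial unit_disc b u \<in> borel_measurable (lebesgue_on unit_disc)" if "b \<in> Basis" for b
  proof -
    have "AE z in lebesgue_on unit_disc. partial_deriv b w z = weak_partial unit_disc b u z"
      using weak_partial_smooth_rep(2)[OF w eq that] by auto
    from square_integrable_AE[OF weak_partial_smooth_rep(3)[OF w eq that] disc_sets_lebesgue this]
    show ?thesis by (simp add: square_integrable_def)
  qed
  show "(\<lambda>z. 1 / 2 * (\<Sum>b\<in>Basis. (norm (weak_partial unit_disc b u z))\<^sup>2)) \<in> borel_measurable (lebesgue_on unit_disc)"
    by measurable
  show "(\<lambda>z. 1 / 2 * grad_sq w z) \<in> borel_measurable (lebesgue_on unit_disc)"
    unfolding grad_sq_def by measurable
  have "AE z in lebesgue_on unit_disc. \<forall>b\<in>Basis. weak_partial unit_disc b u z = partial_deriv b w z"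
    by (intro AE_finite_allI finite_Basis weak_partial_smooth_rep(2)[OF w eq])
  then show "AE z in lebesgue_on unit_disc. 1 / 2 * (\<Sum>b\<in>Basis. (norm (weak_partial unit_disc b u z))\<^sup>2) = 1 / 2 * grad_sq w z"
    by (auto simp: grad_sq_def)
qed

text \<open>The constant sequence \<open>w\<close> serves as the approximation required by
  \<open>has_trace\<close>: it is smooth on the whole plane, differs from \<open>u\<close> on a null
  set, and has the boundary values exactly.\<close>

lemma smooth_rep_in_A_at_origin:
  assumes w: "smooth w" and rot: "\<And>\<alpha> z. w (cis \<alpha> * z) = rot_action \<alpha> (w z)" and n: "\<And>z. norm (w z) = 1"
    and bd: "\<And>t. w (cis t) = g_H (cis t)" and p: "w 0 = p"
    and eq: "AE z in lebesgue_on unit_disc. u z = w z"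
  shows "u \<in> A_at_origin p"
proof -
  have w1: "C_diff (Suc 0) w" using w unfolding smooth_def by blast
  have wc: "continuous_on UNIV w" by (rule C_diff_imp_continuous[OF w1])
  have eq': "AE z in lebesgue_on unit_disc. w z = u z" using eq by auto
  have "square_integrable unit_disc w"
    using wc by (intro square_integrable_continuous disc_sets_lebesgue) (auto intro: continuous_on_subset)
  then have "square_integrable unit_disc u" using disc_sets_lebesgue eq' by (rule square_integrable_AE)
  then have W: "u \<in> W12 unit_disc"
    using weak_partial_smooth_rep(1,3)[OF w1 eq] unfolding W12_def by blast
  have S: "AE z in lebesgue_on unit_disc. u z \<in> sphere 0 1"
    using eq by eventually_elim (simp add: n)
  have R: "equivariant u"
    unfolding equivariant_def
  proof
    fix \<alpha>
    show "AE z in lebesgue_on unit_disc. u (cis \<alpha> * z) = rot_action \<alpha> (u z)"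
      using AE_rotate_disc[OF eq, of \<alpha>] eq by eventually_elim (simp add: rot)
  qed
  have T: "has_trace u g_H"
    unfolding has_trace_def
  proof (intro conjI exI[of _ "\<lambda>n. w"] allI W w)
    have g: "(\<lambda>t. g_H (cis t)) = (\<lambda>t. w (cis t))" by (simp add: bd)
    show "square_integrable {0..2 * pi} (\<lambda>t. g_H (cis t))"
      unfolding g by (intro square_integrable_continuous continuous_on_compose2[OF wc] continuous_intros) auto
    show "(\<lambda>n. LINT t|lebesgue_on {0..2 * pi}. (norm (w (cis t) - g_H (cis t)))\<^sup>2) \<longlonglongrightarrow> 0"
      by (simp add: bd)
    have "(LINT z|lebesgue_on unit_disc. (norm (w z - u z))\<^sup>2) = 0"
      by (rule integral_eq_zero_AE) (use eq in auto)
    moreover have "(LINT z|lebesgue_on unit_disc. (norm (weak_partial unit_disc b (\<lambda>z. w z - u z) z))\<^sup>2) = 0" if b: "b \<in> Basis" for b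
    proof (rule integral_eq_zero_AE)
      have "has_weak_partial unit_disc b (\<lambda>z. w z - u z) (\<lambda>z. partial_deriv b w z - partial_deriv b w z)"
        by (intro has_weak_partial_diff has_weak_partial_classical open_ball w1 b weak_partial_smooth_rep(1)[OF w1 eq] disc_sets_lebesgue)
      from weak_partial_AE_eq[OF this open_ball b]
      show "AE z in lebesgue_on unit_disc. (norm (weak_partial unit_disc b (\<lambda>z. w z - u z) z))\<^sup>2 = 0" by auto
    qed
    ultimately show "(\<lambda>n. W12_norm unit_disc (\<lambda>z. w z - u z)) \<longlonglongrightarrow> 0"
      by (simp add: W12_norm_def)
  qed
  have "u \<in> A_sym" using W S R T by (simp add: A_sym_def)
  then show ?thesis
    unfolding A_at_origin_def using eq p continuous_on_subset[OF wc subset_UNIV] by blast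
qed

text \<open>Along a minimizing profile the radial energy is an exact derivative: \<open>h\<close>
  stands for the calibration along the profile, and the fundamental theorem yields the energy. The
  derivative of \<open>h\<close> is asked for only inside the interval; the two end points are a
  null set.\<close>

lemma E0_smooth_equivariant:
  fixes w :: "complex \<Rightarrow> R5"
  assumes w: "C_diff (Suc 0) w" and rot: "\<And>\<alpha> z. w (cis \<alpha> * z) = rot_action \<alpha> (w z)"
    and eq: "AE z in lebesgue_on unit_disc. u z = w z"
    and h: "continuous_on {0..1} h" "\<And>r. 0 < r \<Longrightarrow> r < 1 \<Longrightarrow> (h has_real_derivative h' r) (at r)"
    and e: "\<And>r. 0 < r \<Longrightarrow> r < 1 \<Longrightarrow>
      radial_energy (\<lambda>r. w (of_real r)) (\<lambda>r. partial_deriv 1 w (of_real r)) r = - 2 * h' r"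
  shows "E0 u = 2 * pi * (h 0 - h 1)"
proof -
  have d: "w differentiable (at z)" for z using w by simp
  have wr: "w (of_real r * cis t) = rot_action t (w (of_real r))" for r t
    using rot[of t "of_real r"] by (simp add: mult.commute)
  have g: "r * grad_sq w (of_real r * cis t) = radial_energy (\<lambda>r. w (of_real r)) (\<lambda>r. partial_deriv 1 w (of_real r)) r"
    if r: "r > 0" for r t
  proof -
    have "((\<lambda>r. w (of_real r * 1)) has_vector_derivative partial_deriv 1 w (of_real r * 1)) (at r)" by (rule radial_derivative[OF d])
    then have "((\<lambda>r. rot_action t (w (of_real r))) has_vector_derivative rot_action t (partial_deriv 1 w (of_real r))) (at r)"
      using bounded_linear.has_vector_derivative[OF bounded_linear_rot_action] by simp
    moreover have "((\<lambda>r. rot_action t (w (of_real r))) has_vector_derivative partial_deriv (cis t) w (of_real r * cis t)) (at r)"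
      using radial_derivative[OF d, of "cis t" r UNIV] by (simp add: wr)
    ultimately have 1: "partial_deriv (cis t) w (of_real r * cis t) = rot_action t (partial_deriv 1 w (of_real r))"
      by (rule vector_derivative_unique_at[symmetric])
    have "((\<lambda>t. rot_action (1 * t) (w (of_real r))) has_vector_derivative rot_action (1 * t) (0 + 1 *\<^sub>R rot_generator (w (of_real r)))) (at t)"
      by (intro has_vector_derivative_rot_action has_vector_derivative_const)
    moreover have "((\<lambda>t. rot_action (1 * t) (w (of_real r))) has_vector_derivative r *\<^sub>R partial_deriv (\<i> * cis t) w (of_real r * cis t)) (at t)"
      using angular_derivative[OF d, of r t UNIV] by (simp add: wr)
    ultimately have 2: "r *\<^sub>R partial_deriv (\<i> * cis t) w (of_real r * cis t) = rot_action t (rot_generator (w (of_real r)))"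
      using vector_derivative_unique_at by fastforce
    have "(norm (r *\<^sub>R partial_deriv (\<i> * cis t) w (of_real r * cis t)))\<^sup>2 = angular_energy (w (of_real r))"
      unfolding 2 by (simp add: norm_rot_generator)
    then have "r\<^sup>2 * (norm (partial_deriv (\<i> * cis t) w (of_real r * cis t)))\<^sup>2 = angular_energy (w (of_real r))"
      by (simp add: power_mult_distrib)
    then show ?thesis
      using r unfolding grad_sq_polar[OF d, of t, symmetric] 1 radial_energy_def by (simp add: field_simps power2_eq_square)
  qed
  have "E0 u = 1 / 2 * (LINT z|lebesgue_on unit_disc. grad_sq w z)"
    unfolding E0_smooth_rep[OF w eq] by simp
  also have "(LINT z|lebesgue_on unit_disc. grad_sq w z) =
      integral {0..1} (\<lambda>r. r * integral {0..2 * pi} (\<lambda>t. grad_sq w (of_real r * cis t)))"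
    by (rule disc_integral_polar[OF continuous_on_grad_sq[OF w]])
  also have "\<dots> = integral {0..1} (\<lambda>r. - 4 * pi * h' r)"
  proof (rule integral_spike[where S="{0, 1}"])
    fix r :: real assume "r \<in> {0..1} - {0, 1}"
    then have r: "0 < r" "r < 1" by auto
    have "r * integral {0..2 * pi} (\<lambda>t. grad_sq w (of_real r * cis t)) = integral {0..2 * pi} (\<lambda>t. r * grad_sq w (of_real r * cis t))"
      by simp
    also have "\<dots> = integral {0..2 * pi} (\<lambda>t. - 2 * h' r)" using g[OF r(1)] e[OF r] by simp
    finally show "- 4 * pi * h' r = r * integral {0..2 * pi} (\<lambda>t. grad_sq w (of_real r * cis t))" by simp
  qed auto
  also have "\<dots> = - 4 * pi * (h 1 - h 0)"
  proof -
    have "(h' has_integral (h 1 - h 0)) {0..1}"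
      using h by (intro fundamental_theorem_of_calculus_interior) (auto simp: has_real_derivative_iff_has_vector_derivative)
    then show ?thesis by (simp add: integral_unique)
  qed
  finally show ?thesis by (simp add: algebra_simps)
qed

text \<open>The profiles of the minimizers are quotients \<open>P / D\<close> with \<open>\<bar>P\<bar> = D\<close>, so that
  \<open>\<bar>(P / D)'\<bar>\<^sup>2 = (\<bar>P'\<bar>\<^sup>2 - D'\<^sup>2) / D\<^sup>2\<close>.\<close>

lemma radial_energy_quotient:
  fixes P P' a a' b b' D D' N N' :: "real \<Rightarrow> real" and \<mu> :: complex
  assumes r: "r > 0" and D: "D r \<noteq> 0"
    and f: "\<And>r. f r = (P r / D r, of_real (a r / D r) * \<mu>, of_real (b r / D r))"
    and d: "(P has_real_derivative P' r) (at r)" "(a has_real_derivative a' r) (at r)"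
      "(b has_real_derivative b' r) (at r)" "(D has_real_derivative D' r) (at r)"
    and f': "(f has_vector_derivative f' r) (at r)"
    and sph: "(P r)\<^sup>2 + (cmod \<mu>)\<^sup>2 * (a r)\<^sup>2 + (b r)\<^sup>2 = (D r)\<^sup>2"
    and ort: "P r * P' r + (cmod \<mu>)\<^sup>2 * (a r * a' r) + b r * b' r = D r * D' r"
    and e: "r\<^sup>2 * ((P' r)\<^sup>2 + (cmod \<mu>)\<^sup>2 * (a' r)\<^sup>2 + (b' r)\<^sup>2 - (D' r)\<^sup>2) = (cmod \<mu>)\<^sup>2 * (a r)\<^sup>2 + 4 * (b r)\<^sup>2"
    and n: "r * (N' r * D r - N r * D' r) = - ((cmod \<mu>)\<^sup>2 * (a r)\<^sup>2 + 4 * (b r)\<^sup>2)"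
  shows "radial_energy f f' r = - 2 * ((N' r * D r - N r * D' r) / (D r * D r))"
proof -
  let ?q = "\<lambda>p p'. (p' * D r - p * D' r) / (D r * D r)"
  have q: "((\<lambda>r. p r / D r) has_real_derivative ?q (p r) (p' r)) (at r)" if "(p has_real_derivative p' r) (at r)" for p p'
    by (rule DERIV_divide[OF that d(4) D])
  have "(f has_vector_derivative (?q (P r) (P' r), of_real (?q (a r) (a' r)) * \<mu>, of_real (?q (b r) (b' r)))) (at r)"
    unfolding f[abs_def]
    by (intro has_vector_derivative_Pair has_vector_derivative_mult_left has_vector_derivative_of_real q d
        q[THEN has_real_derivative_iff_has_vector_derivative[THEN iffD1]])
  then have f'_eq: "f' r = (?q (P r) (P' r), of_real (?q (a r) (a' r)) * \<mu>, of_real (?q (b r) (b' r)))"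
    using f' vector_derivative_unique_at by blast
  define S where "S = (cmod \<mu>)\<^sup>2 * (a r)\<^sup>2 + 4 * (b r)\<^sup>2"
  have "(norm (f' r))\<^sup>2 = (?q (P r) (P' r))\<^sup>2 + (cmod \<mu>)\<^sup>2 * (?q (a r) (a' r))\<^sup>2 + (?q (b r) (b' r))\<^sup>2"
    unfolding f'_eq norm_R5_sq fst_conv snd_conv norm_mult norm_of_real power_mult_distrib power2_abs by simp
  also have "\<dots> = ((P' r * D r - P r * D' r)\<^sup>2 + (cmod \<mu>)\<^sup>2 * (a' r * D r - a r * D' r)\<^sup>2 + (b' r * D r - b r * D' r)\<^sup>2) / (D r) ^ 4"
    by (simp add: power_divide add_divide_distrib power2_eq_square power4_eq_xxxx mult_ac)
  \<comment> \<open>After expansion \<open>ort\<close> turns the cross terms into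
    \<open>- 2 * (D r)\<^sup>2 * (D' r)\<^sup>2\<close>, and \<open>sph\<close> turns the last terms
    into \<open>(D r)\<^sup>2 * (D' r)\<^sup>2\<close>.\<close>
  also have "(P' r * D r - P r * D' r)\<^sup>2 + (cmod \<mu>)\<^sup>2 * (a' r * D r - a r * D' r)\<^sup>2 + (b' r * D r - b r * D' r)\<^sup>2
      = (D r)\<^sup>2 * ((P' r)\<^sup>2 + (cmod \<mu>)\<^sup>2 * (a' r)\<^sup>2 + (b' r)\<^sup>2 - (D' r)\<^sup>2)"
    using sph ort by algebra
  also have "(P' r)\<^sup>2 + (cmod \<mu>)\<^sup>2 * (a' r)\<^sup>2 + (b' r)\<^sup>2 - (D' r)\<^sup>2 = S / r\<^sup>2"
    using e r by (simp add: S_def eq_divide_eq mult.commute)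
  finally have 1: "r * (norm (f' r))\<^sup>2 = S / (r * (D r)\<^sup>2)"
    using r D by (simp add: field_simps power2_eq_square power4_eq_xxxx)
  have 2: "angular_energy (f r) / r = S / (r * (D r)\<^sup>2)"
    using r D unfolding angular_energy_def f fst_conv snd_conv norm_mult norm_of_real power_mult_distrib power2_abs S_def
    by (simp add: field_simps power2_eq_square)
  have 3: "(N' r * D r - N r * D' r) / (D r * D r) = - S / (r * (D r)\<^sup>2)"
  proof -
    have "N' r * D r - N r * D' r = - S / r"
    proof -
      have "N' r * D r - N r * D' r = r * (N' r * D r - N r * D' r) / r" using r by simp
      then show ?thesis unfolding n S_def .
    qed
    then show ?thesis by (simp add: power2_eq_square)
  qed
  show ?thesis unfolding radial_energy_def 1 2 3 by simp
qed

section \<open>Smoothness, symmetry and energy of the explicit maps\<close>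

lemma C_diff_cmod_sq: "C_diff k (\<lambda>z. (cmod z)\<^sup>2)"
  using C_diff_inner[OF C_diff_bounded_linear C_diff_bounded_linear, of "\<lambda>z::complex. z" "\<lambda>z. z" k]
  by (simp add: power2_norm_eq_inner bounded_linear_ident)

lemma C_diff_power:
  fixes f :: "'a::euclidean_space \<Rightarrow> 'b::{euclidean_space, real_normed_algebra_1}"
  shows "C_diff k f \<Longrightarrow> C_diff k (\<lambda>x. f x ^ n)"
  by (induction n) (auto intro: C_diff_const C_diff_mult)

text \<open>Restricted to even powers, which are polynomials in the real coordinates; odd powers
  fail to be smooth at 0.\<close>

lemma C_diff_cmod_power: "C_diff k (\<lambda>z. cmod z ^ (2 * n))"
  unfolding power_mult by (intro C_diff_power C_diff_cmod_sq)

lemma C_diff_diff: "C_diff k f \<Longrightarrow> C_diff k g \<Longrightarrow> C_diff k (\<lambda>x. f x - g x)"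
  using C_diff_add[OF _ C_diff_linear_compose[OF bounded_linear_minus[OF bounded_linear_ident]], of k f g] by simp

lemma C_diff_of_real: "C_diff k f \<Longrightarrow> C_diff k (\<lambda>x. complex_of_real (f x))"
  by (rule C_diff_linear_compose[OF bounded_linear_of_real])

lemma C_diff_square: "C_diff k (\<lambda>z::complex. z\<^sup>2)"
  by (intro C_diff_power C_diff_bounded_linear[OF bounded_linear_ident])

lemma smooth_u_S: "smooth u_S"
  unfolding smooth_def
proof
  fix k
  have c4: "C_diff k (\<lambda>z. cmod z ^ 4)" using C_diff_cmod_power[of k 2] by simp
  have nz: "cmod z ^ 4 + 3 \<noteq> 0" for z by (simp add: add_nonneg_eq_0_iff)
  have i: "C_diff k (\<lambda>z. inverse (cmod z ^ 4 + 3))"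
    using nz by (intro C_diff_inverse C_diff_add c4 C_diff_const)
  have "C_diff k (\<lambda>z. ((cmod z ^ 4 - 3) * inverse (cmod z ^ 4 + 3), 0,
      of_real (2 * sqrt 3) * z\<^sup>2 * of_real (inverse (cmod z ^ 4 + 3))) :: R5)"
    by (intro C_diff_Pair C_diff_mult C_diff_diff C_diff_of_real C_diff_const c4 i C_diff_square)
  moreover have "(\<lambda>z. ((cmod z ^ 4 - 3) * inverse (cmod z ^ 4 + 3), 0,
      of_real (2 * sqrt 3) * z\<^sup>2 * of_real (inverse (cmod z ^ 4 + 3)))) = u_S"
    by (simp add: fun_eq_iff u_S_def divide_inverse)
  ultimately show "C_diff k u_S" by simp
qed

lemma D_N_pos: "D_N \<mu> z > 0"
  unfolding D_N_def by (intro add_pos_nonneg) auto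

lemma smooth_u_N: "smooth (u_N \<mu>)"
  unfolding smooth_def
proof
  fix k
  note cp = C_diff_cmod_power[of k 1, simplified] C_diff_cmod_power[of k 2, simplified] C_diff_cmod_power[of k 3, simplified]
  have D: "C_diff k (D_N \<mu>)"
    unfolding D_N_def[abs_def] by (intro C_diff_add C_diff_mult C_diff_const cp)
  have i: "C_diff k (\<lambda>z. inverse (D_N \<mu> z))"
    using D_N_pos[of \<mu>] by (intro C_diff_inverse D) (simp add: less_imp_neq[symmetric])
  show "C_diff k (u_N \<mu>)"
    unfolding u_N_def[abs_def] inverse_eq_divide[of "D_N _ _", symmetric]
    by (intro C_diff_scaleR C_diff_Pair C_diff_mult C_diff_add C_diff_diff C_diff_of_real C_diff_const cp i C_diff_square
        C_diff_bounded_linear[OF bounded_linear_ident])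
qed

lemma cis_double: "cis (2 * \<alpha>) = (cis \<alpha>)\<^sup>2" "cis (\<alpha> * 2) = (cis \<alpha>)\<^sup>2"
  by (simp_all add: power2_eq_square cis_mult mult.commute)

lemma u_S_rot: "u_S (cis \<alpha> * z) = rot_action \<alpha> (u_S z)"
  by (simp add: u_S_def rot_action_def norm_mult power_mult_distrib cis_double mult_ac)

lemma u_N_rot: "u_N \<mu> (cis \<alpha> * z) = rot_action \<alpha> (u_N \<mu> z)"
  unfolding u_N_def D_N_def
  by (simp add: rot_action_def norm_mult power_mult_distrib cis_double scaleR_conv_of_real mult_ac)

lemma norm_u_S: "norm (u_S z) = 1"
proof -
  define s where "s = (cmod z)\<^sup>2"
  have p: "s\<^sup>2 + 3 > 0" by (simp add: add_nonneg_pos)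
  have s4: "cmod z ^ 4 = s\<^sup>2" by (simp add: s_def flip: power_mult)
  have "cmod (of_real (2 * sqrt 3) * z\<^sup>2 / of_real (s\<^sup>2 + 3)) = 2 * sqrt 3 * s / (s\<^sup>2 + 3)"
    using p by (simp add: norm_divide norm_mult norm_power s_def del: of_real_add of_real_mult)
  then have "(norm (u_S z))\<^sup>2 = ((s\<^sup>2 - 3) / (s\<^sup>2 + 3))\<^sup>2 + (2 * sqrt 3 * s / (s\<^sup>2 + 3))\<^sup>2"
    by (simp add: norm_R5_sq u_S_def s4)
  also have "\<dots> = ((s\<^sup>2 - 3)\<^sup>2 + 12 * s\<^sup>2) / (s\<^sup>2 + 3)\<^sup>2"
    by (simp add: power_divide add_divide_distrib power_mult_distrib)
  also have "(s\<^sup>2 - 3)\<^sup>2 + 12 * s\<^sup>2 = (s\<^sup>2 + 3)\<^sup>2" by algebra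
  finally have "(norm (u_S z))\<^sup>2 = 1" using p by simp
  then show ?thesis using power2_eq_imp_eq[of "norm (u_S z)" 1] by simp
qed

lemma norm_u_N: "norm (u_N \<mu> z) = 1"
proof -
  define s w where "s = (cmod z)\<^sup>2" and "w = (cmod \<mu>)\<^sup>2 / 3"
  have m: "(cmod \<mu>)\<^sup>2 = 3 * w" by (simp add: w_def)
  have s4: "cmod z ^ 4 = s\<^sup>2" "cmod z ^ 6 = s ^ 3" by (simp_all add: s_def flip: power_mult)
  have sw: "0 \<le> s" "0 \<le> w" by (auto simp: s_def w_def)
  have D: "D_N \<mu> z = 1 + 3 * w * s + 3 * s\<^sup>2 + w * s ^ 3" by (simp add: D_N_def m s4 s_def[symmetric])
  have 1: "(cmod (2 * \<mu> * z * of_real (1 - s\<^sup>2)))\<^sup>2 = 12 * w * s * (1 - s\<^sup>2)\<^sup>2"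
    unfolding norm_mult norm_of_real power_mult_distrib power2_abs by (simp add: m s_def)
  have 2: "(cmod (of_real (2 * sqrt 3) * z\<^sup>2 * of_real (1 + w * s)))\<^sup>2 = 12 * s\<^sup>2 * (1 + w * s)\<^sup>2"
    unfolding norm_mult norm_of_real power_mult_distrib power2_abs norm_power by (simp add: s_def flip: power_mult)
  have "(norm (u_N \<mu> z))\<^sup>2 = (1 / D_N \<mu> z)\<^sup>2 * ((1 - 3 * w * s - 3 * s\<^sup>2 + w * s ^ 3)\<^sup>2 + 12 * w * s * (1 - s\<^sup>2)\<^sup>2 + 12 * s\<^sup>2 * (1 + w * s)\<^sup>2)"
    unfolding u_N_def norm_scaleR power_mult_distrib power2_abs norm_R5_sq fst_conv snd_conv s4 w_def[symmetric] s_def[symmetric] 1 2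
    unfolding m ..
  also have "(1 - 3 * w * s - 3 * s\<^sup>2 + w * s ^ 3)\<^sup>2 + 12 * w * s * (1 - s\<^sup>2)\<^sup>2 + 12 * s\<^sup>2 * (1 + w * s)\<^sup>2 = (D_N \<mu> z)\<^sup>2"
    unfolding D by algebra
  finally have "(norm (u_N \<mu> z))\<^sup>2 = 1" using D_N_pos[of \<mu> z] by (simp add: power_divide)
  then show ?thesis using power2_eq_imp_eq[of "norm (u_N \<mu> z)" 1] by simp
qed

lemma u_S_boundary: "u_S (cis t) = g_H (cis t)"
  by (simp add: u_S_def g_H_def)

lemma u_N_boundary: "u_N \<mu> (cis t) = g_H (cis t)"
proof -
  define w where "w = (cmod \<mu>)\<^sup>2 / 3"
  have m: "(cmod \<mu>)\<^sup>2 = 3 * w" by (simp add: w_def)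
  have w: "1 + w > 0" by (simp add: w_def add_pos_nonneg)
  have D: "D_N \<mu> (cis t) = 4 * (1 + w)" by (simp add: D_N_def m)
  have 1: "1 / (4 * (1 + w)) * (1 - 3 * w - 3 + w) = - 1 / 2" using w by (simp add: field_simps)
  have 2: "1 / (4 * (1 + w)) * (2 * sqrt 3 * (1 + w)) = sqrt 3 / 2" using w by (simp add: field_simps)
  have "u_N \<mu> (cis t) = (1 / (4 * (1 + w)) * (1 - 3 * w - 3 + w), 0, of_real (1 / (4 * (1 + w)) * (2 * sqrt 3 * (1 + w))) * (cis t)\<^sup>2)"
    unfolding u_N_def D by (simp add: m scaleR_conv_of_real mult_ac)
  then show ?thesis unfolding 1 2 by (simp add: g_H_def)
qed

lemma u_S_mem: "AE z in lebesgue_on unit_disc. u z = u_S z \<Longrightarrow> u \<in> A_S"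
  unfolding A_S_def
  by (rule smooth_rep_in_A_at_origin[OF smooth_u_S u_S_rot norm_u_S u_S_boundary]) (simp_all add: u_S_def)

lemma u_N_mem: "AE z in lebesgue_on unit_disc. u z = u_N \<mu> z \<Longrightarrow> u \<in> A_N"
  unfolding A_N_def
  by (rule smooth_rep_in_A_at_origin[OF smooth_u_N u_N_rot norm_u_N u_N_boundary]) (simp_all add: u_N_def D_N_def)

lemma E0_u_S:
  assumes "AE z in lebesgue_on unit_disc. u z = u_S z"
  shows "E0 u = 2 * pi"
proof -
  \<comment> \<open>\<open>sqrt 3\<close> is split off from \<open>b\<close>, so that it occurs only
    squared and the identities have rational coefficients. The quotient \<open>N / D\<close> is the
    calibration along the profile: 1 at the south pole, 0 on the boundary.\<close>
  define q where "q = sqrt 3"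
  have q: "q\<^sup>2 = 3" by (simp add: q_def)
  define P P' a a' \<beta> \<beta>' b b' D D' N N' :: "real \<Rightarrow> real"
    where "P r = r ^ 4 - 3" and "P' r = 4 * r ^ 3" and "a r = 0" and "a' r = 0"
      and "\<beta> r = 2 * r\<^sup>2" and "\<beta>' r = 4 * r" and "b r = q * \<beta> r" and "b' r = q * \<beta>' r" and "D r = r ^ 4 + 3" and "D' r = 4 * r ^ 3"
      and "N r = 3 * (1 - r ^ 4)" and "N' r = - (12 * r ^ 3)" for r
  note defs = P_def P'_def a_def a'_def b_def b'_def \<beta>_def \<beta>'_def D_def D'_def N_def N'_def
  have bb: "(b r)\<^sup>2 = 3 * (\<beta> r)\<^sup>2" "(b' r)\<^sup>2 = 3 * (\<beta>' r)\<^sup>2" "b r * b' r = 3 * (\<beta> r * \<beta>' r)" for r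
  proof -
    have "q * \<beta> r * (q * \<beta>' r) = q\<^sup>2 * (\<beta> r * \<beta>' r)" by (simp add: power2_eq_square)
    then show "b r * b' r = 3 * (\<beta> r * \<beta>' r)" unfolding b_def b'_def q .
  qed (simp_all add: b_def b'_def power_mult_distrib q)
  have D0: "D r \<noteq> 0" for r by (simp add: D_def add_nonneg_eq_0_iff)
  have S1: "C_diff (Suc 0) u_S" using smooth_u_S unfolding smooth_def by blast
  have "E0 u = 2 * pi * (N 0 / D 0 - N 1 / D 1)"
  proof (rule E0_smooth_equivariant[OF S1 u_S_rot assms, where h'="\<lambda>r. (N' r * D r - N r * D' r) / (D r * D r)"])
    show "continuous_on {0..1} (\<lambda>r. N r / D r)"
      using D0 by (intro continuous_intros) (auto simp: N_def D_def intro!: continuous_intros)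
    fix r :: real assume r: "0 < r" "r < 1"
    have d: "(P has_real_derivative P' r) (at r)" "(a has_real_derivative a' r) (at r)" "(b has_real_derivative b' r) (at r)"
      "(D has_real_derivative D' r) (at r)" "(N has_real_derivative N' r) (at r)"
      unfolding defs[abs_def] by (auto intro!: derivative_eq_intros)
    show "((\<lambda>r. N r / D r) has_real_derivative (N' r * D r - N r * D' r) / (D r * D r)) (at r)"
      by (rule DERIV_divide[OF d(5,4) D0])
    show "radial_energy (\<lambda>r. u_S (of_real r)) (\<lambda>r. partial_deriv 1 u_S (of_real r)) r = - 2 * ((N' r * D r - N r * D' r) / (D r * D r))"
    proof (rule radial_energy_quotient[where f="\<lambda>r. u_S (of_real r)" and P=P and P'=P' and a=a and a'=a'
          and b=b and b'=b' and D=D and D'=D' and N=N and N'=N' and r=r and \<mu>=0, OF r(1) D0 _ d(1-4)])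
      show "u_S (of_real r) = (P r / D r, of_real (a r / D r) * 0, of_real (b r / D r))" for r
        by (simp add: u_S_def defs q_def)
      show "((\<lambda>r. u_S (of_real r)) has_vector_derivative partial_deriv 1 u_S (of_real r)) (at r)"
        using radial_derivative[of u_S 1 r UNIV] S1 by simp
      show "(P r)\<^sup>2 + (cmod 0)\<^sup>2 * (a r)\<^sup>2 + (b r)\<^sup>2 = (D r)\<^sup>2"
        unfolding bb unfolding defs norm_zero zero_power2 mult_zero_left add_0_left add_0_right by algebra
      show "P r * P' r + (cmod 0)\<^sup>2 * (a r * a' r) + b r * b' r = D r * D' r"
        unfolding bb unfolding defs norm_zero zero_power2 mult_zero_left add_0_left add_0_right by algebra
      show "r\<^sup>2 * ((P' r)\<^sup>2 + (cmod 0)\<^sup>2 * (a' r)\<^sup>2 + (b' r)\<^sup>2 - (D' r)\<^sup>2) = (cmod 0)\<^sup>2 * (a r)\<^sup>2 + 4 * (b r)\<^sup>2"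
        unfolding bb unfolding defs norm_zero zero_power2 mult_zero_left add_0_left add_0_right by algebra
      show "r * (N' r * D r - N r * D' r) = - ((cmod 0)\<^sup>2 * (a r)\<^sup>2 + 4 * (b r)\<^sup>2)"
        unfolding bb unfolding defs norm_zero zero_power2 mult_zero_left add_0_left add_0_right by algebra
    qed
  qed
  then show ?thesis by (simp add: defs)
qed

lemma E0_u_N:
  assumes "AE z in lebesgue_on unit_disc. u z = u_N \<mu> z"
  shows "E0 u = 6 * pi"
proof -
  define w where "w = (cmod \<mu>)\<^sup>2 / 3"
  have m: "(cmod \<mu>)\<^sup>2 = 3 * w" by (simp add: w_def)
  define q where "q = sqrt 3"
  have q: "q\<^sup>2 = 3" by (simp add: q_def)
  \<comment> \<open>\<open>N / D\<close> is again the calibration along the profile. It is 3 at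
    \<open>r = 0\<close> and 0 at \<open>r = 1\<close> for every \<open>\<mu>\<close>, which is why
    the whole family has the same energy.\<close>
  define P P' a a' \<beta> \<beta>' b b' D D' N N' :: "real \<Rightarrow> real"
    where "P r = 1 - 3 * w * r\<^sup>2 - 3 * r ^ 4 + w * r ^ 6" and "P' r = - (6 * w * r) - 12 * r ^ 3 + 6 * w * r ^ 5"
      and "a r = 2 * r * (1 - r ^ 4)" and "a' r = 2 - 10 * r ^ 4"
      and "\<beta> r = 2 * (r\<^sup>2 * (1 + w * r\<^sup>2))" and "\<beta>' r = 2 * (2 * r + 4 * w * r ^ 3)"
      and "b r = q * \<beta> r" and "b' r = q * \<beta>' r"
      and "D r = 1 + 3 * w * r\<^sup>2 + 3 * r ^ 4 + w * r ^ 6" and "D' r = 6 * w * r + 12 * r ^ 3 + 6 * w * r ^ 5"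
      and "N r = 3 * (1 + w * r\<^sup>2) * (1 - r ^ 4)" and "N' r = 6 * w * r * (1 - r ^ 4) - 12 * r ^ 3 * (1 + w * r\<^sup>2)" for r
  note defs = P_def P'_def a_def a'_def b_def b'_def \<beta>_def \<beta>'_def D_def D'_def N_def N'_def
  have DN: "D_N \<mu> (of_real r) = D r" for r by (simp add: D_N_def D_def m)
  have bb: "(b r)\<^sup>2 = 3 * (\<beta> r)\<^sup>2" "(b' r)\<^sup>2 = 3 * (\<beta>' r)\<^sup>2" "b r * b' r = 3 * (\<beta> r * \<beta>' r)" for r
  proof -
    have "q * \<beta> r * (q * \<beta>' r) = q\<^sup>2 * (\<beta> r * \<beta>' r)" by (simp add: power2_eq_square)
    then show "b r * b' r = 3 * (\<beta> r * \<beta>' r)" unfolding b_def b'_def q .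
  qed (simp_all add: b_def b'_def power_mult_distrib q)
  have D0: "D r \<noteq> 0" for r using D_N_pos[of \<mu> "of_real r"] unfolding DN by simp
  have S1: "C_diff (Suc 0) (u_N \<mu>)" using smooth_u_N unfolding smooth_def by blast
  have "E0 u = 2 * pi * (N 0 / D 0 - N 1 / D 1)"
  proof (rule E0_smooth_equivariant[OF S1 u_N_rot assms, where h'="\<lambda>r. (N' r * D r - N r * D' r) / (D r * D r)"])
    show "continuous_on {0..1} (\<lambda>r. N r / D r)"
      using D0 by (intro continuous_intros) (auto simp: N_def D_def intro!: continuous_intros)
    fix r :: real assume r: "0 < r" "r < 1"
    have d: "(P has_real_derivative P' r) (at r)" "(a has_real_derivative a' r) (at r)" "(b has_real_derivative b' r) (at r)"
      "(D has_real_derivative D' r) (at r)" "(N has_real_derivative N' r) (at r)"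
      unfolding defs[abs_def]
      by (auto intro!: derivative_eq_intros simp: algebra_simps power2_eq_square power_numeral_reduce)
    show "((\<lambda>r. N r / D r) has_real_derivative (N' r * D r - N r * D' r) / (D r * D r)) (at r)"
      by (rule DERIV_divide[OF d(5,4) D0])
    show "radial_energy (\<lambda>r. u_N \<mu> (of_real r)) (\<lambda>r. partial_deriv 1 (u_N \<mu>) (of_real r)) r = - 2 * ((N' r * D r - N r * D' r) / (D r * D r))"
    proof (rule radial_energy_quotient[where f="\<lambda>r. u_N \<mu> (of_real r)" and P=P and P'=P' and a=a and a'=a'
          and b=b and b'=b' and D=D and D'=D' and N=N and N'=N' and r=r and \<mu>=\<mu>, OF r(1) D0 _ d(1-4)])
      show "u_N \<mu> (of_real r) = (P r / D r, of_real (a r / D r) * \<mu>, of_real (b r / D r))" for r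
        unfolding u_N_def DN by (simp add: defs q_def m scaleR_conv_of_real mult_ac)
      show "((\<lambda>r. u_N \<mu> (of_real r)) has_vector_derivative partial_deriv 1 (u_N \<mu>) (of_real r)) (at r)"
        using radial_derivative[of "u_N \<mu>" 1 r UNIV] S1 by simp
      show "(P r)\<^sup>2 + (cmod \<mu>)\<^sup>2 * (a r)\<^sup>2 + (b r)\<^sup>2 = (D r)\<^sup>2"
        unfolding bb unfolding defs m by algebra
      show "P r * P' r + (cmod \<mu>)\<^sup>2 * (a r * a' r) + b r * b' r = D r * D' r"
        unfolding bb unfolding defs m by algebra
      show "r\<^sup>2 * ((P' r)\<^sup>2 + (cmod \<mu>)\<^sup>2 * (a' r)\<^sup>2 + (b' r)\<^sup>2 - (D' r)\<^sup>2) = (cmod \<mu>)\<^sup>2 * (a r)\<^sup>2 + 4 * (b r)\<^sup>2"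
        unfolding bb unfolding defs m by algebra
      show "r * (N' r * D r - N r * D' r) = - ((cmod \<mu>)\<^sup>2 * (a r)\<^sup>2 + 4 * (b r)\<^sup>2)"
        unfolding bb unfolding defs m by algebra
    qed
  qed
  then show ?thesis by (simp add: defs)
qed

section \<open>Approximation by smooth profiles\<close>

text \<open>The Cauchy-Schwarz inequality, read off from the nonnegative integral of the squared
  distance between \<open>h\<close> and its mean \<open>m\<close>.\<close>

lemma norm_integral_sq_le:
  fixes h :: "real \<Rightarrow> 'a::euclidean_space"
  assumes h: "continuous_on {a..b} h" and ab: "a \<le> b"
  shows "(norm (integral {a..b} h))\<^sup>2 \<le> (b - a) * integral {a..b} (\<lambda>t. (norm (h t))\<^sup>2)"
proof (cases "a = b")
  case False
  with ab have l: "b - a > 0" by simp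
  define I m where "I = integral {a..b} h" and "m = I /\<^sub>R (b - a)"
  have i: "(\<lambda>t. (norm (h t))\<^sup>2) integrable_on {a..b}" "h integrable_on {a..b}"
    by (intro integrable_continuous_real continuous_intros h)+
  have im: "((\<lambda>t. m \<bullet> h t) has_integral m \<bullet> I) {a..b}"
    using has_integral_linear[OF integrable_integral[OF i(2)] bounded_linear_inner_right[of m]] by (simp add: I_def o_def)
  have "((\<lambda>t. (norm (h t))\<^sup>2 - 2 * (m \<bullet> h t) + (norm m)\<^sup>2) has_integral
      integral {a..b} (\<lambda>t. (norm (h t))\<^sup>2) - 2 * (m \<bullet> I) + (b - a) * (norm m)\<^sup>2) {a..b}"
    using ab has_integral_const_real[of "(norm m)\<^sup>2" a b]
    by (intro has_integral_add has_integral_diff has_integral_mult_right im integrable_integral[OF i(1)]) simp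
  moreover have "0 \<le> (norm (h t))\<^sup>2 - 2 * (m \<bullet> h t) + (norm m)\<^sup>2" for t
  proof -
    have "(norm (h t))\<^sup>2 - 2 * (m \<bullet> h t) + (norm m)\<^sup>2 = (norm (h t - m))\<^sup>2"
      unfolding power2_norm_eq_inner by (simp add: inner_diff_left inner_diff_right inner_commute)
    then show ?thesis by simp
  qed
  ultimately have "0 \<le> integral {a..b} (\<lambda>t. (norm (h t))\<^sup>2) - 2 * (m \<bullet> I) + (b - a) * (norm m)\<^sup>2"
    by (rule has_integral_nonneg)
  also have "m \<bullet> I = (norm I)\<^sup>2 / (b - a)" by (simp add: m_def power2_norm_eq_inner divide_inverse_commute)
  also have "(b - a) * (norm m)\<^sup>2 = (norm I)\<^sup>2 / (b - a)"
  proof -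
    have "L * (norm (I /\<^sub>R L))\<^sup>2 = (norm I)\<^sup>2 / L" if "L > 0" for L :: real
      using that by (simp add: power_mult_distrib power_inverse field_simps power2_eq_square)
    then show ?thesis using l by (simp add: m_def)
  qed
  finally have "(norm I)\<^sup>2 / (b - a) \<le> integral {a..b} (\<lambda>t. (norm (h t))\<^sup>2)" by simp
  then show ?thesis using l by (simp add: I_def pos_divide_le_eq mult.commute)
qed simp

text \<open>A bound on the derivative in \<open>L\<^sup>2\<close> makes the family equicontinuous, so that \<open>L\<^sup>2\<close> closeness
  improves to uniform closeness.\<close>

lemma L2_close_imp_uniformly_close:
  fixes f :: "real \<Rightarrow> 'a::euclidean_space"
  assumes f: "continuous_on {a..b} f" and ab: "a < b" and C: "C \<ge> 0" and \<eta>: "\<eta> > 0"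
  obtains e where "e > 0" "\<And>g g' r. (\<And>r. r \<in> {a..b} \<Longrightarrow> (g has_vector_derivative g' r) (at r within {a..b})) \<Longrightarrow>
    continuous_on {a..b} g' \<Longrightarrow> integral {a..b} (\<lambda>r. (norm (g' r))\<^sup>2) \<le> C \<Longrightarrow>
    integral {a..b} (\<lambda>r. (norm (g r - f r))\<^sup>2) \<le> e \<Longrightarrow> r \<in> {a..b} \<Longrightarrow> norm (g r - f r) \<le> \<eta>"
proof -
  have "uniformly_continuous_on {a..b} f" using f by (intro compact_uniformly_continuous compact_Icc)
  then obtain d where d: "d > 0" "\<And>r s. r \<in> {a..b} \<Longrightarrow> s \<in> {a..b} \<Longrightarrow> \<bar>r - s\<bar> < d \<Longrightarrow> norm (f r - f s) < \<eta> / 3"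
    unfolding uniformly_continuous_on_def dist_norm real_norm_def using \<eta> by (metis divide_pos_pos zero_less_numeral)
  \<comment> \<open>\<open>\<delta>\<close> is the length of a window around \<open>r\<close>:
    \<open>f\<close> varies on it by less than \<open>\<eta> / 3\<close>, it fits into
    \<open>[a, b]\<close> on one side of \<open>r\<close>, and the derivative bound lets
    \<open>g\<close> vary by at most \<open>\<eta> / 3\<close>.\<close>
  define \<delta> where "\<delta> = Min {d / 2, (b - a) / 2, \<eta>\<^sup>2 / (9 * (C + 1))}"
  have \<delta>: "\<delta> > 0" "\<delta> < d" "2 * \<delta> \<le> b - a" "\<delta> * C \<le> \<eta>\<^sup>2 / 9"
  proof -
    show "\<delta> > 0" "\<delta> < d" using d(1) ab \<eta> C by (auto simp: \<delta>_def)
    have "\<delta> \<le> (b - a) / 2" unfolding \<delta>_def by (rule Min_le) auto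
    then show "2 * \<delta> \<le> b - a" by simp
    have "\<delta> * C \<le> \<eta>\<^sup>2 / (9 * (C + 1)) * C" using C by (intro mult_right_mono) (auto simp: \<delta>_def)
    also have "\<dots> \<le> \<eta>\<^sup>2 / 9" using C by (simp add: field_simps)
    finally show "\<delta> * C \<le> \<eta>\<^sup>2 / 9" .
  qed
  show thesis
  \<comment> \<open>With this value the three squared errors contribute
    \<open>\<eta>\<^sup>2 / 9\<close> each on average over the window, and the factor 3 of the
    three-term inequality brings the sum to \<open>\<eta>\<^sup>2\<close>.\<close>
  proof (rule that[of "\<delta> * \<eta>\<^sup>2 / 9"])
    show "\<delta> * \<eta>\<^sup>2 / 9 > 0" using \<delta> \<eta> by simp
    fix g g' :: "real \<Rightarrow> 'a" and r
    assume g: "\<And>r. r \<in> {a..b} \<Longrightarrow> (g has_vector_derivative g' r) (at r within {a..b})"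
      and g': "continuous_on {a..b} g'" "integral {a..b} (\<lambda>r. (norm (g' r))\<^sup>2) \<le> C"
      and gf: "integral {a..b} (\<lambda>r. (norm (g r - f r))\<^sup>2) \<le> \<delta> * \<eta>\<^sup>2 / 9" and r: "r \<in> {a..b}"
    define l where "l = (if r + \<delta> \<le> b then r else r - \<delta>)"
    have l: "a \<le> l" "l + \<delta> \<le> b" "\<And>s. s \<in> {l..l + \<delta>} \<Longrightarrow> \<bar>r - s\<bar> \<le> \<delta>"
      using \<delta> r by (auto simp: l_def abs_le_iff split: if_splits)
    have gc: "continuous_on {a..b} g" using g by (rule continuous_on_vector_derivative)
    have gg: "(norm (g y - g x))\<^sup>2 \<le> (y - x) * C" if xy: "a \<le> x" "x \<le> y" "y \<le> b" for x y
    proof -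
      have "(g' has_integral (g y - g x)) {x..y}"
      proof (rule fundamental_theorem_of_calculus[OF xy(2)])
        show "(g has_vector_derivative g' t) (at t within {x..y})" if "t \<in> {x..y}" for t
          using g[of t] that xy by (auto intro: has_vector_derivative_within_subset)
      qed
      then have "(norm (g y - g x))\<^sup>2 = (norm (integral {x..y} g'))\<^sup>2" by (simp add: integral_unique)
      also have "\<dots> \<le> (y - x) * integral {x..y} (\<lambda>r. (norm (g' r))\<^sup>2)"
        using xy by (intro norm_integral_sq_le continuous_on_subset[OF g'(1)]) auto
      also have "\<dots> \<le> (y - x) * C"
      proof (rule mult_left_mono)
        have "integral {x..y} (\<lambda>r. (norm (g' r))\<^sup>2) \<le> integral {a..b} (\<lambda>r. (norm (g' r))\<^sup>2)"
          using xy by (intro integral_subset_le integrable_continuous_real continuous_intros continuous_on_subset[OF g'(1)]) auto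
        with g'(2) show "integral {x..y} (\<lambda>r. (norm (g' r))\<^sup>2) \<le> C" by linarith
      qed (use xy in simp)
      finally show ?thesis .
    qed
    have pt: "(norm (g r - f r))\<^sup>2 \<le> 3 * (2 * \<eta>\<^sup>2 / 9 + (norm (g s - f s))\<^sup>2)" if s: "s \<in> {l..l + \<delta>}" for s
    proof -
      have sab: "s \<in> {a..b}" using s l by auto
      have "(norm (g r - g s))\<^sup>2 \<le> \<bar>r - s\<bar> * C"
        using gg[of s r] gg[of r s] r sab by (cases "s \<le> r") (auto simp: norm_minus_commute abs_if)
      also have "\<dots> \<le> \<delta> * C" using l(3)[OF s] C by (intro mult_right_mono) auto
      finally have 1: "(norm (g r - g s))\<^sup>2 \<le> \<eta>\<^sup>2 / 9" using \<delta>(4) by linarith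
      have "norm (f r - f s) < \<eta> / 3" using l(3)[OF s] \<delta>(2) r sab by (intro d(2)) auto
      then have "(norm (f r - f s))\<^sup>2 \<le> (\<eta> / 3)\<^sup>2" by (intro power_mono) auto
      then have 2: "(norm (f r - f s))\<^sup>2 \<le> \<eta>\<^sup>2 / 9" by (simp add: power_divide)
      have sq: "(x + y + z)\<^sup>2 \<le> 3 * (x\<^sup>2 + y\<^sup>2 + z\<^sup>2)" for x y z :: real
      proof -
        have "0 \<le> (x - y)\<^sup>2 + (y - z)\<^sup>2 + (x - z)\<^sup>2" by simp
        then show ?thesis by (simp add: power2_eq_square algebra_simps)
      qed
      have "norm (g r - f r) \<le> norm (g r - f s) + norm (f r - f s)"
        using norm_triangle_ineq[of "g r - f s" "f s - f r"] by (simp add: norm_minus_commute)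
      moreover have "norm (g r - f s) \<le> norm (g r - g s) + norm (g s - f s)"
        using norm_triangle_ineq[of "g r - g s" "g s - f s"] by simp
      ultimately have "norm (g r - f r) \<le> norm (g r - g s) + norm (g s - f s) + norm (f r - f s)" by linarith
      then have "(norm (g r - f r))\<^sup>2 \<le> (norm (g r - g s) + norm (g s - f s) + norm (f r - f s))\<^sup>2"
        by (intro power_mono) auto
      also have "\<dots> \<le> 3 * ((norm (g r - g s))\<^sup>2 + (norm (g s - f s))\<^sup>2 + (norm (f r - f s))\<^sup>2)" by (rule sq)
      finally show ?thesis using 1 2 by simp
    qed
    have gfi: "(\<lambda>s. (norm (g s - f s))\<^sup>2) integrable_on {x..y}" if "a \<le> x" "y \<le> b" for x y
      using that by (intro integrable_continuous_real continuous_intros continuous_on_subset[OF gc] continuous_on_subset[OF f]) auto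
    have "\<delta> * (norm (g r - f r))\<^sup>2 = integral {l..l + \<delta>} (\<lambda>s. (norm (g r - f r))\<^sup>2)" using \<delta> by simp
    also have "\<dots> \<le> integral {l..l + \<delta>} (\<lambda>s. 3 * (2 * \<eta>\<^sup>2 / 9 + (norm (g s - f s))\<^sup>2))"
      using pt l by (intro integral_le integrable_on_mult_right integrable_add gfi) auto
    also have "\<dots> = 3 * integral {l..l + \<delta>} (\<lambda>s. 2 * \<eta>\<^sup>2 / 9 + (norm (g s - f s))\<^sup>2)"
      by (rule Henstock_Kurzweil_Integration.integral_mult_right)
    also have "integral {l..l + \<delta>} (\<lambda>s. 2 * \<eta>\<^sup>2 / 9 + (norm (g s - f s))\<^sup>2) =
        integral {l..l + \<delta>} (\<lambda>s. 2 * \<eta>\<^sup>2 / 9) + integral {l..l + \<delta>} (\<lambda>s. (norm (g s - f s))\<^sup>2)"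
      using l by (intro Henstock_Kurzweil_Integration.integral_add gfi) auto
    also have "integral {l..l + \<delta>} (\<lambda>s. 2 * \<eta>\<^sup>2 / 9) = \<delta> * (2 * \<eta>\<^sup>2 / 9)" using \<delta> by simp
    also have "integral {l..l + \<delta>} (\<lambda>s. (norm (g s - f s))\<^sup>2) \<le> integral {a..b} (\<lambda>s. (norm (g s - f s))\<^sup>2)"
      using l \<delta> by (intro integral_subset_le gfi) auto
    also note gf
    finally have "\<delta> * (norm (g r - f r))\<^sup>2 \<le> \<delta> * \<eta>\<^sup>2" by (simp add: algebra_simps)
    then have "(norm (g r - f r))\<^sup>2 \<le> \<eta>\<^sup>2" using \<delta>(1) by simp
    then show "norm (g r - f r) \<le> \<eta>" using \<eta> by (simp add: power2_le_iff_abs_le)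
  qed
qed

text \<open>Differentiating the normalized curve projects \<open>g'\<close> onto the tangent space
  and divides by the norm. The projection does not lengthen, and the angular energy is homogeneous
  of degree 2.\<close>

lemma normalized_curve:
  fixes g :: "real \<Rightarrow> R5"
  assumes g: "\<And>r. r \<in> {a..b} \<Longrightarrow> (g has_vector_derivative g' r) (at r within {a..b})"
    and c: "continuous_on {a..b} g'" and a: "0 < a" and nz: "\<And>r. r \<in> {a..b} \<Longrightarrow> g r \<noteq> 0"
  obtains h h' where "\<And>r. h r = g r /\<^sub>R norm (g r)"
    "\<And>r. r \<in> {a..b} \<Longrightarrow> (h has_vector_derivative h' r) (at r within {a..b})" "continuous_on {a..b} h'"
    "\<And>r. r \<in> {a..b} \<Longrightarrow> (norm (g r))\<^sup>2 * radial_energy h h' r \<le> radial_energy g g' r"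
proof -
  define h where "h r = g r /\<^sub>R norm (g r)" for r
  define h' where "h' r = (g' r - (h r \<bullet> g' r) *\<^sub>R h r) /\<^sub>R norm (g r)" for r
  have gc: "continuous_on {a..b} g" using g by (rule continuous_on_vector_derivative)
  have hc: "continuous_on {a..b} h" unfolding h_def using nz by (intro continuous_intros gc) auto
  show thesis
  proof (rule that[of h h'])
    show "h r = g r /\<^sub>R norm (g r)" for r by (simp add: h_def)
    show "continuous_on {a..b} h'" unfolding h'_def using nz by (intro continuous_intros gc hc c) auto
    fix r assume r: "r \<in> {a..b}"
    define n where "n = norm (g r)"
    have n: "n > 0" using nz[OF r] by (simp add: n_def)
    have gh: "g r = n *\<^sub>R h r" using n by (simp add: h_def n_def)
    have hh: "h r \<bullet> h r = 1" using n by (simp add: h_def n_def power2_norm_eq_inner[symmetric] power2_eq_square)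
    have "((\<lambda>r. norm (g r)) has_real_derivative h r \<bullet> g' r) (at r within {a..b})"
    proof -
      have "((\<lambda>r. sqrt ((norm (g r))\<^sup>2)) has_real_derivative inverse (sqrt ((norm (g r))\<^sup>2)) / 2 * (2 * (g r \<bullet> g' r))) (at r within {a..b})"
        by (rule DERIV_chain2[OF DERIV_real_sqrt has_real_derivative_norm_sq[OF g[OF r]]]) (use nz[OF r] in simp)
      moreover have "inverse n / 2 * (2 * (g r \<bullet> g' r)) = h r \<bullet> g' r" using n by (subst gh) simp
      ultimately show ?thesis using n by (simp add: n_def[symmetric])
    qed
    then have "((\<lambda>r. inverse (norm (g r))) has_real_derivative - (inverse n * (h r \<bullet> g' r) * inverse n)) (at r within {a..b})"
      unfolding n_def using nz[OF r] by (intro DERIV_inverse') auto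
    from has_vector_derivative_scaleR[OF this g[OF r]]
    have "(h has_vector_derivative inverse n *\<^sub>R g' r + (- (inverse n * (h r \<bullet> g' r) * inverse n)) *\<^sub>R g r) (at r within {a..b})"
      by (simp add: h_def[abs_def] n_def)
    moreover have "inverse n *\<^sub>R g' r + (- (inverse n * (h r \<bullet> g' r) * inverse n)) *\<^sub>R g r = h' r"
      unfolding h'_def n_def[symmetric] using n by (subst gh) (simp add: scaleR_diff_right)
    ultimately show "(h has_vector_derivative h' r) (at r within {a..b})" by simp
    have "n\<^sup>2 * (norm (h' r))\<^sup>2 = (norm (g' r - (h r \<bullet> g' r) *\<^sub>R h r))\<^sup>2"
      using n by (simp add: h'_def n_def[symmetric] power_mult_distrib power_inverse)
    also have "\<dots> = (norm (g' r))\<^sup>2 - (h r \<bullet> g' r)\<^sup>2"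
    proof -
      have "(norm (x - k *\<^sub>R y))\<^sup>2 = (norm x)\<^sup>2 - k * (x \<bullet> y) - k * (y \<bullet> x) + k * k * (y \<bullet> y)" for x y :: R5 and k
        unfolding power2_norm_eq_inner inner_diff_left inner_diff_right inner_scaleR_left inner_scaleR_right by algebra
      from this[of "g' r" "h r \<bullet> g' r" "h r"] show ?thesis
        by (simp add: hh inner_commute[of "g' r" "h r"] power2_eq_square)
    qed
    also have "\<dots> \<le> (norm (g' r))\<^sup>2" by simp
    finally have 1: "n\<^sup>2 * (norm (h' r))\<^sup>2 \<le> (norm (g' r))\<^sup>2" .
    have 2: "angular_energy (g r) = n\<^sup>2 * angular_energy (h r)"
      by (subst gh) (simp add: angular_energy_def power_mult_distrib algebra_simps)
    have "n\<^sup>2 * radial_energy h h' r = r * (n\<^sup>2 * (norm (h' r))\<^sup>2) + n\<^sup>2 * angular_energy (h r) / r"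
      by (simp add: radial_energy_def algebra_simps)
    also have "\<dots> \<le> radial_energy g g' r"
      unfolding radial_energy_def 2 using 1 r a by (intro add_mono mult_left_mono) auto
    finally show "(norm (g r))\<^sup>2 * radial_energy h h' r \<le> radial_energy g g' r" by (simp add: n_def)
  qed
qed

text \<open>The profile of the projection of \<open>v\<close> onto the equivariant maps: if
  \<open>v\<close> is equivariant, then the integrand is constantly the value of \<open>v\<close> at
  \<open>r\<close>.\<close>

definition circle_avg :: "(complex \<Rightarrow> R5) \<Rightarrow> real \<Rightarrow> R5" where
  "circle_avg v r = (1 / (2 * pi)) *\<^sub>R integral {0..2 * pi} (\<lambda>t. rot_action (- t) (v (of_real r * cis t)))"

definition circle_avg_deriv :: "(complex \<Rightarrow> R5) \<Rightarrow> real \<Rightarrow> R5" where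
  "circle_avg_deriv v r = (1 / (2 * pi)) *\<^sub>R
     integral {0..2 * pi} (\<lambda>t. rot_action (- t) (partial_deriv (cis t) v (of_real r * cis t)))"

text \<open>Jensen's inequality for the mean over the circle; the rotations are isometries and drop
  out of the norm.\<close>

lemma norm_circle_avg_sq_le:
  fixes h :: "real \<Rightarrow> R5"
  assumes "continuous_on {0..2 * pi} h"
  shows "(norm ((1 / (2 * pi)) *\<^sub>R integral {0..2 * pi} (\<lambda>t. rot_action (- t) (h t))))\<^sup>2
    \<le> (1 / (2 * pi)) * integral {0..2 * pi} (\<lambda>t. (norm (h t))\<^sup>2)"
proof -
  have "(norm (integral {0..2 * pi} (\<lambda>t. rot_action (- t) (h t))))\<^sup>2
      \<le> (2 * pi - 0) * integral {0..2 * pi} (\<lambda>t. (norm (rot_action (- t) (h t)))\<^sup>2)"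
    by (intro norm_integral_sq_le continuous_on_rot_action continuous_intros assms) simp
  then have "(1 / (2 * pi))\<^sup>2 * (norm (integral {0..2 * pi} (\<lambda>t. rot_action (- t) (h t))))\<^sup>2
      \<le> (1 / (2 * pi))\<^sup>2 * (2 * pi * integral {0..2 * pi} (\<lambda>t. (norm (h t))\<^sup>2))"
    by (intro mult_left_mono) auto
  then show ?thesis by (simp add: power_mult_distrib power2_eq_square)
qed

lemma continuous_on_partial_deriv:
  fixes v :: "complex \<Rightarrow> 'b::euclidean_space"
  assumes v: "C_diff (Suc 0) v" and "continuous_on S h" "continuous_on S z"
  shows "continuous_on S (\<lambda>x. partial_deriv (h x) v (z x))"
proof -
  have d: "v differentiable (at z)" for z using v by simp
  have c: "continuous_on UNIV (partial_deriv 1 v)" "continuous_on UNIV (partial_deriv \<i> v)"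
    using v by (auto simp: Basis_complex_def)
  show ?thesis
    unfolding partial_deriv_complex[OF d, of "h _"]
    by (intro continuous_intros assms continuous_on_compose2[OF c(1)] continuous_on_compose2[OF c(2)]) auto
qed

lemma circle_avg_has_derivative:
  assumes v: "C_diff (Suc 0) v"
  shows "(circle_avg v has_vector_derivative circle_avg_deriv v r) (at r)"
proof -
  have d: "v differentiable (at z)" for z using v by simp
  have vc: "continuous_on UNIV v" by (rule C_diff_imp_continuous[OF v])
  have "((\<lambda>r. integral (cbox 0 (2 * pi)) (\<lambda>t. rot_action (- t) (v (of_real r * cis t)))) has_vector_derivative
      integral (cbox 0 (2 * pi)) (\<lambda>t. rot_action (- t) (partial_deriv (cis t) v (of_real r * cis t)))) (at r within UNIV)"
  proof (rule leibniz_rule_vector_derivative[where U=UNIV])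
    show "((\<lambda>r. rot_action (- t) (v (of_real r * cis t))) has_vector_derivative
        rot_action (- t) (partial_deriv (cis t) v (of_real r * cis t))) (at r within UNIV)" for r t
      by (rule bounded_linear.has_vector_derivative[OF bounded_linear_rot_action radial_derivative[OF d]])
    show "(\<lambda>t. rot_action (- t) (v (of_real r * cis t))) integrable_on cbox 0 (2 * pi)" for r
      by (intro integrable_continuous continuous_on_rot_action continuous_intros continuous_on_compose2[OF vc]) auto
    have "continuous_on (UNIV \<times> cbox 0 (2 * pi)) (\<lambda>x. rot_action (- snd x) (partial_deriv (cis (snd x)) v (of_real (fst x) * cis (snd x))))"
      by (intro continuous_on_rot_action continuous_on_partial_deriv[OF v] continuous_intros)
    then show "continuous_on (UNIV \<times> cbox 0 (2 * pi)) (\<lambda>(r, t). rot_action (- t) (partial_deriv (cis t) v (of_real r * cis t)))"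
      by (simp add: split_beta)
  qed auto
  from bounded_linear.has_vector_derivative[OF bounded_linear_scaleR_right this]
  show ?thesis by (simp add: circle_avg_def[abs_def] circle_avg_deriv_def)
qed

lemma continuous_on_circle_avg_deriv:
  assumes v: "C_diff (Suc 0) v"
  shows "continuous_on S (circle_avg_deriv v)"
proof -
  have "continuous_on (S \<times> cbox 0 (2 * pi)) (\<lambda>x. rot_action (- snd x) (partial_deriv (cis (snd x)) v (of_real (fst x) * cis (snd x))))"
    by (intro continuous_on_rot_action continuous_on_partial_deriv[OF v] continuous_intros)
  then have "continuous_on (S \<times> cbox 0 (2 * pi)) (\<lambda>(r, t). rot_action (- t) (partial_deriv (cis t) v (of_real r * cis t)))"
    by (simp add: split_beta)
  from integral_continuous_on_param[OF this] show ?thesis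
    unfolding circle_avg_deriv_def[abs_def] by (intro continuous_intros) simp
qed

lemma bounded_linear_rot_generator: "bounded_linear rot_generator"
  unfolding rot_generator_def[abs_def]
  by (intro bounded_linear_Pair bounded_linear_zero
      bounded_linear_compose[OF bounded_linear_mult_right bounded_linear_compose[OF bounded_linear_fst bounded_linear_snd]]
      bounded_linear_compose[OF bounded_linear_mult_right bounded_linear_compose[OF bounded_linear_snd bounded_linear_snd]])

text \<open>Integrating \<open>d/dt (rot (- t) v)\<close> over a period trades the generator of the rotations for the
  angular derivative.\<close>

lemma rot_generator_circle_avg:
  assumes v: "C_diff (Suc 0) v"
  shows "rot_generator (circle_avg v r) = (1 / (2 * pi)) *\<^sub>R
    integral {0..2 * pi} (\<lambda>t. rot_action (- t) (r *\<^sub>R partial_deriv (\<i> * cis t) v (of_real r * cis t)))"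
proof -
  have d: "v differentiable (at z)" for z using v by simp
  have vc: "continuous_on UNIV v" by (rule C_diff_imp_continuous[OF v])
  let ?g = "\<lambda>t. v (of_real r * cis t)" and ?g' = "\<lambda>t. r *\<^sub>R partial_deriv (\<i> * cis t) v (of_real r * cis t)"
  have gc: "continuous_on {0..2 * pi} ?g" by (intro continuous_intros continuous_on_compose2[OF vc]) auto
  have g'c: "continuous_on {0..2 * pi} ?g'" by (intro continuous_intros continuous_on_partial_deriv[OF v])
  have i: "(\<lambda>t. rot_action (- t) (?g t)) integrable_on {0..2 * pi}" "(\<lambda>t. rot_action (- t) (?g' t)) integrable_on {0..2 * pi}"
    by (intro integrable_continuous_real continuous_on_rot_action continuous_intros gc g'c)+
  have comm: "rot_action a (rot_generator p) = rot_generator (rot_action a p)" for a p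
    by (simp add: rot_action_eq rot_generator_def mult_ac)
  have gi: "((\<lambda>t. rot_generator (rot_action (- t) (?g t))) has_integral rot_generator (integral {0..2 * pi} (\<lambda>t. rot_action (- t) (?g t)))) {0..2 * pi}"
    using has_integral_linear[OF integrable_integral[OF i(1)] bounded_linear_rot_generator] by (simp add: o_def)
  have "((\<lambda>t. rot_action (- 1 * t) (?g' t + (- 1) *\<^sub>R rot_generator (?g t))) has_integral
      (rot_action (- 1 * (2 * pi)) (?g (2 * pi)) - rot_action (- 1 * 0) (?g 0))) {0..2 * pi}"
    by (intro fundamental_theorem_of_calculus has_vector_derivative_rot_action angular_derivative d) simp
  moreover have "cis (- (2 * pi)) = 1" "cis (- (4 * pi)) = 1" by (simp_all add: complex_eq_iff cos_minus sin_minus)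
  moreover have "rot_action a (x + (- 1) *\<^sub>R rot_generator y) = rot_action a x - rot_generator (rot_action a y)" for a x y
    using linear_diff[OF bounded_linear.linear[OF bounded_linear_rot_action]] by (simp add: comm)
  ultimately have "((\<lambda>t. rot_action (- t) (?g' t) - rot_generator (rot_action (- t) (?g t))) has_integral 0) {0..2 * pi}"
    by (simp add: rot_action_eq[of "- (2 * pi)"])
  from has_integral_add[OF this gi]
  have "((\<lambda>t. rot_action (- t) (?g' t)) has_integral rot_generator (integral {0..2 * pi} (\<lambda>t. rot_action (- t) (?g t)))) {0..2 * pi}"
    by simp
  then have "integral {0..2 * pi} (\<lambda>t. rot_action (- t) (?g' t)) = rot_generator (integral {0..2 * pi} (\<lambda>t. rot_action (- t) (?g t)))"
    by (rule integral_unique)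
  then show ?thesis
    by (simp add: circle_avg_def linear_scale[OF bounded_linear.linear[OF bounded_linear_rot_generator]])
qed

text \<open>Averaging does not increase the energy: the radial derivative and the generator of the
  averaged map are themselves averages, of the radial and the angular derivative of
  \<open>v\<close>, and Jensen's inequality applies to each.\<close>

lemma radial_energy_circle_avg_le:
  assumes v: "C_diff (Suc 0) v" and r: "r > 0"
  shows "radial_energy (circle_avg v) (circle_avg_deriv v) r
    \<le> (1 / (2 * pi)) * (r * integral {0..2 * pi} (\<lambda>t. grad_sq v (of_real r * cis t)))"
proof -
  have d: "v differentiable (at z)" for z using v by simp
  let ?A = "\<lambda>t. partial_deriv (cis t) v (of_real r * cis t)" and ?B = "\<lambda>t. partial_deriv (\<i> * cis t) v (of_real r * cis t)"
  have c: "continuous_on {0..2 * pi} ?A" "continuous_on {0..2 * pi} ?B"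
    by (intro continuous_intros continuous_on_partial_deriv[OF v])+
  have 1: "(norm (circle_avg_deriv v r))\<^sup>2 \<le> (1 / (2 * pi)) * integral {0..2 * pi} (\<lambda>t. (norm (?A t))\<^sup>2)"
    unfolding circle_avg_deriv_def by (rule norm_circle_avg_sq_le[OF c(1)])
  have "angular_energy (circle_avg v r) \<le> (1 / (2 * pi)) * integral {0..2 * pi} (\<lambda>t. (norm (r *\<^sub>R ?B t))\<^sup>2)"
    unfolding norm_rot_generator[symmetric] rot_generator_circle_avg[OF v]
    by (intro norm_circle_avg_sq_le continuous_intros c)
  also have "\<dots> = r\<^sup>2 * ((1 / (2 * pi)) * integral {0..2 * pi} (\<lambda>t. (norm (?B t))\<^sup>2))"
    by (simp add: power_mult_distrib)
  finally have 2: "angular_energy (circle_avg v r) / r \<le> r * ((1 / (2 * pi)) * integral {0..2 * pi} (\<lambda>t. (norm (?B t))\<^sup>2))"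
    using r by (simp add: pos_divide_le_eq power2_eq_square mult_ac)
  have "integral {0..2 * pi} (\<lambda>t. grad_sq v (of_real r * cis t)) = integral {0..2 * pi} (\<lambda>t. (norm (?A t))\<^sup>2 + (norm (?B t))\<^sup>2)"
    by (simp add: grad_sq_polar[OF d])
  also have "\<dots> = integral {0..2 * pi} (\<lambda>t. (norm (?A t))\<^sup>2) + integral {0..2 * pi} (\<lambda>t. (norm (?B t))\<^sup>2)"
    by (intro Henstock_Kurzweil_Integration.integral_add integrable_continuous_real continuous_intros c)
  finally have "(1 / (2 * pi)) * (r * integral {0..2 * pi} (\<lambda>t. grad_sq v (of_real r * cis t))) =
      r * ((1 / (2 * pi)) * integral {0..2 * pi} (\<lambda>t. (norm (?A t))\<^sup>2)) + r * ((1 / (2 * pi)) * integral {0..2 * pi} (\<lambda>t. (norm (?B t))\<^sup>2))"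
    by (simp add: algebra_simps)
  moreover have "r * (norm (circle_avg_deriv v r))\<^sup>2 \<le> r * ((1 / (2 * pi)) * integral {0..2 * pi} (\<lambda>t. (norm (?A t))\<^sup>2))"
    using 1 r by (intro mult_left_mono) auto
  ultimately show ?thesis unfolding radial_energy_def using 2 by linarith
qed

lemma disc_integral_ge_annulus:
  fixes G :: "complex \<Rightarrow> real"
  assumes G: "continuous_on (cball 0 1) G" and n: "\<And>z. z \<in> cball 0 1 \<Longrightarrow> 0 \<le> G z" and e: "0 \<le> \<epsilon>" "\<epsilon> \<le> 1"
    and h: "continuous_on {\<epsilon>..1} h" "\<And>r. r \<in> {\<epsilon>..1} \<Longrightarrow> h r \<le> r * integral {0..2 * pi} (\<lambda>t. G (of_real r * cis t))"
  shows "integral {\<epsilon>..1} h \<le> (LINT z|lebesgue_on unit_disc. G z)"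
proof -
  let ?I = "\<lambda>r. r * integral {0..2 * pi} (\<lambda>t. G (of_real r * cis t))"
  have "continuous_on ({0..1} \<times> cbox 0 (2 * pi)) (\<lambda>x. G (of_real (fst x) * cis (snd x)))"
    by (rule continuous_on_compose2[OF G]) (auto intro!: continuous_intros simp: norm_mult)
  then have "continuous_on ({0..1} \<times> cbox 0 (2 * pi)) (\<lambda>(r, t). G (of_real r * cis t))" by (simp add: split_beta)
  from integral_continuous_on_param[OF this] have Ic: "continuous_on {0..1} ?I"
    by (intro continuous_intros) simp
  have nn: "0 \<le> ?I r" if "r \<in> {0..1}" for r
  proof -
    have "continuous_on {0..2 * pi} (\<lambda>t. G (of_real r * cis t))"
      using that by (intro continuous_on_compose2[OF G] continuous_intros) (auto simp: norm_mult)
    then show ?thesis using that n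
      by (intro mult_nonneg_nonneg integral_nonneg integrable_continuous_real) (auto simp: norm_mult)
  qed
  have Ii: "?I integrable_on {\<epsilon>..1}" using e by (intro integrable_continuous_real continuous_on_subset[OF Ic]) auto
  have "integral {\<epsilon>..1} h \<le> integral {\<epsilon>..1} ?I"
    using h by (intro integral_le integrable_continuous_real[OF h(1)] Ii) auto
  also have "\<dots> \<le> integral {0..1} ?I"
    using e nn by (intro integral_subset_le Ii integrable_continuous_real[OF Ic]) auto
  also have "\<dots> = (LINT z|lebesgue_on unit_disc. G z)" by (rule disc_integral_polar[OF G, symmetric])
  finally show ?thesis .
qed

section \<open>From Sobolev maps to their smooth approximations\<close>

lemma continuous_AE_eq:
  fixes F G :: "complex \<Rightarrow> 'b::euclidean_space"
  assumes c: "continuous_on unit_disc F" "continuous_on unit_disc G"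
    and eq: "AE z in lebesgue_on unit_disc. F z = G z" and z: "z \<in> unit_disc"
  shows "F z = G z"
proof (rule ccontr)
  assume "F z \<noteq> G z"
  define S where "S = unit_disc \<inter> (\<lambda>z. F z - G z) -` (- {0})"
  have "open S" unfolding S_def
    by (intro continuous_open_preimage continuous_intros c open_ball open_Compl closed_singleton)
  moreover have "S \<noteq> {}" using z \<open>F z \<noteq> G z\<close> by (auto simp: S_def)
  moreover have "negligible {z \<in> unit_disc. \<not> F z = G z}"
    using eq disc_sets_lebesgue by (simp only: AE_lebesgue_on_iff_negligible)
  then have "negligible S" by (rule negligible_subset) (auto simp: S_def)
  ultimately show False using open_not_negligible by blast
qed

lemma square_integrable_diff:
  fixes f g :: "'a::euclidean_space \<Rightarrow> 'b::euclidean_space"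
  assumes "square_integrable U f" "square_integrable U g"
  shows "square_integrable U (\<lambda>x. f x - g x)"
proof -
  have [measurable]: "f \<in> borel_measurable (lebesgue_on U)" "g \<in> borel_measurable (lebesgue_on U)"
    using assms by (auto simp: square_integrable_def)
  have "integrable (lebesgue_on U) (\<lambda>x. (norm (f x - g x))\<^sup>2)"
  proof (rule Bochner_Integration.integrable_bound[where f="\<lambda>x. 2 * (norm (f x))\<^sup>2 + 2 * (norm (g x))\<^sup>2"])
    show "integrable (lebesgue_on U) (\<lambda>x. 2 * (norm (f x))\<^sup>2 + 2 * (norm (g x))\<^sup>2)"
      using assms by (auto simp: square_integrable_def)
    have "(norm (a - b))\<^sup>2 \<le> 2 * (norm a)\<^sup>2 + 2 * (norm b)\<^sup>2" for a b :: 'b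
    proof -
      have "0 \<le> (norm (a + b))\<^sup>2" by simp
      then show ?thesis
        unfolding power2_norm_eq_inner by (simp add: inner_add_left inner_add_right inner_diff_left inner_diff_right inner_commute)
    qed
    then show "AE x in lebesgue_on U. norm ((norm (f x - g x))\<^sup>2) \<le> norm (2 * (norm (f x))\<^sup>2 + 2 * (norm (g x))\<^sup>2)"
      by (intro AE_I2) (simp add: order_trans[OF _ abs_ge_self])
    show "(\<lambda>x. (norm (f x - g x))\<^sup>2) \<in> borel_measurable (lebesgue_on U)" by measurable
  qed
  then show ?thesis by (simp add: square_integrable_def)
qed

lemma weak_partial_W12:
  assumes u: "u \<in> W12 unit_disc" and b: "b \<in> Basis"
  shows "has_weak_partial unit_disc b u (weak_partial unit_disc b u)"
    "square_integrable unit_disc (weak_partial unit_disc b u)"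
proof -
  obtain w where w: "has_weak_partial unit_disc b u w" "square_integrable unit_disc w"
    using u b unfolding W12_def by blast
  show "has_weak_partial unit_disc b u (weak_partial unit_disc b u)" by (rule has_weak_partial_weak_partial[OF w(1)])
  have "AE z in lebesgue_on unit_disc. w z = weak_partial unit_disc b u z"
    using weak_partial_AE_eq[OF w(1) open_ball b] by auto
  then show "square_integrable unit_disc (weak_partial unit_disc b u)"
    by (rule square_integrable_AE[OF w(2) disc_sets_lebesgue])
qed

lemma E0_nonneg: "0 \<le> E0 u"
  unfolding E0_def by (intro integral_nonneg_AE AE_I2) (simp add: sum_nonneg)

lemma W12_norm_sq:
  "(W12_norm U u)\<^sup>2 = (LINT x|lebesgue_on U. (norm (u x))\<^sup>2) + (\<Sum>b\<in>Basis. LINT x|lebesgue_on U. (norm (weak_partial U b u x))\<^sup>2)"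
  unfolding W12_norm_def by (intro real_sqrt_pow2 add_nonneg_nonneg sum_nonneg integral_nonneg_AE AE_I2) auto

text \<open>Young's inequality with weight \<open>\<kappa>\<close>, applied to each partial
  derivative. A small \<open>\<kappa>\<close> is fixed first; the distance then has to be small
  compared with it.\<close>

lemma energy_le_of_W12_close:
  fixes u v :: "complex \<Rightarrow> R5"
  assumes u: "u \<in> W12 unit_disc" and v: "C_diff (Suc 0) v" and \<kappa>: "\<kappa> > 0"
  shows "1 / 2 * (LINT z|lebesgue_on unit_disc. grad_sq v z)
    \<le> (1 + \<kappa>) * E0 u + (1 + 1 / \<kappa>) / 2 * (W12_norm unit_disc (\<lambda>z. v z - u z))\<^sup>2"
proof -
  let ?M = "lebesgue_on unit_disc"
  let ?A = "\<lambda>b. weak_partial unit_disc b u" and ?B = "\<lambda>b. partial_deriv b v"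
    and ?C = "\<lambda>b. weak_partial unit_disc b (\<lambda>z. v z - u z)"
  have sA: "square_integrable unit_disc (?A b)" if "b \<in> Basis" for b by (rule weak_partial_W12[OF u that])
  have sB: "square_integrable unit_disc (?B b)" if "b \<in> Basis" for b
    by (rule weak_partial_smooth_rep(3)[OF v _ that, of v]) simp
  have C: "AE z in ?M. ?C b z = ?B b z - ?A b z" if b: "b \<in> Basis" for b
    by (intro weak_partial_AE_eq has_weak_partial_diff has_weak_partial_classical v b weak_partial_W12[OF u] open_ball disc_sets_lebesgue)
  have sC: "square_integrable unit_disc (?C b)" if b: "b \<in> Basis" for b
    by (rule square_integrable_AE[OF square_integrable_diff[OF sB[OF b] sA[OF b]] disc_sets_lebesgue])
      (use C[OF b] in auto)
  have le: "(LINT z|?M. (norm (?B b z))\<^sup>2) \<le> (1 + \<kappa>) * (LINT z|?M. (norm (?A b z))\<^sup>2) + (1 + 1 / \<kappa>) * (LINT z|?M. (norm (?C b z))\<^sup>2)"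
    if b: "b \<in> Basis" for b
  proof -
    have i: "integrable ?M (\<lambda>z. (norm (?A b z))\<^sup>2)" "integrable ?M (\<lambda>z. (norm (?B b z))\<^sup>2)" "integrable ?M (\<lambda>z. (norm (?C b z))\<^sup>2)"
      using sA[OF b] sB[OF b] sC[OF b] by (auto simp: square_integrable_def)
    have pt: "(norm y)\<^sup>2 \<le> (1 + \<kappa>) * (norm x)\<^sup>2 + (1 + 1 / \<kappa>) * (norm (y - x))\<^sup>2" for x y :: R5
    proof -
      have "y = x + (y - x)" by simp
      then have "norm y \<le> norm x + norm (y - x)" by (metis norm_triangle_ineq)
      then have "(norm y)\<^sup>2 \<le> (norm x + norm (y - x))\<^sup>2" by (intro power_mono) auto
      moreover have "(s + t)\<^sup>2 \<le> (1 + \<kappa>) * s\<^sup>2 + (1 + 1 / \<kappa>) * t\<^sup>2" for s t :: real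
      proof -
        have "0 \<le> (\<kappa> * s - t)\<^sup>2 / \<kappa>" using \<kappa> by simp
        also have "\<dots> = \<kappa> * s\<^sup>2 - 2 * s * t + t\<^sup>2 / \<kappa>" using \<kappa> by (simp add: field_simps power2_eq_square)
        finally show ?thesis by (simp add: power2_eq_square algebra_simps)
      qed
      ultimately show ?thesis using order_trans by blast
    qed
    have "(LINT z|?M. (norm (?B b z))\<^sup>2) \<le> (LINT z|?M. (1 + \<kappa>) * (norm (?A b z))\<^sup>2 + (1 + 1 / \<kappa>) * (norm (?C b z))\<^sup>2)"
    proof (rule integral_mono_AE)
      show "AE z in ?M. (norm (?B b z))\<^sup>2 \<le> (1 + \<kappa>) * (norm (?A b z))\<^sup>2 + (1 + 1 / \<kappa>) * (norm (?C b z))\<^sup>2"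
        using C[OF b] by eventually_elim (simp only: pt)
      show "integrable ?M (\<lambda>z. (norm (?B b z))\<^sup>2)" by (rule i(2))
      show "integrable ?M (\<lambda>z. (1 + \<kappa>) * (norm (?A b z))\<^sup>2 + (1 + 1 / \<kappa>) * (norm (?C b z))\<^sup>2)"
        by (intro Bochner_Integration.integrable_add integrable_mult_right i)
    qed
    also have "\<dots> = (1 + \<kappa>) * (LINT z|?M. (norm (?A b z))\<^sup>2) + (1 + 1 / \<kappa>) * (LINT z|?M. (norm (?C b z))\<^sup>2)"
      by (subst Bochner_Integration.integral_add) (use i in auto)
    finally show ?thesis .
  qed
  have "(LINT z|?M. grad_sq v z) = (\<Sum>b\<in>Basis. LINT z|?M. (norm (?B b z))\<^sup>2)"
    unfolding grad_sq_def by (rule Bochner_Integration.integral_sum) (use sB in \<open>auto simp: square_integrable_def\<close>)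
  also have "\<dots> \<le> (\<Sum>b\<in>Basis. (1 + \<kappa>) * (LINT z|?M. (norm (?A b z))\<^sup>2) + (1 + 1 / \<kappa>) * (LINT z|?M. (norm (?C b z))\<^sup>2))"
    by (rule sum_mono) (rule le)
  also have "\<dots> = (1 + \<kappa>) * (\<Sum>b\<in>Basis. LINT z|?M. (norm (?A b z))\<^sup>2) + (1 + 1 / \<kappa>) * (\<Sum>b\<in>Basis. LINT z|?M. (norm (?C b z))\<^sup>2)"
    by (simp add: sum.distrib sum_distrib_left)
  also have "(\<Sum>b\<in>Basis. LINT z|?M. (norm (?A b z))\<^sup>2) = 2 * E0 u"
  proof -
    have "E0 u = 1 / 2 * (LINT z|?M. (\<Sum>b\<in>Basis. (norm (?A b z))\<^sup>2))" unfolding E0_def by simp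
    also have "(LINT z|?M. (\<Sum>b\<in>Basis. (norm (?A b z))\<^sup>2)) = (\<Sum>b\<in>Basis. LINT z|?M. (norm (?A b z))\<^sup>2)"
      by (rule Bochner_Integration.integral_sum) (use sA in \<open>auto simp: square_integrable_def\<close>)
    finally show ?thesis by simp
  qed
  also have "(1 + 1 / \<kappa>) * (\<Sum>b\<in>Basis. LINT z|?M. (norm (?C b z))\<^sup>2) \<le> (1 + 1 / \<kappa>) * (W12_norm unit_disc (\<lambda>z. v z - u z))\<^sup>2"
    unfolding W12_norm_sq using \<kappa> by (intro mult_left_mono) (auto intro!: integral_nonneg_AE)
  finally have "1 / 2 * (LINT z|?M. grad_sq v z) \<le>
      1 / 2 * ((1 + \<kappa>) * (2 * E0 u) + (1 + 1 / \<kappa>) * (W12_norm unit_disc (\<lambda>z. v z - u z))\<^sup>2)" by simp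
  also have "\<dots> = (1 + \<kappa>) * E0 u + (1 + 1 / \<kappa>) / 2 * (W12_norm unit_disc (\<lambda>z. v z - u z))\<^sup>2"
    by (simp add: distrib_left)
  finally show ?thesis .
qed

lemma disc_L2_le_W12_norm: "(LINT z|lebesgue_on unit_disc. (norm (w z))\<^sup>2) \<le> (W12_norm unit_disc w)\<^sup>2"
  unfolding W12_norm_sq by (auto intro!: sum_nonneg integral_nonneg_AE)

lemma lebesgue_on_Icc_integral:
  fixes h :: "real \<Rightarrow> real"
  assumes "continuous_on {a..b} h"
  shows "(LINT t|lebesgue_on {a..b}. h t) = integral {a..b} h"
  by (intro lebesgue_integral_eq_integral absolutely_integrable_imp_integrable absolutely_integrable_continuous_real assms) auto

lemma rot_action_g_H: "rot_action (- t) (g_H (cis t)) = (- 1 / 2, 0, of_real (sqrt 3 / 2))"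
  by (simp add: rot_action_eq g_H_def power2_eq_square cis_mult mult.left_commute)

text \<open>\<open>U\<close> is the continuous representative of \<open>u\<close>, so equivariance
  and unit length hold at every point of the closed disc; \<open>v\<close> is a sequence as in the
  definition of the trace.\<close>

locale trace_approximation =
  fixes u U :: "complex \<Rightarrow> R5" and v :: "nat \<Rightarrow> complex \<Rightarrow> R5"
  assumes u: "u \<in> W12 unit_disc"
    and Uc: "continuous_on (cball 0 1) U"
    and uU: "AE z in lebesgue_on unit_disc. u z = U z"
    and Urot: "\<And>\<alpha> z. z \<in> cball 0 1 \<Longrightarrow> U (cis \<alpha> * z) = rot_action \<alpha> (U z)"
    and Un: "\<And>z. z \<in> cball 0 1 \<Longrightarrow> norm (U z) = 1"
    and v: "\<And>n. smooth (v n)"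
    and conv: "(\<lambda>n. W12_norm unit_disc (\<lambda>z. v n z - u z)) \<longlonglongrightarrow> 0"
    and tr: "(\<lambda>n. LINT t|lebesgue_on {0..2 * pi}. (norm (v n (cis t) - g_H (cis t)))\<^sup>2) \<longlonglongrightarrow> 0"
begin

abbreviation f :: "real \<Rightarrow> R5" where "f r \<equiv> U (of_real r)"
abbreviation avg where "avg n \<equiv> circle_avg (v n)"
abbreviation davg where "davg n \<equiv> circle_avg_deriv (v n)"

lemma v1: "C_diff (Suc 0) (v n)"
  using v unfolding smooth_def by blast

lemma vc: "continuous_on S (v n)"
  using C_diff_imp_continuous[OF v1] continuous_on_subset by blast

lemma fc: "continuous_on {0..1} f"
  by (intro continuous_on_compose2[OF Uc] continuous_intros) auto

lemma avg_deriv: "(avg n has_vector_derivative davg n r) (at r within S)"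
  using circle_avg_has_derivative[OF v1] has_vector_derivative_at_within by blast

lemma avg_cont: "continuous_on S (avg n)"
  using avg_deriv by (rule continuous_on_vector_derivative)

lemma eventually_energy:
  assumes "\<eta> > 0"
  shows "\<forall>\<^sub>F n in sequentially. 1 / 2 * (LINT z|lebesgue_on unit_disc. grad_sq (v n) z) \<le> E0 u + \<eta>"
proof -
  \<comment> \<open>Chosen so that the relative error \<open>\<kappa> * E0 u\<close> is at most
    \<open>\<eta> / 2\<close>; the summand 1 guards against a vanishing energy.\<close>
  define \<kappa> where "\<kappa> = \<eta> / (2 * (E0 u + 1))"
  have E: "E0 u + 1 > 0" using E0_nonneg[of u] by simp
  have \<kappa>: "\<kappa> > 0" "\<kappa> * E0 u \<le> \<eta> / 2"
  proof -
    show "\<kappa> > 0" using assms E by (simp add: \<kappa>_def)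
    then have "\<kappa> * E0 u \<le> \<kappa> * (E0 u + 1)" by (intro mult_left_mono) auto
    also have "\<dots> = \<eta> / 2"
    proof -
      have "\<eta> / (2 * e) * e = \<eta> / 2" if "e > 0" for e using that by simp
      from this[OF E] show ?thesis by (simp only: \<kappa>_def)
    qed
    finally show "\<kappa> * E0 u \<le> \<eta> / 2" .
  qed
  have lim: "(\<lambda>n. (1 + 1 / \<kappa>) / 2 * (W12_norm unit_disc (\<lambda>z. v n z - u z))\<^sup>2) \<longlonglongrightarrow> (1 + 1 / \<kappa>) / 2 * 0\<^sup>2"
    by (intro tendsto_intros conv)
  have "(1 + 1 / \<kappa>) / 2 * 0\<^sup>2 < \<eta> / 2" using assms by simp
  from order_tendstoD(2)[OF lim this] show ?thesis
  proof eventually_elim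
    case (elim n)
    have "(1 + \<kappa>) * E0 u = E0 u + \<kappa> * E0 u" by (simp add: distrib_right)
    with elim show ?case
      using energy_le_of_W12_close[OF u v1 \<kappa>(1), of n] \<kappa>(2) by linarith
  qed
qed

lemma avg_energy:
  assumes "0 < \<epsilon>" "\<epsilon> < 1"
  shows "pi * integral {\<epsilon>..1} (radial_energy (avg n) (davg n)) \<le> 1 / 2 * (LINT z|lebesgue_on unit_disc. grad_sq (v n) z)"
proof -
  have rc: "continuous_on {\<epsilon>..1} (radial_energy (avg n) (davg n))"
    unfolding radial_energy_def[abs_def] using assms
    by (intro continuous_intros avg_cont continuous_on_circle_avg_deriv v1) auto
  have "integral {\<epsilon>..1} (\<lambda>r. 2 * pi * radial_energy (avg n) (davg n) r) \<le> (LINT z|lebesgue_on unit_disc. grad_sq (v n) z)"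
  proof (rule disc_integral_ge_annulus)
    show "2 * pi * radial_energy (avg n) (davg n) r \<le> r * integral {0..2 * pi} (\<lambda>t. grad_sq (v n) (of_real r * cis t))"
      if "r \<in> {\<epsilon>..1}" for r
      using radial_energy_circle_avg_le[OF v1, of r n] that assms by (simp add: field_simps)
    show "0 \<le> grad_sq (v n) z" for z by (simp add: grad_sq_def sum_nonneg)
  qed (use assms in \<open>auto intro!: continuous_on_grad_sq v1 continuous_intros rc\<close>)
  then show ?thesis by simp
qed

text \<open>\<open>U\<close> is equivariant, so \<open>f\<close> is its own circle average and the
  difference is the average of \<open>v n - U\<close>. The loss of \<open>1 / \<epsilon>\<close>
  comes from the weight \<open>r \<ge> \<epsilon>\<close> in polar coordinates.\<close>

lemma avg_L2:
  assumes "0 < \<epsilon>" "\<epsilon> < 1"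
  shows "integral {\<epsilon>..1} (\<lambda>r. (norm (avg n r - f r))\<^sup>2) \<le> (W12_norm unit_disc (\<lambda>z. v n z - u z))\<^sup>2 / \<epsilon>"
proof -
  have fe: "continuous_on {\<epsilon>..1} f" using assms by (intro continuous_on_subset[OF fc]) auto
  have c: "continuous_on {\<epsilon>..1} (\<lambda>r. (norm (avg n r - f r))\<^sup>2)" by (intro continuous_intros avg_cont fe)
  have "integral {\<epsilon>..1} (\<lambda>r. \<epsilon> * (norm (avg n r - f r))\<^sup>2) \<le> (LINT z|lebesgue_on unit_disc. (norm (v n z - U z))\<^sup>2)"
  proof (rule disc_integral_ge_annulus)
    fix r assume r: "r \<in> {\<epsilon>..1}"
    let ?d = "\<lambda>t. v n (of_real r * cis t) - U (of_real r * cis t)"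
    have Ut: "rot_action (- t) (U (of_real r * cis t)) = f r" for t
      using Urot[of "of_real r" t] r assms by (simp add: mult.commute rot_action_add)
    have cU: "continuous_on {0..2 * pi} (\<lambda>t. U (of_real r * cis t))"
      by (intro continuous_on_compose2[OF Uc] continuous_intros) (use r assms in \<open>auto simp: norm_mult\<close>)
    have cv: "continuous_on {0..2 * pi} (\<lambda>t. v n (of_real r * cis t))"
      by (intro continuous_on_compose2[OF vc[of UNIV]] continuous_intros) auto
    have "((\<lambda>t. f r) has_integral (2 * pi) *\<^sub>R f r) {0..2 * pi}"
      using has_integral_const_real[of "f r" 0 "2 * pi"] by simp
    then have "integral {0..2 * pi} (\<lambda>t. rot_action (- t) (?d t)) =
        integral {0..2 * pi} (\<lambda>t. rot_action (- t) (v n (of_real r * cis t))) - (2 * pi) *\<^sub>R f r"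
      unfolding linear_diff[OF bounded_linear.linear[OF bounded_linear_rot_action]] Ut
      by (subst Henstock_Kurzweil_Integration.integral_diff)
        (auto intro!: integrable_continuous_real continuous_on_rot_action continuous_intros cv simp: integral_unique)
    then have "avg n r - f r = (1 / (2 * pi)) *\<^sub>R integral {0..2 * pi} (\<lambda>t. rot_action (- t) (?d t))"
      by (simp add: circle_avg_def scaleR_diff_right)
    then have "(norm (avg n r - f r))\<^sup>2 \<le> (1 / (2 * pi)) * integral {0..2 * pi} (\<lambda>t. (norm (?d t))\<^sup>2)"
      using norm_circle_avg_sq_le[of ?d] cU cv by (simp add: continuous_on_diff)
    also have "\<dots> \<le> 1 * integral {0..2 * pi} (\<lambda>t. (norm (?d t))\<^sup>2)"
      using pi_gt3 by (intro mult_right_mono integral_nonneg integrable_continuous_real continuous_intros cU cv) auto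
    finally have "\<epsilon> * (norm (avg n r - f r))\<^sup>2 \<le> r * integral {0..2 * pi} (\<lambda>t. (norm (?d t))\<^sup>2)"
      using r assms by (intro mult_mono) auto
    then show "\<epsilon> * (norm (avg n r - f r))\<^sup>2 \<le> r * integral {0..2 * pi} (\<lambda>t. (norm (v n (of_real r * cis t) - U (of_real r * cis t)))\<^sup>2)" .
  qed (use assms in \<open>auto intro!: continuous_intros vc Uc c\<close>)
  also have "(LINT z|lebesgue_on unit_disc. (norm (v n z - U z))\<^sup>2) = (LINT z|lebesgue_on unit_disc. (norm (v n z - u z))\<^sup>2)"
  proof (rule integral_cong_AE)
    have m: "v n \<in> borel_measurable (lebesgue_on unit_disc)" "U \<in> borel_measurable (lebesgue_on unit_disc)"
      by (intro continuous_imp_measurable_on_sets_lebesgue disc_sets_lebesgue vc continuous_on_subset[OF Uc] ball_subset_cball)+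
    have "u \<in> borel_measurable (lebesgue_on unit_disc)" using u by (auto simp: W12_def square_integrable_def)
    with m show "(\<lambda>z. (norm (v n z - U z))\<^sup>2) \<in> borel_measurable (lebesgue_on unit_disc)"
      "(\<lambda>z. (norm (v n z - u z))\<^sup>2) \<in> borel_measurable (lebesgue_on unit_disc)" by measurable
    show "AE z in lebesgue_on unit_disc. (norm (v n z - U z))\<^sup>2 = (norm (v n z - u z))\<^sup>2"
      using uU by eventually_elim simp
  qed
  also have "\<dots> \<le> (W12_norm unit_disc (\<lambda>z. v n z - u z))\<^sup>2" by (rule disc_L2_le_W12_norm)
  finally show ?thesis using assms by (simp add: pos_le_divide_eq mult.commute)
qed

text \<open>Away from the origin the weight \<open>r\<close> is at least \<open>\<epsilon>\<close>,
  so the energy bounds the averaged derivatives in the mean square by the constant \<open>C\<close>,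
  and closeness in the mean square improves to uniform closeness.\<close>

lemma eventually_uniform:
  assumes \<epsilon>: "0 < \<epsilon>" "\<epsilon> < 1" and \<eta>: "\<eta> > 0"
  shows "\<forall>\<^sub>F n in sequentially. \<forall>r\<in>{\<epsilon>..1}. norm (avg n r - f r) \<le> \<eta>"
proof -
  define C where "C = (E0 u + 1) / \<epsilon>"
  have C: "C \<ge> 0" using E0_nonneg[of u] \<epsilon> by (simp add: C_def)
  have fe: "continuous_on {\<epsilon>..1} f" using \<epsilon> by (intro continuous_on_subset[OF fc]) auto
  obtain e where e: "e > 0" "\<And>g g' r. (\<And>r. r \<in> {\<epsilon>..1} \<Longrightarrow> (g has_vector_derivative g' r) (at r within {\<epsilon>..1})) \<Longrightarrow>
    continuous_on {\<epsilon>..1} g' \<Longrightarrow> integral {\<epsilon>..1} (\<lambda>r. (norm (g' r))\<^sup>2) \<le> C \<Longrightarrow>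
    integral {\<epsilon>..1} (\<lambda>r. (norm (g r - f r))\<^sup>2) \<le> e \<Longrightarrow> r \<in> {\<epsilon>..1} \<Longrightarrow> norm (g r - f r) \<le> \<eta>"
    using L2_close_imp_uniformly_close[OF fe \<epsilon>(2) C \<eta>] by blast
  have "(\<lambda>n. (W12_norm unit_disc (\<lambda>z. v n z - u z))\<^sup>2 / \<epsilon>) \<longlonglongrightarrow> 0\<^sup>2 / \<epsilon>"
    using \<epsilon> by (intro tendsto_intros conv) auto
  then have "\<forall>\<^sub>F n in sequentially. (W12_norm unit_disc (\<lambda>z. v n z - u z))\<^sup>2 / \<epsilon> < e"
    using e(1) by (intro order_tendstoD(2)) auto
  moreover have "\<forall>\<^sub>F n in sequentially. 1 / 2 * (LINT z|lebesgue_on unit_disc. grad_sq (v n) z) \<le> E0 u + 1"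
    by (rule eventually_energy) simp
  ultimately show ?thesis
  proof eventually_elim
    case (elim n)
    have dc: "continuous_on {\<epsilon>..1} (davg n)" by (rule continuous_on_circle_avg_deriv[OF v1])
    have rc: "continuous_on {\<epsilon>..1} (radial_energy (avg n) (davg n))"
      unfolding radial_energy_def[abs_def] using \<epsilon> by (intro continuous_intros avg_cont dc) auto
    have "integral {\<epsilon>..1} (\<lambda>r. \<epsilon> * (norm (davg n r))\<^sup>2) \<le> integral {\<epsilon>..1} (radial_energy (avg n) (davg n))"
    proof (intro integral_le integrable_continuous_real rc continuous_intros dc)
      fix r assume r: "r \<in> {\<epsilon>..1}"
      have "\<epsilon> * (norm (davg n r))\<^sup>2 \<le> r * (norm (davg n r))\<^sup>2" using r by (intro mult_right_mono) auto
      moreover have "0 \<le> angular_energy (avg n r) / r" using r \<epsilon> by (intro divide_nonneg_nonneg angular_energy_nonneg) auto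
      ultimately show "\<epsilon> * (norm (davg n r))\<^sup>2 \<le> radial_energy (avg n) (davg n) r" by (simp add: radial_energy_def)
    qed
    then have le: "\<epsilon> * integral {\<epsilon>..1} (\<lambda>r. (norm (davg n r))\<^sup>2) \<le> integral {\<epsilon>..1} (radial_energy (avg n) (davg n))" by simp
    have "0 \<le> \<epsilon> * integral {\<epsilon>..1} (\<lambda>r. (norm (davg n r))\<^sup>2)"
      using \<epsilon> by (intro mult_nonneg_nonneg integral_nonneg integrable_continuous_real continuous_intros dc) auto
    with le have "1 * integral {\<epsilon>..1} (radial_energy (avg n) (davg n)) \<le> pi * integral {\<epsilon>..1} (radial_energy (avg n) (davg n))"
      using pi_gt3 by (intro mult_right_mono) auto
    with le avg_energy[OF \<epsilon>, of n] elim(2) have "\<epsilon> * integral {\<epsilon>..1} (\<lambda>r. (norm (davg n r))\<^sup>2) \<le> E0 u + 1" by linarith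
    then have "integral {\<epsilon>..1} (\<lambda>r. (norm (davg n r))\<^sup>2) \<le> C" using \<epsilon> by (simp add: C_def pos_le_divide_eq mult.commute)
    moreover have "integral {\<epsilon>..1} (\<lambda>r. (norm (avg n r - f r))\<^sup>2) \<le> e" using avg_L2[OF \<epsilon>, of n] elim(1) by linarith
    ultimately show ?case using e(2)[of "avg n" "davg n"] avg_deriv dc by blast
  qed
qed

text \<open>This reconciles the trace with the continuous representative: uniform convergence of the
  averages includes \<open>r = 1\<close>, and there the averages also tend to that of
  \<open>g_H\<close>, by the convergence on the circle in the definition of the trace.\<close>

lemma f_1: "f 1 = (- 1 / 2, 0, of_real (sqrt 3 / 2))" (is "_ = ?p")
proof -
  have "norm (f 1 - ?p) \<le> 0"
  proof (rule field_le_epsilon)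
    fix e :: real assume e: "e > 0"
    then have "\<forall>\<^sub>F n in sequentially. \<forall>r\<in>{1/2..1}. norm (avg n r - f r) \<le> e / 2"
      by (intro eventually_uniform) auto
    moreover have "\<forall>\<^sub>F n in sequentially. (LINT t|lebesgue_on {0..2 * pi}. (norm (v n (cis t) - g_H (cis t)))\<^sup>2) < (e / 2)\<^sup>2"
      using e by (intro order_tendstoD(2)[OF tr]) auto
    ultimately have "\<forall>\<^sub>F n in sequentially. norm (f 1 - ?p) \<le> e"
    proof eventually_elim
      case (elim n)
      let ?d = "\<lambda>t. v n (cis t) - g_H (cis t)"
      have cg: "continuous_on {0..2 * pi} (\<lambda>t. g_H (cis t))" unfolding g_H_def by (intro continuous_intros)
      have cv: "continuous_on {0..2 * pi} (\<lambda>t. v n (cis t))"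
        by (intro continuous_on_compose2[OF vc[of UNIV]] continuous_intros) auto
      have "((\<lambda>t. ?p) has_integral (2 * pi) *\<^sub>R ?p) {0..2 * pi}"
        using has_integral_const_real[of ?p 0 "2 * pi"] by simp
      then have "integral {0..2 * pi} (\<lambda>t. rot_action (- t) (?d t)) =
          integral {0..2 * pi} (\<lambda>t. rot_action (- t) (v n (cis t))) - (2 * pi) *\<^sub>R ?p"
        unfolding linear_diff[OF bounded_linear.linear[OF bounded_linear_rot_action]] rot_action_g_H
        by (subst Henstock_Kurzweil_Integration.integral_diff)
          (auto intro!: integrable_continuous_real continuous_on_rot_action continuous_intros cv simp: integral_unique)
      then have "avg n 1 - ?p = (1 / (2 * pi)) *\<^sub>R integral {0..2 * pi} (\<lambda>t. rot_action (- t) (?d t))"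
        by (simp add: circle_avg_def scaleR_diff_right del: scaleR_Pair)
      then have "(norm (avg n 1 - ?p))\<^sup>2 \<le> (1 / (2 * pi)) * integral {0..2 * pi} (\<lambda>t. (norm (?d t))\<^sup>2)"
        using norm_circle_avg_sq_le[of ?d] cg cv by (simp add: continuous_on_diff)
      also have "\<dots> \<le> 1 * integral {0..2 * pi} (\<lambda>t. (norm (?d t))\<^sup>2)"
        using pi_gt3 by (intro mult_right_mono integral_nonneg integrable_continuous_real continuous_intros cg cv) auto
      also have "\<dots> \<le> (e / 2)\<^sup>2"
        using elim(2) by (subst (asm) lebesgue_on_Icc_integral) (auto intro!: continuous_intros cg cv)
      finally have 1: "norm (avg n 1 - ?p) \<le> e / 2" by (rule power2_le_imp_le) (use e in simp)
      have 2: "norm (avg n 1 - f 1) \<le> e / 2" by (rule bspec[OF elim(1)]) simp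
      have tri: "norm (x - p) \<le> norm (y - p) + norm (y - x)" for x y p :: R5
        using norm_triangle_ineq4[of "y - p" "y - x"] by simp
      show ?case using order_trans[OF tri add_mono[OF 1 2]] by (simp only: field_sum_of_halves)
    qed
    then show "norm (f 1 - ?p) \<le> 0 + e" by (simp add: eventually_const_iff)
  qed
  then show ?thesis by simp
qed

text \<open>The averages lie close to the sphere but not on it. Normalizing them costs at most the
  factor \<open>1 / (1 - x)\<^sup>2\<close> in energy, where \<open>x\<close> bounds the
  distance.\<close>

lemma sphere_approximation:
  assumes \<epsilon>: "0 < \<epsilon>" "\<epsilon> < 1" and \<eta>: "\<eta> > 0"
  shows "\<exists>g g'. (\<forall>r\<in>{\<epsilon>..1}. (g has_vector_derivative g' r) (at r within {\<epsilon>..1}) \<and> norm (g r) = 1 \<and> norm (g r - f r) \<le> \<eta>) \<and>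
      continuous_on {\<epsilon>..1} g' \<and> pi * integral {\<epsilon>..1} (radial_energy g g') \<le> E0 u + \<eta>"
proof -
  define E where "E = E0 u + 1"
  have E: "E \<ge> 1" using E0_nonneg[of u] by (simp add: E_def)
  \<comment> \<open>The bound \<open>1 / 4\<close> serves the estimate of the factor by
    \<open>1 + 4 * x\<close>, \<open>2 * x \<le> \<eta>\<close> covers averaging and normalizing,
    and \<open>8 * x * E \<le> \<eta>\<close> limits the gain of energy to
    \<open>\<eta> / 2\<close>.\<close>
  define x where "x = Min {1 / 4, \<eta> / 2, \<eta> / (8 * E)}"
  have x: "0 < x" "x \<le> 1 / 4" "2 * x \<le> \<eta>" "8 * x * E \<le> \<eta>"
  proof -
    show "0 < x" "x \<le> 1 / 4" using E \<eta> by (auto simp: x_def)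
    have "x \<le> \<eta> / 2" "x \<le> \<eta> / (8 * E)" unfolding x_def by (rule Min_le; simp)+
    then show "2 * x \<le> \<eta>" "8 * x * E \<le> \<eta>" using E by (auto simp: pos_le_divide_eq mult_ac)
  qed
  define y where "y = min 1 (\<eta> / 2)"
  have y: "y > 0" "y \<le> 1" "y \<le> \<eta> / 2" using \<eta> by (auto simp: y_def)
  have "\<forall>\<^sub>F n in sequentially. (\<forall>r\<in>{\<epsilon>..1}. norm (avg n r - f r) \<le> x) \<and> 1 / 2 * (LINT z|lebesgue_on unit_disc. grad_sq (v n) z) \<le> E0 u + y"
    by (intro eventually_conj eventually_uniform eventually_energy \<epsilon> x y)
  from eventually_happens'[OF sequentially_bot this]
  obtain n where n: "\<And>r. r \<in> {\<epsilon>..1} \<Longrightarrow> norm (avg n r - f r) \<le> x" "1 / 2 * (LINT z|lebesgue_on unit_disc. grad_sq (v n) z) \<le> E0 u + y"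
    by blast
  have fn: "norm (f r) = 1" if "r \<in> {\<epsilon>..1}" for r using that \<epsilon> by (intro Un) auto
  have gn: "\<bar>norm (avg n r) - 1\<bar> \<le> x" if "r \<in> {\<epsilon>..1}" for r
    using norm_triangle_ineq3[of "avg n r" "f r"] fn[OF that] n(1)[OF that] by simp
  have nz: "avg n r \<noteq> 0" if "r \<in> {\<epsilon>..1}" for r using gn[OF that] x by auto
  have dc: "continuous_on {\<epsilon>..1} (davg n)" by (rule continuous_on_circle_avg_deriv[OF v1])
  obtain h h' where h: "\<And>r. h r = avg n r /\<^sub>R norm (avg n r)"
    "\<And>r. r \<in> {\<epsilon>..1} \<Longrightarrow> (h has_vector_derivative h' r) (at r within {\<epsilon>..1})" "continuous_on {\<epsilon>..1} h'"
    "\<And>r. r \<in> {\<epsilon>..1} \<Longrightarrow> (norm (avg n r))\<^sup>2 * radial_energy h h' r \<le> radial_energy (avg n) (davg n) r"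
    using normalized_curve[OF avg_deriv dc \<epsilon>(1) nz] by blast
  have hn: "norm (h r) = 1" if "r \<in> {\<epsilon>..1}" for r using nz[OF that] by (simp add: h(1))
  have hf: "norm (h r - f r) \<le> \<eta>" if r: "r \<in> {\<epsilon>..1}" for r
  proof -
    define m where "m = norm (avg n r)"
    have a: "avg n r = m *\<^sub>R h r" using nz[OF r] by (simp add: h(1) m_def)
    have "h r - avg n r = (1 - m) *\<^sub>R h r" unfolding a by (simp add: scaleR_diff_left)
    then have "norm (h r - avg n r) = \<bar>m - 1\<bar>" using hn[OF r] by simp
    then have "norm (h r - avg n r) \<le> x" using gn[OF r] by (simp add: m_def)
    moreover have "h r - f r = (h r - avg n r) + (avg n r - f r)" by simp
    ultimately show ?thesis using n(1)[OF r] x(3) norm_triangle_ineq[of "h r - avg n r" "avg n r - f r"] by simp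
  qed
  have hc: "continuous_on {\<epsilon>..1} h" using h(2) by (rule continuous_on_vector_derivative)
  have rc: "continuous_on {\<epsilon>..1} (radial_energy (avg n) (davg n))" "continuous_on {\<epsilon>..1} (radial_energy h h')"
    unfolding radial_energy_def[abs_def] using \<epsilon> by (intro continuous_intros avg_cont dc hc h(3); auto)+
  have "integral {\<epsilon>..1} (\<lambda>r. (1 - x)\<^sup>2 * radial_energy h h' r) \<le> integral {\<epsilon>..1} (radial_energy (avg n) (davg n))"
  proof (intro integral_le integrable_continuous_real continuous_intros rc)
    fix r assume r: "r \<in> {\<epsilon>..1}"
    have "0 \<le> radial_energy h h' r"
      using r \<epsilon> unfolding radial_energy_def by (intro add_nonneg_nonneg divide_nonneg_nonneg angular_energy_nonneg) auto
    moreover have "(1 - x)\<^sup>2 \<le> (norm (avg n r))\<^sup>2" using gn[OF r] x by (intro power_mono) auto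
    ultimately show "(1 - x)\<^sup>2 * radial_energy h h' r \<le> radial_energy (avg n) (davg n) r"
      using h(4)[OF r] by (meson mult_right_mono order_trans)
  qed
  then have "pi * ((1 - x)\<^sup>2 * integral {\<epsilon>..1} (radial_energy h h')) \<le> pi * integral {\<epsilon>..1} (radial_energy (avg n) (davg n))"
    by (intro mult_left_mono) auto
  also have "\<dots> \<le> E0 u + y" using avg_energy[OF \<epsilon>, of n] n(2) by linarith
  finally have le: "(1 - x)\<^sup>2 * (pi * integral {\<epsilon>..1} (radial_energy h h')) \<le> E0 u + y" by (simp add: mult_ac)
  \<comment> \<open>The right side exceeds 1 by \<open>x * (2 - 7 * x) + 4 * x ^ 3\<close>.\<close>
  have "1 \<le> (1 + 4 * x) * (1 - x)\<^sup>2"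
  proof -
    have "0 \<le> x * (2 - 7 * x)" using x by (intro mult_nonneg_nonneg) auto
    moreover have "0 \<le> 4 * x ^ 3" using x by simp
    ultimately show ?thesis by (simp add: power2_eq_square power3_eq_cube algebra_simps)
  qed
  moreover have "0 \<le> pi * integral {\<epsilon>..1} (radial_energy h h')"
    using \<epsilon> unfolding radial_energy_def
    by (intro mult_nonneg_nonneg integral_nonneg integrable_continuous_real rc(2)[unfolded radial_energy_def[abs_def]]
        add_nonneg_nonneg divide_nonneg_nonneg angular_energy_nonneg) auto
  ultimately have "1 * (pi * integral {\<epsilon>..1} (radial_energy h h')) \<le> (1 + 4 * x) * (1 - x)\<^sup>2 * (pi * integral {\<epsilon>..1} (radial_energy h h'))"
    by (intro mult_right_mono)
  also have "\<dots> \<le> (1 + 4 * x) * (E0 u + y)" unfolding mult.assoc using le x by (intro mult_left_mono) auto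
  also have "\<dots> \<le> E0 u + \<eta>"
  proof -
    have "4 * x * (E0 u + y) \<le> 4 * x * E" using x y by (intro mult_left_mono) (auto simp: E_def)
    then show ?thesis using x(4) y by (simp add: distrib_right)
  qed
  finally have "pi * integral {\<epsilon>..1} (radial_energy h h') \<le> E0 u + \<eta>" by simp
  then show ?thesis using h(2,3) hn hf by blast
qed

lemma approximable_profile:
  assumes "calibration (U 0) > 0"
  shows "approximable_profile f (E0 u)"
proof
  show "continuous_on {0..1} f" by (rule fc)
  show "norm (f r) = 1" if "r \<in> {0..1}" for r using that by (intro Un) auto
  show "calibration (f 1) = 0" unfolding f_1 by (simp add: calibration_def)
  show "calibration (f 0) > 0" using assms by simp
qed (rule sphere_approximation)

end

text \<open>Identities that hold almost everywhere for \<open>u\<close> hold everywhere in the open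
  disc for its continuous representative, and by continuity up to the boundary.\<close>

lemma trace_approximation_exists:
  assumes "u \<in> A_at_origin p"
  obtains U v where "trace_approximation u U v" "U 0 = p"
proof -
  from assms obtain U where U: "u \<in> A_sym" "continuous_on (cball 0 1) U" "AE z in lebesgue_on unit_disc. u z = U z" "U 0 = p"
    unfolding A_at_origin_def by auto
  have A: "u \<in> W12 unit_disc" "AE z in lebesgue_on unit_disc. u z \<in> sphere 0 1" "equivariant u" "has_trace u g_H"
    using U(1) by (auto simp: A_sym_def)
  obtain v where v: "\<And>n. smooth (v n)" "(\<lambda>n. W12_norm unit_disc (\<lambda>z. v n z - u z)) \<longlonglongrightarrow> 0"
    "(\<lambda>n. LINT t|lebesgue_on {0..2 * pi}. (norm (v n (cis t) - g_H (cis t)))\<^sup>2) \<longlonglongrightarrow> 0"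
    using A(4) unfolding has_trace_def by blast
  have cl: "closure unit_disc = cball 0 1" by simp
  have Urc: "continuous_on (cball 0 1) (\<lambda>z. U (cis a * z))" for a
    by (intro continuous_on_compose2[OF U(2)] continuous_intros) (auto simp: norm_mult)
  have Ud: "continuous_on unit_disc U" by (intro continuous_on_subset[OF U(2)] ball_subset_cball)
  have rot: "U (cis a * z) = rot_action a (U z)" if z: "z \<in> cball 0 1" for a z
  proof -
    have "AE z in lebesgue_on unit_disc. u (cis a * z) = rot_action a (u z)" using A(3) by (auto simp: equivariant_def)
    then have "AE z in lebesgue_on unit_disc. U (cis a * z) = rot_action a (U z)"
      using U(3) AE_rotate_disc[OF U(3), of a] by eventually_elim simp
    then have in_disc: "U (cis a * z) = rot_action a (U z)" if "z \<in> unit_disc" for z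
      by (rule continuous_AE_eq[where F="\<lambda>z. U (cis a * z)" and G="\<lambda>z. rot_action a (U z)", rotated 2, OF _ that])
        (auto intro!: continuous_on_rot_action Ud continuous_intros continuous_on_subset[OF Urc ball_subset_cball])
    define D where "D z = U (cis a * z) - rot_action a (U z)" for z
    have "D z = 0"
    proof (rule continuous_constant_on_closure[of unit_disc D 0])
      show "continuous_on (closure unit_disc) D"
        unfolding D_def cl by (intro continuous_intros continuous_on_rot_action Urc U(2))
      show "D z = 0" if "z \<in> unit_disc" for z unfolding D_def using in_disc[OF that] by simp
      show "z \<in> closure unit_disc" using z unfolding cl .
    qed
    then show ?thesis by (simp add: D_def)
  qed
  have nrm: "norm (U z) = 1" if z: "z \<in> cball 0 1" for z
  proof -
    have "AE z in lebesgue_on unit_disc. norm (U z) = 1" using A(2) U(3) by eventually_elim simp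
    then have in_disc: "norm (U z) = 1" if "z \<in> unit_disc" for z
      by (rule continuous_AE_eq[where F="\<lambda>z. norm (U z)" and G="\<lambda>z. 1", rotated 2, OF _ that])
        (auto intro!: continuous_intros Ud)
    show ?thesis
    proof (rule continuous_constant_on_closure[of unit_disc "\<lambda>z. norm (U z)" 1])
      show "continuous_on (closure unit_disc) (\<lambda>z. norm (U z))" unfolding cl by (intro continuous_intros U(2))
      show "z \<in> closure unit_disc" using z unfolding cl .
    qed (rule in_disc)
  qed
  have "trace_approximation u U v"
    using A(1) U(2,3) rot nrm v by unfold_locales
  then show thesis using that U(4) by blast
qed

section \<open>Minimality and uniqueness\<close>

lemma calibration_poles: "calibration (1, 0, 0) = 3" "calibration (- 1, 0, 0) = 1"
  by (simp_all add: calibration_def)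

lemma energy_lower_bound:
  assumes "u \<in> A_at_origin p" "calibration p > 0"
  shows "2 * pi * calibration p \<le> E0 u"
proof -
  obtain U v where t: "trace_approximation u U v" "U 0 = p"
    by (rule trace_approximation_exists[OF assms(1)])
  have "approximable_profile (\<lambda>r. U (of_real r)) (E0 u)"
    by (rule trace_approximation.approximable_profile[OF t(1)]) (simp add: t(2) assms(2))
  from approximable_profile.energy_ge[OF this] show ?thesis by (simp add: t(2))
qed

lemma minimizer_flow_profile:
  assumes "u \<in> A_at_origin p" "calibration p > 0" "E0 u \<le> 2 * pi * calibration p"
  obtains U where "flow_profile (\<lambda>r. U (of_real r))" "U 0 = p" "AE z in lebesgue_on unit_disc. u z = U z"
    "\<And>\<alpha> z. z \<in> cball 0 1 \<Longrightarrow> U (cis \<alpha> * z) = rot_action \<alpha> (U z)"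
proof -
  obtain U v where t: "trace_approximation u U v" "U 0 = p"
    by (rule trace_approximation_exists[OF assms(1)])
  interpret trace_approximation u U v by (rule t(1))
  let ?f = "\<lambda>r. U (of_real r)"
  have a: "approximable_profile ?f (E0 u)"
    by (rule approximable_profile) (simp add: t(2) assms(2))
  have m: "E0 u \<le> 2 * pi * calibration (?f 0)" using assms(3) by (simp add: t(2))
  have "flow_profile ?f"
  proof
    show "continuous_on {0..1} ?f" by (rule fc)
    show "norm (?f r) = 1" if "r \<in> {0..1}" for r using that by (intro Un) simp
    show "?f 1 = (- 1 / 2, 0, of_real (sqrt 3 / 2))" by (rule f_1)
    show "calibration (?f r) > 0" if "0 \<le> r" "r < 1" for r
      by (rule approximable_profile.no_early_zero[OF a m that])
    show "(?f has_vector_derivative - (calib_field (?f r) /\<^sub>R r)) (at r)" if "0 < r" "r < 1" for r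
      by (rule approximable_profile.gradient_flow[OF a m that])
  qed
  then show thesis using that t(2) uU Urot by blast
qed

text \<open>Every nonzero point is a rotation of a point on the positive real axis, so the two
  symmetric maps need to be compared only there and at the origin.\<close>

lemma equivariant_eq_on_disc:
  assumes U: "\<And>\<alpha> z. z \<in> cball 0 1 \<Longrightarrow> U (cis \<alpha> * z) = rot_action \<alpha> (U z)"
    and w: "\<And>\<alpha> z. w (cis \<alpha> * z) = rot_action \<alpha> (w z)"
    and eq: "\<And>r. 0 < r \<Longrightarrow> r < 1 \<Longrightarrow> U (of_real r) = w (of_real r)" "U 0 = w 0"
    and z: "z \<in> unit_disc"
  shows "U z = w z"
proof (cases "z = 0")
  case True
  then show ?thesis using eq(2) by simp
next
  case False
  have z': "z = cis (Arg z) * of_real (cmod z)"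
    using rcis_cmod_Arg[of z] by (simp add: rcis_def mult.commute)
  have "U (of_real (cmod z)) = w (of_real (cmod z))" using False z by (intro eq(1)) auto
  moreover have "of_real (cmod z) \<in> cball (0 :: complex) 1" using z by simp
  ultimately have "U (cis (Arg z) * of_real (cmod z)) = w (cis (Arg z) * of_real (cmod z))"
    by (simp only: U w)
  then show ?thesis using z' by simp
qed

lemma minimizer_S:
  assumes u: "u \<in> A_S" and E: "E0 u \<le> 2 * pi"
  shows "AE z in lebesgue_on unit_disc. u z = u_S z"
proof -
  obtain U where U: "flow_profile (\<lambda>r. U (of_real r))" "U 0 = (- 1, 0, 0)"
    "AE z in lebesgue_on unit_disc. u z = U z"
    "\<And>\<alpha> z. z \<in> cball 0 1 \<Longrightarrow> U (cis \<alpha> * z) = rot_action \<alpha> (U z)"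
    by (rule minimizer_flow_profile[OF u[unfolded A_S_def]]) (use E calibration_poles in auto)
  have "U z = u_S z" if "z \<in> unit_disc" for z
    using U(4) u_S_rot _ _ that
  proof (rule equivariant_eq_on_disc)
    show "U (of_real r) = u_S (of_real r)" if "0 < r" "r < 1" for r
      using flow_profile.south_solution[OF U(1) _ that] U(2) by simp
    show "U 0 = u_S 0" by (simp add: U(2) u_S_def)
  qed
  with U(3) show ?thesis by (auto simp: AE_lebesgue_on_iff_negligible disc_sets_lebesgue elim!: negligible_subset)
qed

lemma minimizer_N:
  assumes u: "u \<in> A_N" and E: "E0 u \<le> 6 * pi"
  obtains \<mu> where "AE z in lebesgue_on unit_disc. u z = u_N \<mu> z"
proof -
  obtain U where U: "flow_profile (\<lambda>r. U (of_real r))" "U 0 = (1, 0, 0)"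
    "AE z in lebesgue_on unit_disc. u z = U z"
    "\<And>\<alpha> z. z \<in> cball 0 1 \<Longrightarrow> U (cis \<alpha> * z) = rot_action \<alpha> (U z)"
    by (rule minimizer_flow_profile[OF u[unfolded A_N_def]]) (use E calibration_poles in auto)
  obtain \<mu> where \<mu>: "\<And>r. 0 < r \<Longrightarrow> r < 1 \<Longrightarrow> U (of_real r) = u_N \<mu> (of_real r)"
    using flow_profile.north_solution[OF U(1)] U(2) by auto
  have "U z = u_N \<mu> z" if "z \<in> unit_disc" for z
    using U(4) u_N_rot \<mu> _ that
  proof (rule equivariant_eq_on_disc)
    show "U 0 = u_N \<mu> 0" by (simp add: U(2) u_N_def D_N_def)
  qed
  with U(3) show thesis
    by (intro that) (auto simp: AE_lebesgue_on_iff_negligible disc_sets_lebesgue elim!: negligible_subset)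
qed

theorem theorem4p4:
  shows "(\<exists>m_S m_N. has_minimum E0 A_S m_S \<and> has_minimum E0 A_N m_N \<and>
            2 * pi = m_S \<and> m_S < m_N \<and> m_N = 6 * pi)
       \<and> (\<forall>u. is_arg_min E0 (\<lambda>v. v \<in> A_S) u \<longleftrightarrow>
              (AE z in lebesgue_on unit_disc. u z = u_S z))
       \<and> (\<forall>u. is_arg_min E0 (\<lambda>v. v \<in> A_N) u \<longleftrightarrow>
              (\<exists>\<mu>\<^sub>1 :: complex. AE z in lebesgue_on unit_disc. u z = u_N \<mu>\<^sub>1 z))"
proof -
  have S: "2 * pi \<le> E0 u" if "u \<in> A_S" for u
    using energy_lower_bound[OF that[unfolded A_S_def]] by (simp add: calibration_poles)
  have N: "6 * pi \<le> E0 u" if "u \<in> A_N" for u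
    using energy_lower_bound[OF that[unfolded A_N_def]] by (simp add: calibration_poles)
  have uS: "u_S \<in> A_S" "E0 u_S = 2 * pi" by (simp_all add: u_S_mem E0_u_S)
  \<comment> \<open>The parameter 0 is an arbitrary member of the family; all members have energy
    \<open>6 * pi\<close>.\<close>
  have uN: "u_N 0 \<in> A_N" "E0 (u_N 0) = 6 * pi" by (simp_all add: u_N_mem[of _ 0] E0_u_N[of _ 0])
  have "has_minimum E0 A_S (2 * pi)" "has_minimum E0 A_N (6 * pi)"
    unfolding has_minimum_def using S N uS uN by blast+
  moreover have "is_arg_min E0 (\<lambda>v. v \<in> A_S) u \<longleftrightarrow> (AE z in lebesgue_on unit_disc. u z = u_S z)" for u
  proof
    assume "is_arg_min E0 (\<lambda>v. v \<in> A_S) u"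
    then have "u \<in> A_S" "E0 u \<le> 2 * pi" using uS by (force simp: is_arg_min_def)+
    then show "AE z in lebesgue_on unit_disc. u z = u_S z" by (rule minimizer_S)
  next
    assume u: "AE z in lebesgue_on unit_disc. u z = u_S z"
    show "is_arg_min E0 (\<lambda>v. v \<in> A_S) u"
      unfolding is_arg_min_def using u_S_mem[OF u] E0_u_S[OF u] S by (auto simp: not_less)
  qed
  moreover have "is_arg_min E0 (\<lambda>v. v \<in> A_N) u \<longleftrightarrow>
      (\<exists>\<mu>. AE z in lebesgue_on unit_disc. u z = u_N \<mu> z)" for u
  proof
    assume "is_arg_min E0 (\<lambda>v. v \<in> A_N) u"
    then have "u \<in> A_N" "E0 u \<le> 6 * pi" using uN by (force simp: is_arg_min_def)+
    then show "\<exists>\<mu>. AE z in lebesgue_on unit_disc. u z = u_N \<mu> z" using minimizer_N by blast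
  next
    assume "\<exists>\<mu>. AE z in lebesgue_on unit_disc. u z = u_N \<mu> z"
    then obtain \<mu> where u: "AE z in lebesgue_on unit_disc. u z = u_N \<mu> z" ..
    show "is_arg_min E0 (\<lambda>v. v \<in> A_N) u"
      unfolding is_arg_min_def using u_N_mem[OF u] E0_u_N[OF u] N by (auto simp: not_less)
  qed
  ultimately show ?thesis by (intro conjI exI[of _ "2 * pi"] exI[of _ "6 * pi"]) auto
qed

end
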